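(* The assignment $$F_{ij}\mapsto\frac14\Big(s_{ij}^{(1)}-s_{ij}^{\prime\,(1)}\Big)$$ defines an embedding of algebras $\mathrm{U}(\mathfrak{g}_N)\hookrightarrow\mathrm{B}(\mathfrak{g}_N)$. Moreover, the homomorphism $\mathrm{B}(\mathfrak{g}_N)\to\mathrm{U}(\mathfrak{g}_N)$ given by $$S(u)\mapsto\frac{u+F-N/4}{u-F+N/4}=1+2\sum_{r=1}^{\infty}\Big(F-\frac{N}{4}\Big)^{r}u^{-r}$$ is identical on $\mathrm{U}(\mathfrak{g}_N)$ (regarded as a subalgebra of $\mathrm{B}(\mathfrak{g}_N)$ via this embedding).
   Context: Let $G=[g_{ij}]$ be a nonsingular symmetric or skew-symmetric complex $N\times N$ matrix ($N$ even in the skew-symmetric case), and $G^{-1}=[\overline g_{ij}]$. In double signs the upper sign refers to the symmetric case and the lower one to the skew-symmetric case. Let $E_{ij}$ be the standard basis of $\mathfrak{gl}_N$ and $$F_{ij}=E_{ij}-\sum_{k,l=1}^N g_{ik}\,\overline g_{lj}\,E_{lk}.$$ $\mathfrak{g}_N$ denotes the Lie subalgebra of $\mathfrak{gl}_N$ spanned by the $F_{ij}$ (isomorphic to $\mathfrak{o}_N$ in the symmetric case and $\mathfrak{sp}_N$ in the skew-symmetric case). Let $F=[F_{ij}]=\sum_{i,j}e_{ij}\otimes F_{ij}\in\mathrm{End}\,\mathbb{C}^N\otimes\mathrm{U}(\mathfrak{g}_N)$, where $e_{ij}$ are the matrix units. Let $P=\sum_{i,j}e_{ij}\otimes e_{ji}$,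 $P^t=\sum_{i,j}e_{ij}\otimes e_{ij}$ and $Q=G_1P^tG_1^{-1}$, where $G_1=G\otimes1$. Set $\kappa=N/2\mp1$ and $R(u)=1-\frac{P}{u}+\frac{Q}{u-\kappa}$. The reflection algebra $\mathrm{B}(\mathfrak{g}_N)$ is the unital associative algebra generated by elements $s_{ij}^{(r)}$, $1\leqslant i,j\leqslant N$, $r\geqslant1$, subject to the relations (of formal series in $u^{-1},v^{-1}$) $$R(u-v)\,S_1(u)\,R(u+v)\,S_2(v)=S_2(v)\,R(u+v)\,S_1(u)\,R(u-v),\qquad S(u)\,S(-u)=1,$$ where $s_{ij}(u)=\delta_{ij}+\sum_{r\geqslant1}s_{ij}^{(r)}u^{-r}$, $S(u)=\sum_{i,j}e_{ij}\otimes s_{ij}(u)$, $S_1(u)=\sum e_{ij}\otimes1\otimes s_{ij}(u)$, $S_2(u)=\sum1\otimes e_{ij}\otimes s_{ij}(u)$. The series $s'_{ij}(u)=\delta_{ij}+\sum_{r\geqslant1}s_{ij}^{\prime\,(r)}u^{-r}$ are the entries of the matrix $S'(u)=G\,S^t(u)\,G^{-1}$, where $t$ is the standard matrix transposition. *)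

theory Defs
  imports
    "HOL-Analysis.Analysis"
    "HOL-Library.Poly_Mapping"
    "HOL-Computational_Algebra.Formal_Laurent_Series"
    "HOL-Algebra.QuotRing"
    "HOL-Algebra.Module"
begin

section \<open>Free algebras and algebras given by generators and relations\<close>

datatype 'x free_monoid = Word (letters: "'x list")

instantiation free_monoid :: (type) monoid_add
begin

definition zero_free_monoid :: "'x free_monoid"
  where "zero_free_monoid = Word []"

definition plus_free_monoid :: "'x free_monoid \<Rightarrow> 'x free_monoid \<Rightarrow> 'x free_monoid"
  where "plus_free_monoid v w = Word (letters v @ letters w)"

instance
  by standard (simp_all add: zero_free_monoid_def plus_free_monoid_def)

end

text \<open>
  The monoid algebra of the free monoid, i.e. noncommutative polynomials over the complex numbers.
  The (noncommutative) unital ring structure is the convolution product on finitely supported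
  functions from \<^theory>\<open>HOL-Library.Poly_Mapping\<close>.
\<close>

type_synonym 'x free_alg = "'x free_monoid \<Rightarrow>\<^sub>0 complex"

definition gen :: "'x \<Rightarrow> 'x free_alg"
  where "gen x = Poly_Mapping.single (Word [x]) 1"

definition scal :: "complex \<Rightarrow> 'x free_alg"
  where "scal c = Poly_Mapping.single 0 c"

definition free_algebra :: "'x set \<Rightarrow> 'x free_alg ring"
  where "free_algebra X =
    \<lparr>carrier = {p. \<forall>w \<in> Poly_Mapping.keys p. set (letters w) \<subseteq> X},
     mult = (*), one = 1, zero = 0, add = (+)\<rparr>"

lemma ring_free_algebra: "ring (free_algebra X)"
proof -
  have 0: "0 \<in> carrier (free_algebra X)"
    by (simp add: free_algebra_def)
  have 1: "1 \<in> carrier (free_algebra X)"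
    by (simp add: free_algebra_def zero_free_monoid_def)
  have add: "p + q \<in> carrier (free_algebra X)"
    if "p \<in> carrier (free_algebra X)" "q \<in> carrier (free_algebra X)" for p q
    using that Poly_Mapping.keys_add[of p q] by (auto simp: free_algebra_def)
  have uminus: "- p \<in> carrier (free_algebra X)" if "p \<in> carrier (free_algebra X)" for p
    using that by (simp add: free_algebra_def)
  have mult: "p * q \<in> carrier (free_algebra X)"
    if "p \<in> carrier (free_algebra X)" "q \<in> carrier (free_algebra X)" for p q
    using that keys_mult[of p q] by (fastforce simp: free_algebra_def plus_free_monoid_def)
  show ?thesis
  proof (intro ringI abelian_groupI monoidI)
    fix x assume "x \<in> carrier (free_algebra X)"
    then show "\<exists>y \<in> carrier (free_algebra X).
        y \<oplus>\<^bsub>free_algebra X\<^esub> x = \<zero>\<^bsub>free_algebra X\<^esub>"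
      using uminus[of x] by (intro bexI[of _ "- x"]) (simp_all add: free_algebra_def)
  next
    fix x y assume "x \<in> carrier (free_algebra X)" "y \<in> carrier (free_algebra X)"
    then show "x \<oplus>\<^bsub>free_algebra X\<^esub> y \<in> carrier (free_algebra X)"
      "x \<otimes>\<^bsub>free_algebra X\<^esub> y \<in> carrier (free_algebra X)"
      using add[of x y] mult[of x y] by (simp_all add: free_algebra_def)
  next
    show "\<zero>\<^bsub>free_algebra X\<^esub> \<in> carrier (free_algebra X)"
      "\<one>\<^bsub>free_algebra X\<^esub> \<in> carrier (free_algebra X)"
      using 0 1 by (simp_all add: free_algebra_def)
  qed (simp_all add: free_algebra_def algebra_simps)
qed

text \<open>
  The ideal generated by the relators is two-sided: this is what \<^const>\<open>genideal\<close> means for a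
  noncommutative ring.  The relators have to lie in the free algebra on \<open>X\<close>.
\<close>

definition relation_ideal :: "'x set \<Rightarrow> 'x free_alg set \<Rightarrow> 'x free_alg set"
  where "relation_ideal X \<R> = genideal (free_algebra X) \<R>"

definition cls :: "'x set \<Rightarrow> 'x free_alg set \<Rightarrow> 'x free_alg \<Rightarrow> 'x free_alg set"
  where "cls X \<R> p = relation_ideal X \<R> +>\<^bsub>free_algebra X\<^esub> p"

definition presented_algebra ::
    "'x set \<Rightarrow> 'x free_alg set \<Rightarrow> (complex, 'x free_alg set) module"
  where "presented_algebra X \<R> = (let Q = free_algebra X Quot relation_ideal X \<R> in
    \<lparr>carrier = carrier Q, mult = mult Q, one = one Q, zero = zero Q, add = add Q,
     smult = (\<lambda>c x. cls X \<R> (scal c) \<otimes>\<^bsub>Q\<^esub> x)\<rparr>)"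

definition alg_hom :: "(complex, 'a) module \<Rightarrow> (complex, 'b) module \<Rightarrow> ('a \<Rightarrow> 'b) set"
  where "alg_hom A B =
    {h \<in> ring_hom A B. \<forall>c. \<forall>x \<in> carrier A. h (c \<odot>\<^bsub>A\<^esub> x) = c \<odot>\<^bsub>B\<^esub> h x}"

text \<open>
  \<open>h\<close> is an algebra homomorphism with the prescribed property, and the only one; homomorphisms
  are compared on the carrier, since HOL functions are total.
\<close>

definition unique_alg_hom ::
    "(complex, 'a) module \<Rightarrow> (complex, 'b) module \<Rightarrow> (('a \<Rightarrow> 'b) \<Rightarrow> bool) \<Rightarrow> ('a \<Rightarrow> 'b) \<Rightarrow> bool"
  where "unique_alg_hom A B prop h \<longleftrightarrow>
    h \<in> alg_hom A B \<and> prop h \<and>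
    (\<forall>h' \<in> alg_hom A B. prop h' \<longrightarrow> (\<forall>x \<in> carrier A. h' x = h x))"


section \<open>The Lie algebra and its universal enveloping algebra\<close>

definition munit :: "'n \<Rightarrow> 'n \<Rightarrow> 'a::{zero,one}^'n^'n"
  where "munit i j = axis i (axis j 1)"

definition cscale :: "complex \<Rightarrow> complex^'n^'n \<Rightarrow> complex^'n^'n"
  where "cscale c A = (\<chi> i j. c * A $ i $ j)"

lemma vector_space_cscale: "vector_space cscale"
  by unfold_locales (simp_all add: cscale_def vec_eq_iff algebra_simps)

definition Fmat :: "complex^'n^'n \<Rightarrow> 'n::finite \<Rightarrow> 'n \<Rightarrow> complex^'n^'n"
  where "Fmat G i j =
    munit i j - (\<Sum>k\<in>UNIV. \<Sum>l\<in>UNIV. cscale (G $ i $ k * matrix_inv G $ l $ j) (munit l k))"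

definition gN :: "complex^'n^'n \<Rightarrow> (complex^'n::finite^'n) set"
  where "gN G = module.span cscale {Fmat G i j | i j. True}"

text \<open>
  The usual presentation of the enveloping algebra of a Lie algebra \<open>L\<close> of matrices:
  one generator for each element of \<open>L\<close>, the first two families of relators making the
  inclusion of \<open>L\<close> linear.
\<close>

definition env_rels :: "(complex^'n::finite^'n) set \<Rightarrow> (complex^'n^'n) free_alg set"
  where "env_rels L =
    {gen (x + y) - gen x - gen y | x y. x \<in> L \<and> y \<in> L} \<union>
    {gen (cscale c x) - scal c * gen x | c x. x \<in> L} \<union>
    {gen x * gen y - gen y * gen x - gen (x ** y - y ** x) | x y. x \<in> L \<and> y \<in> L}"

definition UgN ::
    "complex^'n::finite^'n \<Rightarrow> (complex, (complex^'n^'n) free_alg set) module"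
  where "UgN G = presented_algebra (gN G) (env_rels (gN G))"

definition FU :: "complex^'n::finite^'n \<Rightarrow> 'n \<Rightarrow> 'n \<Rightarrow> (complex^'n^'n) free_alg set"
  where "FU G i j = cls (gN G) (env_rels (gN G)) (gen (Fmat G i j))"


section \<open>The reflection algebra\<close>

text \<open>
  \<open>kron A B\<close> is the tensor product of matrices \<open>A\<close> and \<open>B\<close>.  For matrices with entries in an
  algebra the entries are multiplied in this order; it is only used with one
  of the factors scalar.
\<close>

definition kron :: "'a::times^'n^'n \<Rightarrow> 'a^'n^'n \<Rightarrow> 'a^('n \<times> 'n)^('n \<times> 'n)"
  where "kron A B = (\<chi> p q. A $ fst p $ fst q * B $ snd p $ snd q)"

definition Pmat :: "complex^('n::finite \<times> 'n)^('n \<times> 'n)"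
  where "Pmat = (\<Sum>i\<in>UNIV. \<Sum>j\<in>UNIV. kron (munit i j) (munit j i))"

definition Ptmat :: "complex^('n::finite \<times> 'n)^('n \<times> 'n)"
  where "Ptmat = (\<Sum>i\<in>UNIV. \<Sum>j\<in>UNIV. kron (munit i j) (munit i j))"

definition Qmat :: "complex^'n::finite^'n \<Rightarrow> complex^('n \<times> 'n)^('n \<times> 'n)"
  where "Qmat G = kron G (mat 1) ** Ptmat ** kron (matrix_inv G) (mat 1)"

text \<open>
  Formal series in \<open>u\<inverse>, v\<inverse>\<close> are treated as iterated Laurent series: the outer
  indeterminate \<^term>\<open>fls_X\<close> is \<open>u\<inverse>\<close> and the one of the coefficients is \<open>v\<inverse>\<close>.  Thus the
  fractions in \<open>R(u - v)\<close> and \<open>R(u + v)\<close> are expanded in powers of \<open>u\<inverse>\<close>, with coefficients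
  polynomial in \<open>v\<close>.
\<close>

abbreviation const2 :: "'a::zero \<Rightarrow> 'a fls fls"
  where "const2 c \<equiv> fls_const (fls_const c)"

definition var_u :: "complex fls fls"
  where "var_u = fls_X_inv"

definition var_v :: "complex fls fls"
  where "var_v = fls_const fls_X_inv"

definition Rmat ::
    "complex \<Rightarrow> complex^'n::finite^'n \<Rightarrow> complex fls fls \<Rightarrow> complex fls fls^('n \<times> 'n)^('n \<times> 'n)"
  where "Rmat \<kappa> G x =
    (\<chi> p q. mat 1 $ p $ q - const2 (Pmat $ p $ q) / x + const2 (Qmat G $ p $ q) / (x - const2 \<kappa>))"

text \<open>Coefficientwise application of a map that preserves zero.\<close>

definition fls_map :: "('a::zero \<Rightarrow> 'b::zero) \<Rightarrow> 'a fls \<Rightarrow> 'b fls"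
  where "fls_map f a = Abs_fls (\<lambda>n. f (fls_nth a n))"

lemma fls_map_nth:
  assumes "f 0 = 0"
  shows "fls_nth (fls_map f a) n = f (fls_nth a n)"
  unfolding fls_map_def
  by (rule nth_Abs_fls_lower_bound[of "fls_subdegree a"]) (simp add: assms)

definition scal_matrix :: "complex fls fls^'m^'m \<Rightarrow> 'x free_alg fls fls^'m^'m"
  where "scal_matrix A = (\<chi> p q. fls_map (fls_map scal) (A $ p $ q))"

type_synonym 'n rgen = "'n \<times> 'n \<times> nat"

definition rgens :: "'n rgen set"
  where "rgens = {(i, j, r) | i j r. r \<ge> 1}"

definition scoeff :: "'n \<Rightarrow> 'n \<Rightarrow> nat \<Rightarrow> 'n rgen free_alg"
  where "scoeff i j r = (if r = 0 then (if i = j then 1 else 0) else gen (i, j, r))"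

definition S_u :: "'n::finite rgen free_alg fls fls^'n^'n"
  where "S_u = (\<chi> i j. fps_to_fls (Abs_fps (\<lambda>r. fls_const (scoeff i j r))))"

definition S_v :: "'n::finite rgen free_alg fls fls^'n^'n"
  where "S_v = (\<chi> i j. fls_const (fps_to_fls (Abs_fps (scoeff i j))))"

definition reflection_defect ::
    "complex \<Rightarrow> complex^'n::finite^'n \<Rightarrow> 'n rgen free_alg fls fls^('n \<times> 'n)^('n \<times> 'n)"
  where "reflection_defect \<kappa> G =
    (let Rm = scal_matrix (Rmat \<kappa> G (var_u - var_v));
         Rp = scal_matrix (Rmat \<kappa> G (var_u + var_v));
         S1 = kron S_u (mat 1);
         S2 = kron (mat 1) S_v
     in Rm ** S1 ** Rp ** S2 - S2 ** Rp ** S1 ** Rm)"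

text \<open>The matrices \<open>S(u)\<close> and \<open>S(-u)\<close> of power series in the single indeterminate \<open>u\<inverse>\<close>.\<close>

definition S_series :: "'n::finite rgen free_alg fps^'n^'n"
  where "S_series = (\<chi> i j. Abs_fps (scoeff i j))"

definition S_series_neg :: "'n::finite rgen free_alg fps^'n^'n"
  where "S_series_neg = (\<chi> i j. Abs_fps (\<lambda>r. (-1) ^ r * scoeff i j r))"

definition refl_rels :: "complex \<Rightarrow> complex^'n::finite^'n \<Rightarrow> 'n rgen free_alg set"
  where "refl_rels \<kappa> G =
    {fls_nth (fls_nth (reflection_defect \<kappa> G $ p $ q) m) n | p q m n. True} \<union>
    {fps_nth ((S_series ** S_series_neg - mat 1) $ i $ j) r | i j r. True}"

text \<open>\<open>\<epsilon> = 1\<close> in the symmetric case and \<open>\<epsilon> = -1\<close> in the skew-symmetric case.\<close>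

definition kappa :: "complex \<Rightarrow> 'n::finite itself \<Rightarrow> complex"
  where "kappa \<epsilon> _ = of_nat CARD('n) / 2 - \<epsilon>"

definition BgN ::
    "complex \<Rightarrow> complex^'n::finite^'n \<Rightarrow> (complex, 'n rgen free_alg set) module"
  where "BgN \<epsilon> G = presented_algebra rgens (refl_rels (kappa \<epsilon> TYPE('n)) G)"

definition sB :: "complex \<Rightarrow> complex^'n::finite^'n \<Rightarrow> 'n \<Rightarrow> 'n \<Rightarrow> nat \<Rightarrow> 'n rgen free_alg set"
  where "sB \<epsilon> G i j r = cls rgens (refl_rels (kappa \<epsilon> TYPE('n)) G) (scoeff i j r)"

definition const_matrix :: "complex^'n^'n \<Rightarrow> 'x free_alg fps^'n^'n"
  where "const_matrix A = (\<chi> i j. fps_const (scal (A $ i $ j)))"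

definition S_series' :: "complex^'n::finite^'n \<Rightarrow> 'n rgen free_alg fps^'n^'n"
  where "S_series' G = const_matrix G ** transpose S_series ** const_matrix (matrix_inv G)"

definition sB' :: "complex \<Rightarrow> complex^'n::finite^'n \<Rightarrow> 'n \<Rightarrow> 'n \<Rightarrow> nat \<Rightarrow> 'n rgen free_alg set"
  where "sB' \<epsilon> G i j r =
    cls rgens (refl_rels (kappa \<epsilon> TYPE('n)) G) (fps_nth (S_series' G $ i $ j) r)"


section \<open>Matrices, and series of matrices, over a ring with carrier\<close>

definition rmat_one :: "('a, 'm) ring_scheme \<Rightarrow> 'n \<Rightarrow> 'n \<Rightarrow> 'a"
  where "rmat_one R = (\<lambda>i j. if i = j then \<one>\<^bsub>R\<^esub> else \<zero>\<^bsub>R\<^esub>)"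

definition rmat_mult ::
    "('a, 'm) ring_scheme \<Rightarrow> ('n::finite \<Rightarrow> 'n \<Rightarrow> 'a) \<Rightarrow> ('n \<Rightarrow> 'n \<Rightarrow> 'a) \<Rightarrow> 'n \<Rightarrow> 'n \<Rightarrow> 'a"
  where "rmat_mult R A B = (\<lambda>i j. \<Oplus>\<^bsub>R\<^esub>k\<in>UNIV. A i k \<otimes>\<^bsub>R\<^esub> B k j)"

primrec rmat_pow ::
    "('a, 'm) ring_scheme \<Rightarrow> ('n::finite \<Rightarrow> 'n \<Rightarrow> 'a) \<Rightarrow> nat \<Rightarrow> 'n \<Rightarrow> 'n \<Rightarrow> 'a"
where
  "rmat_pow R A 0 = rmat_one R"
| "rmat_pow R A (Suc r) = rmat_mult R (rmat_pow R A r) A"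

text \<open>A series in \<open>u\<inverse>\<close> of matrices is the sequence of its coefficients.\<close>

definition rser_mult ::
    "('a, 'm) ring_scheme \<Rightarrow> (nat \<Rightarrow> 'n::finite \<Rightarrow> 'n \<Rightarrow> 'a) \<Rightarrow> (nat \<Rightarrow> 'n \<Rightarrow> 'n \<Rightarrow> 'a) \<Rightarrow>
      nat \<Rightarrow> 'n \<Rightarrow> 'n \<Rightarrow> 'a"
  where "rser_mult R A B = (\<lambda>r i j. \<Oplus>\<^bsub>R\<^esub>m\<in>{..r}. rmat_mult R (A m) (B (r - m)) i j)"

text \<open>The series \<open>1 + A u\<inverse>\<close>.\<close>

definition rser_linear ::
    "('a, 'm) ring_scheme \<Rightarrow> ('n \<Rightarrow> 'n \<Rightarrow> 'a) \<Rightarrow> nat \<Rightarrow> 'n \<Rightarrow> 'n \<Rightarrow> 'a"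
  where "rser_linear R A =
    (\<lambda>r. if r = 0 then rmat_one R else if r = 1 then A else (\<lambda>i j. \<zero>\<^bsub>R\<^esub>))"

text \<open>
  \<open>T\<close> is the expansion in \<open>u\<inverse>\<close> of the fraction \<open>(u + A) / (u - A)\<close>; numerator and
  denominator are divided by \<open>u\<close>.  Since \<open>1 - A u\<inverse>\<close> is invertible as a series, \<open>T\<close>
  is determined by either equation.
\<close>

definition is_cayley_fraction ::
    "('a, 'm) ring_scheme \<Rightarrow> ('n::finite \<Rightarrow> 'n \<Rightarrow> 'a) \<Rightarrow> (nat \<Rightarrow> 'n \<Rightarrow> 'n \<Rightarrow> 'a) \<Rightarrow> bool"
  where "is_cayley_fraction R A T \<longleftrightarrow>
    rser_mult R T (rser_linear R (\<lambda>i j. \<ominus>\<^bsub>R\<^esub> A i j)) = rser_linear R A \<and>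
    rser_mult R (rser_linear R (\<lambda>i j. \<ominus>\<^bsub>R\<^esub> A i j)) T = rser_linear R A"

text \<open>The matrix \<open>F - N/4\<close> over the enveloping algebra.\<close>

definition F_shifted :: "complex^'n::finite^'n \<Rightarrow> 'n \<Rightarrow> 'n \<Rightarrow> (complex^'n^'n) free_alg set"
  where "F_shifted G = (\<lambda>i j. FU G i j \<ominus>\<^bsub>UgN G\<^esub>
    ((of_nat CARD('n) / 4) \<odot>\<^bsub>UgN G\<^esub> rmat_one (UgN G) i j))"

definition eval_series ::
    "complex^'n::finite^'n \<Rightarrow> nat \<Rightarrow> 'n \<Rightarrow> 'n \<Rightarrow> (complex^'n^'n) free_alg set"
  where "eval_series G = (\<lambda>r i j. if r = 0 then rmat_one (UgN G) i j
    else 2 \<odot>\<^bsub>UgN G\<^esub> rmat_pow (UgN G) (F_shifted G) r i j)"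

end

theory Submission
  imports Defs
begin

text \<open>
  Write \<open>H = S\<^sup>(\<^sup>1\<^sup>)\<close> and \<open>h(X) = \<Sum> X\<^sub>i\<^sub>j H\<^sub>i\<^sub>j\<close> for a matrix \<open>X\<close>.  The coefficient of
  \<open>u\<inverse>v\<inverse>\<close> in the reflection equation is \<open>[H\<^sub>1, H\<^sub>2] = 2 [P - Q, H\<^sub>2]\<close>.  Contracting it with
  \<open>X\<close> and \<open>Y\<close> from the Lie algebra, where the transposition with respect to \<open>G\<close> acts as \<open>-1\<close>, turns it
  into \<open>[h(X), h(Y)] = 4 h([X, Y])\<close> (\<open>Hgen_commutator\<close>).  Hence \<open>X \<mapsto> h(X) / 4\<close> is a homomorphism
  of Lie algebras, and it sends \<open>F\<^sub>i\<^sub>j\<close> to the required element.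

  In the other direction put \<open>A = F - N/4\<close>.  The commutation relations of the \<open>F\<^sub>i\<^sub>j\<close> say precisely that
  \<open>B = A\<^sub>2 - P + Q\<close> commutes with \<open>A\<^sub>1\<close>, and the skewness of \<open>F\<close> says that \<open>A\<^sub>1 + A\<^sub>2\<close> acts as
  \<open>-N/2\<close> on \<open>Q\<close> from either side.  Multiply the reflection equation for \<open>S(u) = (u + A)/(u - A)\<close> by
  \<open>v - A\<^sub>2\<close> from both sides, so that only the resolvent \<open>X = 1/(u - A\<^sub>1)\<close> remains, and factor
  \<open>(v - A\<^sub>2) R(u - v)\<close> and \<open>R(u + v) (v + A\<^sub>2)\<close> through \<open>v \<mp> B\<close> and \<open>u - A\<^sub>1\<close>
  (\<open>left_factor\<close>, \<open>right_factor\<close>).  The factors \<open>u - A\<^sub>1\<close> cancel the resolvent, \<open>B\<close> moves past it,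
  and \<open>B Q = (\<kappa> - A\<^sub>1) Q\<close>; the shift by \<open>N/4\<close> is the one for which the last identity
  produces the constant \<open>\<kappa>\<close> of the R-matrix.  What is left is an identity between rational functions.
  Thus \<open>S(u) \<mapsto> (u + A)/(u - A)\<close> is a homomorphism.  The composite of the two maps fixes every \<open>F\<^sub>i\<^sub>j\<close>,
  because \<open>F\<close> is skew and the constant \<open>N/4\<close> drops out of \<open>S - S'\<close>; so it is the identity, and
  the first map is injective.

  All computations take place in free algebras, and only their results are read modulo the relations.
  The matrix \<open>F\<close> is lifted to the free algebra as an exactly skew matrix (\<open>Flift\<close>), which makes
  \<open>[B, A\<^sub>1] = 0\<close> the only relation that fails there.  Accordingly \<open>reflection_equation_mod\<close> is an
  exact identity in a ring, which expresses the failure of the reflection equation through \<open>[B, X]\<close>.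
\<close>

(* The infix dollar sign always selects a component of a vector. *)
no_notation fps_nth (infixl "$" 75)

section \<open>Noncommutative polynomials\<close>

lemma lookup_sum_singles:
  "p = (\<Sum>w\<in>Poly_Mapping.keys p. Poly_Mapping.single w (Poly_Mapping.lookup p w))"
  by (rule poly_mapping_eqI) (simp add: lookup_sum lookup_single when_def in_keys_iff)

lemma free_alg_induct [case_names add monom]:
  fixes p :: "'x free_alg"
  assumes "\<And>p q. Q p \<Longrightarrow> Q q \<Longrightarrow> Q (p + q)" and "\<And>w c. Q (Poly_Mapping.single w c)"
  shows "Q p"
proof -
  have "Q (\<Sum>w\<in>W. Poly_Mapping.single w (f w))" if "finite W" for W f
    using that
  proof (induction rule: finite_induct)
    case empty
    show ?case using assms(2)[of undefined 0] by simp
  next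
    case (insert x F)
    then show ?case using assms by simp
  qed
  from this[OF finite_keys] show ?thesis
    using lookup_sum_singles[of p] by metis
qed

lemma scal_0 [simp]: "scal 0 = 0" by (simp add: scal_def)
lemma scal_1 [simp]: "scal 1 = 1" by (simp add: scal_def)
lemma scal_add: "scal (a + b) = scal a + scal b" by (simp add: scal_def single_add)
lemma scal_diff: "scal (a - b) = scal a - scal b" by (simp add: scal_def single_diff)
lemma scal_minus: "scal (- b) = - scal b" by (simp add: scal_def single_uminus)
lemma scal_mult: "scal (a * b) = scal a * scal b" by (simp add: scal_def mult_single)
lemma scal_commute: "scal c * p = p * scal c"
  by (induction p rule: free_alg_induct)
    (simp_all add: algebra_simps scal_def mult_single)
lemma scal_sum: "scal (sum f S) = (\<Sum>x\<in>S. scal (f x))"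
  by (induction S rule: infinite_finite_induct) (simp_all add: scal_add)

definition subst :: "('x \<Rightarrow> 'y free_alg) \<Rightarrow> 'x free_alg \<Rightarrow> 'y free_alg"
  where "subst g p = (\<Sum>w\<in>Poly_Mapping.keys p.
    scal (Poly_Mapping.lookup p w) * prod_list (map g (letters w)))"

lemma subst_superset:
  assumes "finite W" "Poly_Mapping.keys p \<subseteq> W"
  shows "subst g p = (\<Sum>w\<in>W. scal (Poly_Mapping.lookup p w) * prod_list (map g (letters w)))"
  unfolding subst_def
  by (rule sum.mono_neutral_left) (use assms in \<open>auto simp: in_keys_iff\<close>)

lemma subst_add: "subst g (p + q) = subst g p + subst g q"
proof -
  let ?W = "Poly_Mapping.keys p \<union> Poly_Mapping.keys q"
  have "Poly_Mapping.keys (p + q) \<subseteq> ?W" by (rule Poly_Mapping.keys_add)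
  then show ?thesis
    by (simp add: subst_superset[of ?W] lookup_add scal_add distrib_right sum.distrib)
qed

lemma subst_single: "subst g (Poly_Mapping.single w c) = scal c * prod_list (map g (letters w))"
  by (subst subst_superset[of "{w}"]) auto

lemma subst_0 [simp]: "subst g 0 = 0" by (simp add: subst_def)
lemma subst_scal [simp]: "subst g (scal c) = scal c"
  by (simp add: scal_def subst_single zero_free_monoid_def)
lemma subst_1 [simp]: "subst g 1 = 1" using subst_scal[of g 1] by simp
lemma subst_gen [simp]: "subst g (gen x) = g x" by (simp add: gen_def subst_single)

lemma subst_mult: "subst g (p * q) = subst g p * subst g q"
proof (induction p rule: free_alg_induct)
  case (monom v a)
  show ?case
  proof (induction q rule: free_alg_induct)
    case (monom w b)
    show ?case
      by (simp add: mult_single subst_single plus_free_monoid_def scal_mult)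
        (metis (no_types, lifting) mult.assoc scal_commute)
  qed (simp add: subst_add distrib_left)
qed (simp add: subst_add distrib_right)

lemma subst_minus: "subst g (- p) = - subst g p"
  using subst_add[of g p "- p"] by (simp add: eq_neg_iff_add_eq_0 add.commute)
lemma subst_diff: "subst g (p - q) = subst g p - subst g q"
  using subst_add[of g p "- q"] by (simp add: subst_minus)
lemma subst_sum: "subst g (sum f S) = (\<Sum>x\<in>S. subst g (f x))"
  by (induction S rule: infinite_finite_induct) (simp_all add: subst_add)

section \<open>Algebras given by generators and relations\<close>

lemma free_algebra_simps [simp]:
  "mult (free_algebra X) = (*)" "one (free_algebra X) = 1" "zero (free_algebra X) = 0"
  "add (free_algebra X) = (+)"
  by (simp_all add: free_algebra_def)

abbreviation FA :: "'x set \<Rightarrow> 'x free_alg set"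
  where "FA X \<equiv> carrier (free_algebra X)"

lemma FA_add [intro]: "p \<in> FA X \<Longrightarrow> q \<in> FA X \<Longrightarrow> p + q \<in> FA X"
  using ring.ring_simprules(1)[OF ring_free_algebra, of p X q] by simp
lemma FA_mult [intro]: "p \<in> FA X \<Longrightarrow> q \<in> FA X \<Longrightarrow> p * q \<in> FA X"
  using ring.ring_simprules(5)[OF ring_free_algebra, of p X q] by simp
lemma FA_minus [intro]: "p \<in> FA X \<Longrightarrow> - p \<in> FA X"
  by (simp add: free_algebra_def)
lemma FA_diff [intro]: "p \<in> FA X \<Longrightarrow> q \<in> FA X \<Longrightarrow> p - q \<in> FA X"
  using FA_add[OF _ FA_minus, of p X q] by simp
lemma FA_scal [intro, simp]: "scal c \<in> FA X"
  by (simp add: free_algebra_def scal_def zero_free_monoid_def)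
lemma FA_1 [intro, simp]: "1 \<in> FA X" using FA_scal[of 1] by simp
lemma FA_0 [intro, simp]: "0 \<in> FA X" using FA_scal[of 0] by simp
lemma FA_gen [intro]: "x \<in> X \<Longrightarrow> gen x \<in> FA X"
  by (simp add: free_algebra_def gen_def)
lemma FA_sum [intro]: "(\<And>i. i \<in> S \<Longrightarrow> f i \<in> FA X) \<Longrightarrow> sum f S \<in> FA X"
  by (induction S rule: infinite_finite_induct) auto

lemma FA_induct [consumes 1, case_names scal gen add mult]:
  assumes p: "p \<in> FA X"
    and "\<And>c. Q (scal c)" "\<And>x. x \<in> X \<Longrightarrow> Q (gen x)"
    and add: "\<And>p q. p \<in> FA X \<Longrightarrow> q \<in> FA X \<Longrightarrow> Q p \<Longrightarrow> Q q \<Longrightarrow> Q (p + q)"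
    and mult: "\<And>p q. p \<in> FA X \<Longrightarrow> q \<in> FA X \<Longrightarrow> Q p \<Longrightarrow> Q q \<Longrightarrow> Q (p * q)"
  shows "Q p"
proof -
  have word: "Poly_Mapping.single (Word w) c \<in> FA X \<and> Q (Poly_Mapping.single (Word w) c)"
    if "set w \<subseteq> X" for w c
    using that
  proof (induction w)
    case Nil
    show ?case using assms(2)[of c] FA_scal[of c X] by (simp add: scal_def zero_free_monoid_def)
  next
    case (Cons x w)
    have "Poly_Mapping.single (Word (x # w)) c = gen x * Poly_Mapping.single (Word w) c"
      by (simp add: gen_def mult_single plus_free_monoid_def)
    then show ?case using Cons assms(3)[of x] mult[of "gen x"] FA_gen[of x X] by auto
  qed
  have "(\<Sum>w\<in>W. Poly_Mapping.single w (f w)) \<in> FA X \<and> Q (\<Sum>w\<in>W. Poly_Mapping.single w (f w))"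
    if "finite W" "\<forall>w\<in>W. set (letters w) \<subseteq> X" for W f
    using that
  proof (induction rule: finite_induct)
    case empty
    show ?case using assms(2)[of 0] by simp
  next
    case (insert w W)
    then show ?case using word[of "letters w" "f w"] add by auto
  qed
  from this[OF finite_keys, of p "Poly_Mapping.lookup p"] show ?thesis
    using p by (simp add: free_algebra_def lookup_sum_singles[symmetric])
qed

lemma subst_FA:
  assumes "p \<in> FA X" "\<And>x. x \<in> X \<Longrightarrow> g x \<in> FA Y"
  shows "subst g p \<in> FA Y"
  using assms(1)
  by (induction rule: FA_induct) (auto simp: assms(2) subst_add subst_mult)

text \<open>
  Killing the letters outside \<open>X\<close> is a projection onto the free algebra on \<open>X\<close>.  Membership in that
  algebra therefore becomes an equation, which ring homomorphisms preserve.
\<close>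

definition retract :: "'x set \<Rightarrow> 'x free_alg \<Rightarrow> 'x free_alg"
  where "retract X = subst (\<lambda>x. if x \<in> X then gen x else 0)"

lemma retract_FA: "p \<in> FA X \<Longrightarrow> retract X p = p"
  by (induction rule: FA_induct) (auto simp: retract_def subst_add subst_mult)

lemma retract_in_FA: "retract X p \<in> FA X"
proof -
  have "p \<in> FA UNIV" by (simp add: free_algebra_def)
  then show ?thesis unfolding retract_def by (rule subst_FA) auto
qed

locale presentation =
  fixes X :: "'x set" and \<R> :: "'x free_alg set"
  assumes relators: "\<R> \<subseteq> FA X"
begin

abbreviation "I \<equiv> relation_ideal X \<R>"
abbreviation "\<A> \<equiv> presented_algebra X \<R>"
abbreviation "\<pi> \<equiv> cls X \<R>"

sublocale F: ring "free_algebra X" by (rule ring_free_algebra)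

sublocale I: ideal I "free_algebra X"
  unfolding relation_ideal_def using relators by (rule F.genideal_ideal)

lemma I_relator: "r \<in> \<R> \<Longrightarrow> r \<in> I"
  unfolding relation_ideal_def using F.genideal_self[OF relators] by blast
lemma I_FA: "p \<in> I \<Longrightarrow> p \<in> FA X" by (rule I.Icarr)
lemma I_add: "p \<in> I \<Longrightarrow> q \<in> I \<Longrightarrow> p + q \<in> I" using I.a_closed[of p q] by simp
lemma I_mult_left: "p \<in> I \<Longrightarrow> q \<in> FA X \<Longrightarrow> q * p \<in> I" using I.I_l_closed[of p q] by simp
lemma I_mult_right: "p \<in> I \<Longrightarrow> q \<in> FA X \<Longrightarrow> p * q \<in> I" using I.I_r_closed[of p q] by simp
lemma I_0: "0 \<in> I" using I.zero_closed by simp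
lemma I_minus: "p \<in> I \<Longrightarrow> - p \<in> I"
  using I_mult_left[of p "scal (- 1)", OF _ FA_scal] by (simp add: scal_minus)
lemma I_diff: "p \<in> I \<Longrightarrow> q \<in> I \<Longrightarrow> p - q \<in> I" using I_add[OF _ I_minus, of p q] by simp
lemma I_sum: "(\<And>i. i \<in> S \<Longrightarrow> f i \<in> I) \<Longrightarrow> sum f S \<in> I"
  by (induction S rule: infinite_finite_induct) (auto intro: I_0 I_add)

lemma I_minimal:
  assumes "ideal K (free_algebra X)" "\<R> \<subseteq> K"
  shows "I \<subseteq> K"
  unfolding relation_ideal_def by (rule F.genideal_minimal[OF assms])

lemma cls_eq_iff:
  assumes "p \<in> FA X" "q \<in> FA X"
  shows "\<pi> p = \<pi> q \<longleftrightarrow> p - q \<in> I"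
proof -
  have "\<pi> p = \<pi> q \<longleftrightarrow> p \<ominus>\<^bsub>free_algebra X\<^esub> q \<in> I"
    unfolding cls_def using F.quotient_eq_iff_same_a_r_cos[OF I.ideal_axioms assms] by blast
  moreover have "p \<ominus>\<^bsub>free_algebra X\<^esub> q = p - q"
    unfolding a_minus_def using F.minus_equality[of "- q" q] assms(2) FA_minus by fastforce
  ultimately show ?thesis by simp
qed

lemma carrier_pres: "carrier \<A> = \<pi> ` FA X"
  by (auto simp: presented_algebra_def Let_def FactRing_def A_RCOSETS_def' cls_def)

lemma zero_pres: "\<zero>\<^bsub>\<A>\<^esub> = \<pi> 0"
  using F.a_coset_add_zero[of I] I.a_subset by (simp add: presented_algebra_def Let_def FactRing_def
      cls_def)

lemma one_pres: "\<one>\<^bsub>\<A>\<^esub> = \<pi> 1"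
  by (simp add: presented_algebra_def Let_def FactRing_def cls_def)

lemma add_pres: "p \<in> FA X \<Longrightarrow> q \<in> FA X \<Longrightarrow> \<pi> p \<oplus>\<^bsub>\<A>\<^esub> \<pi> q = \<pi> (p + q)"
  using I.a_rcos_sum[of p q] by (simp add: presented_algebra_def Let_def FactRing_def cls_def)

lemma mult_pres: "p \<in> FA X \<Longrightarrow> q \<in> FA X \<Longrightarrow> \<pi> p \<otimes>\<^bsub>\<A>\<^esub> \<pi> q = \<pi> (p * q)"
  using I.rcoset_mult_add[of p q] by (simp add: presented_algebra_def Let_def FactRing_def cls_def)

lemma smult_pres: "p \<in> FA X \<Longrightarrow> c \<odot>\<^bsub>\<A>\<^esub> \<pi> p = \<pi> (scal c * p)"
  using mult_pres[OF FA_scal, of p c] by (simp add: presented_algebra_def Let_def)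

sublocale P: ring \<A>
proof (intro ringI abelian_groupI monoidI)
  fix x assume "x \<in> carrier \<A>"
  then obtain p where "p \<in> FA X" "x = \<pi> p" by (auto simp: carrier_pres)
  then show "\<exists>y\<in>carrier \<A>. y \<oplus>\<^bsub>\<A>\<^esub> x = \<zero>\<^bsub>\<A>\<^esub>"
    by (intro bexI[of _ "\<pi> (- p)"]) (auto simp: carrier_pres add_pres[OF FA_minus] zero_pres FA_minus)
qed (auto simp: carrier_pres zero_pres one_pres add_pres mult_pres FA_add FA_mult algebra_simps)

lemma diff_pres: "p \<in> FA X \<Longrightarrow> q \<in> FA X \<Longrightarrow> \<pi> p \<ominus>\<^bsub>\<A>\<^esub> \<pi> q = \<pi> (p - q)"
proof -
  assume p: "p \<in> FA X" "q \<in> FA X"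
  have "\<ominus>\<^bsub>\<A>\<^esub> \<pi> q = \<pi> (- q)"
    by (rule P.minus_equality) (use p in \<open>auto simp: carrier_pres add_pres zero_pres FA_minus\<close>)
  then show ?thesis using p by (simp add: a_minus_def add_pres FA_minus)
qed

lemma minus_pres: "q \<in> FA X \<Longrightarrow> \<ominus>\<^bsub>\<A>\<^esub> \<pi> q = \<pi> (- q)"
  by (rule P.minus_equality) (auto simp: carrier_pres add_pres zero_pres FA_minus)

lemma finsum_pres:
  assumes "\<And>i. i \<in> S \<Longrightarrow> f i \<in> FA X" "finite S"
  shows "(\<Oplus>\<^bsub>\<A>\<^esub>i\<in>S. \<pi> (f i)) = \<pi> (\<Sum>i\<in>S. f i)"
  using assms(2,1)
proof (induction S rule: finite_induct)
  case empty
  show ?case by (simp add: zero_pres)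
next
  case (insert i S)
  then have "(\<Oplus>\<^bsub>\<A>\<^esub>j\<in>insert i S. \<pi> (f j)) = \<pi> (f i) \<oplus>\<^bsub>\<A>\<^esub> (\<Oplus>\<^bsub>\<A>\<^esub>j\<in>S. \<pi> (f j))"
    by (intro P.finsum_insert) (auto simp: carrier_pres)
  then show ?case using insert by (simp add: add_pres FA_sum)
qed

end

lemma alg_hom_values:
  assumes A: "presentation X \<R>" and B: "presentation Y \<S>"
    and h: "h \<in> alg_hom (presented_algebra X \<R>) (presented_algebra Y \<S>)"
  shows "p \<in> FA X \<Longrightarrow> q \<in> FA X \<Longrightarrow>
      h (cls X \<R> (p + q)) = h (cls X \<R> p) \<oplus>\<^bsub>presented_algebra Y \<S>\<^esub> h (cls X \<R> q)"
    and "p \<in> FA X \<Longrightarrow> q \<in> FA X \<Longrightarrow>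
      h (cls X \<R> (p * q)) = h (cls X \<R> p) \<otimes>\<^bsub>presented_algebra Y \<S>\<^esub> h (cls X \<R> q)"
    and "h (cls X \<R> (scal c)) = cls Y \<S> (scal c)"
proof -
  interpret A: presentation X \<R> by fact
  interpret B: presentation Y \<S> by fact
  show "p \<in> FA X \<Longrightarrow> q \<in> FA X \<Longrightarrow> h (A.\<pi> (p + q)) = h (A.\<pi> p) \<oplus>\<^bsub>B.\<A>\<^esub> h (A.\<pi> q)"
    "p \<in> FA X \<Longrightarrow> q \<in> FA X \<Longrightarrow> h (A.\<pi> (p * q)) = h (A.\<pi> p) \<otimes>\<^bsub>B.\<A>\<^esub> h (A.\<pi> q)"
    using h by (auto simp: alg_hom_def ring_hom_def A.carrier_pres A.add_pres[symmetric]
        A.mult_pres[symmetric])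
  have "h (c \<odot>\<^bsub>A.\<A>\<^esub> \<one>\<^bsub>A.\<A>\<^esub>) = c \<odot>\<^bsub>B.\<A>\<^esub> h \<one>\<^bsub>A.\<A>\<^esub>" "h \<one>\<^bsub>A.\<A>\<^esub> = \<one>\<^bsub>B.\<A>\<^esub>"
    using h by (auto simp: alg_hom_def ring_hom_def)
  then show "h (A.\<pi> (scal c)) = B.\<pi> (scal c)"
    by (simp add: A.one_pres B.one_pres A.smult_pres B.smult_pres)
qed

lemma alg_hom_unique:
  assumes A: "presentation X \<R>" and B: "presentation Y \<S>"
    and h: "h \<in> alg_hom (presented_algebra X \<R>) (presented_algebra Y \<S>)"
    and h': "h' \<in> alg_hom (presented_algebra X \<R>) (presented_algebra Y \<S>)"
    and eq: "\<And>x. x \<in> X \<Longrightarrow> h (cls X \<R> (gen x)) = h' (cls X \<R> (gen x))"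
    and x: "x \<in> carrier (presented_algebra X \<R>)"
  shows "h x = h' x"
proof -
  interpret A: presentation X \<R> by fact
  obtain p where p: "p \<in> FA X" "x = A.\<pi> p" using x by (auto simp: A.carrier_pres)
  from p(1) have "h (A.\<pi> p) = h' (A.\<pi> p)"
    by (induction rule: FA_induct) (simp_all add: alg_hom_values[OF A B h] alg_hom_values[OF A B h'] eq)
  then show ?thesis by (simp add: p)
qed

text \<open>
  The polynomials that the substitution sends into the ideal of the target form an ideal; as it
  contains the relators, the substitution descends to the quotients.
\<close>

lemma alg_hom_exists:
  assumes A: "presentation X \<R>" and B: "presentation Y \<S>"
    and g: "\<And>x. x \<in> X \<Longrightarrow> g x \<in> FA Y"
    and rel: "\<And>r. r \<in> \<R> \<Longrightarrow> subst g r \<in> relation_ideal Y \<S>"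
  obtains h where "h \<in> alg_hom (presented_algebra X \<R>) (presented_algebra Y \<S>)"
    "\<And>p. p \<in> FA X \<Longrightarrow> h (cls X \<R> p) = cls Y \<S> (subst g p)"
proof -
  interpret A: presentation X \<R> by fact
  interpret B: presentation Y \<S> by fact
  let ?K = "{p \<in> FA X. subst g p \<in> B.I}"
  have gFA: "p \<in> FA X \<Longrightarrow> subst g p \<in> FA Y" for p using subst_FA[of p X g Y] g by blast
  have "ideal ?K (free_algebra X)"
  proof (rule idealI[OF ring_free_algebra])
    show "subgroup ?K (add_monoid (free_algebra X))"
    proof (rule group.subgroupI[OF A.F.a_group])
      fix a assume "a \<in> ?K"
      moreover have "inv\<^bsub>add_monoid (free_algebra X)\<^esub> a = - a" if "a \<in> FA X"
        using A.F.minus_equality[of "- a" a] that FA_minus unfolding a_inv_def by fastforce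
      ultimately show "inv\<^bsub>add_monoid (free_algebra X)\<^esub> a \<in> ?K"
        by (auto simp: subst_minus B.I_minus)
    qed (auto simp: subst_add B.I_add B.I_0 intro!: exI[of _ 0])
  qed (auto simp: subst_mult B.I_mult_left B.I_mult_right gFA)
  then have "A.I \<subseteq> ?K" by (rule A.I_minimal) (use A.relators rel in blast)
  then have I: "subst g p \<in> B.I" if "p \<in> A.I" for p using that by blast
  have wd: "B.\<pi> (subst g p) = B.\<pi> (subst g q)" if "p \<in> FA X" "q \<in> FA X" "A.\<pi> p = A.\<pi> q" for p q
    using that I[of "p - q"] by (simp add: A.cls_eq_iff B.cls_eq_iff gFA subst_diff)
  define h where "h x = B.\<pi> (subst g (SOME p. p \<in> FA X \<and> A.\<pi> p = x))" for x
  have h: "h (A.\<pi> p) = B.\<pi> (subst g p)" if "p \<in> FA X" for p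
  proof -
    have "(SOME q. q \<in> FA X \<and> A.\<pi> q = A.\<pi> p) \<in> FA X \<and> A.\<pi> (SOME q. q \<in> FA X \<and> A.\<pi> q = A.\<pi> p) = A.\<pi> p"
      by (rule someI[of _ p]) (use that in simp)
    then show ?thesis unfolding h_def using wd that by blast
  qed
  have "h \<in> alg_hom A.\<A> B.\<A>"
    unfolding alg_hom_def ring_hom_def
    by (auto simp: A.carrier_pres B.carrier_pres h gFA A.add_pres A.mult_pres A.smult_pres A.one_pres
      B.add_pres B.mult_pres B.smult_pres B.one_pres FA_add FA_mult subst_add subst_mult)
  with h show ?thesis using that by blast
qed

section \<open>Laurent series and matrices over a noncommutative ring\<close>

locale ring_morphism =
  fixes f :: "'a::ring_1 \<Rightarrow> 'b::ring_1"
  assumes add: "f (x + y) = f x + f y" and mult: "f (x * y) = f x * f y" and one [simp]: "f 1 = 1"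
begin

lemma zero [simp]: "f 0 = 0" using add[of 0 0] by simp
lemma minus: "f (- x) = - f x" using add[of x "- x"] by (simp add: eq_neg_iff_add_eq_0 add.commute)
lemma diff: "f (x - y) = f x - f y" using add[of x "- y"] by (simp add: minus)
lemma sum: "f (sum g S) = (\<Sum>i\<in>S. f (g i))"
  by (induction S rule: infinite_finite_induct) (simp_all add: add)

end

lemma ring_morphism_subst: "ring_morphism (subst g)"
  by standard (simp_all add: subst_add subst_mult)

lemma ring_morphism_scal: "ring_morphism scal"
  by standard (simp_all add: scal_add scal_mult)

text \<open>
  Bounds that need not be sharp make it possible to compare products of series whose lowest
  coefficients may cancel or be mapped to zero.
\<close>

lemma fls_times_nth_above:
  fixes f g :: "'a::ring_1 fls"
  assumes f: "\<forall>i<a. fls_nth f i = 0" and g: "\<forall>i<b. fls_nth g i = 0"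
  shows "fls_nth (f * g) n = (\<Sum>i=a..n - b. fls_nth f i * fls_nth g (n - i))"
proof (cases "f = 0 \<or> g = 0")
  case False
  then have "a \<le> fls_subdegree f" "b \<le> fls_subdegree g"
    using fls_subdegree_geI f g by blast+
  then show ?thesis
    unfolding fls_times_nth(2)
    by (intro sum.mono_neutral_left) (auto simp: not_le)
qed auto

lemma fls_zero_below:
  fixes f :: "'a::zero fls"
  obtains a where "\<forall>i<a. fls_nth f i = 0"
  using that[of "fls_subdegree f"] by simp

lemma ring_morphism_fls_map:
  assumes "ring_morphism f"
  shows "ring_morphism (fls_map f)"
proof -
  interpret ring_morphism f by fact
  have nth: "fls_nth (fls_map f a) n = f (fls_nth a n)" for a n by (simp add: fls_map_nth)
  show ?thesis
  proof
    fix x y :: "'a fls"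
    show "fls_map f (x + y) = fls_map f x + fls_map f y"
      by (rule fls_eqI) (simp add: nth add)
    obtain a where a: "\<forall>i<a. fls_nth x i = 0" using fls_zero_below[of x] by blast
    obtain b where b: "\<forall>i<b. fls_nth y i = 0" using fls_zero_below[of y] by blast
    show "fls_map f (x * y) = fls_map f x * fls_map f y"
    proof (rule fls_eqI)
      fix n
      show "fls_nth (fls_map f (x * y)) n = fls_nth (fls_map f x * fls_map f y) n"
        unfolding nth fls_times_nth_above[of a x b y n, OF a b]
        using fls_times_nth_above[of a "fls_map f x" b "fls_map f y" n]
          fls_times_nth_above[of a x b y n, OF a b]
        by (simp add: nth a b sum mult)
    qed
  qed (rule fls_eqI, simp add: nth)
qed

lemma fls_map_const [simp]: "f 0 = 0 \<Longrightarrow> fls_map f (fls_const c) = fls_const (f c)"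
  by (rule fls_eqI) (simp add: fls_map_nth)

lemma fls_map_zero [simp]: "f 0 = 0 \<Longrightarrow> fls_map f 0 = 0"
  by (rule fls_eqI) (simp add: fls_map_nth)

lemma fls_map_X_inv [simp]: "f 0 = 0 \<Longrightarrow> f 1 = 1 \<Longrightarrow> fls_map f fls_X_inv = fls_X_inv"
  by (rule fls_eqI) (simp add: fls_map_nth)

lemma fls_map_one [simp]: "f 0 = 0 \<Longrightarrow> f 1 = 1 \<Longrightarrow> fls_map f 1 = 1"
  by (rule fls_eqI) (simp add: fls_map_nth)

lemma fls_map_fps [simp]: "f 0 = 0 \<Longrightarrow> fls_map f (fps_to_fls (Abs_fps c)) = fps_to_fls (Abs_fps (\<lambda>n. f
    (c n)))"
  by (rule fls_eqI) (simp add: fls_map_nth)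

lemma fls_map_comp: "f 0 = 0 \<Longrightarrow> g 0 = 0 \<Longrightarrow> fls_map f (fls_map g x) = fls_map (\<lambda>c. f (g c)) x"
  by (rule fls_eqI) (simp add: fls_map_nth)

text \<open>
  The componentwise product occupies the symbol \<open>*\<close> on vectors of vectors.  A copy of the type of square
  matrices carries the matrix product as its multiplication, so that ring identities apply to it.
\<close>

typedef ('a, 'n) sqmat = "UNIV :: ('a^'n^'n) set"
  morphisms mat_of sqmat ..

setup_lifting type_definition_sqmat

lemma mat_of_sqmat [simp]: "mat_of (sqmat M) = M" by (simp add: sqmat_inverse)

instantiation sqmat :: (ring_1, finite) ring_1
begin
lift_definition zero_sqmat :: "('a, 'b) sqmat" is 0 .
lift_definition one_sqmat :: "('a, 'b) sqmat" is "mat 1" .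
lift_definition plus_sqmat :: "('a, 'b) sqmat \<Rightarrow> ('a, 'b) sqmat \<Rightarrow> ('a, 'b) sqmat" is "(+)" .
lift_definition minus_sqmat :: "('a, 'b) sqmat \<Rightarrow> ('a, 'b) sqmat \<Rightarrow> ('a, 'b) sqmat" is "(-)" .
lift_definition uminus_sqmat :: "('a, 'b) sqmat \<Rightarrow> ('a, 'b) sqmat" is "uminus" .
lift_definition times_sqmat :: "('a, 'b) sqmat \<Rightarrow> ('a, 'b) sqmat \<Rightarrow> ('a, 'b) sqmat" is "(**)" .
instance
proof
  fix a b c :: "('a, 'b) sqmat"
  show "a * b * c = a * (b * c)" by transfer (simp add: matrix_mul_assoc)
  show "(a + b) * c = a * c + b * c"
    by transfer (simp add: matrix_matrix_mult_def vec_eq_iff distrib_right sum.distrib)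
  show "a * (b + c) = a * b + a * c"
    by transfer (simp add: matrix_matrix_mult_def vec_eq_iff distrib_left sum.distrib)
  show "1 * a = a" "a * 1 = a" by (transfer, simp)+
  show "(0::('a, 'b) sqmat) \<noteq> 1" by transfer (simp add: vec_eq_iff mat_def)
qed (transfer, simp add: algebra_simps)+
end

lemma sqmat_eq_iff: "A = B \<longleftrightarrow> (\<forall>i j. mat_of A $ i $ j = mat_of B $ i $ j)"
  by transfer (simp add: vec_eq_iff)

lemma sqmat_hom:
  "sqmat (M ** N) = sqmat M * sqmat N" "sqmat (M + N) = sqmat M + sqmat N"
  "sqmat (M - N) = sqmat M - sqmat N" "sqmat (mat 1) = 1" "sqmat 0 = 0"
  by (transfer, simp)+

lemmas mat_of_simps = times_sqmat.rep_eq plus_sqmat.rep_eq minus_sqmat.rep_eq one_sqmat.rep_eq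
    zero_sqmat.rep_eq
  uminus_sqmat.rep_eq

definition map_matrix :: "('a \<Rightarrow> 'b) \<Rightarrow> 'a^'n^'m \<Rightarrow> 'b^'n^'m"
  where "map_matrix f M = (\<chi> i j. f (M $ i $ j))"

lemma map_matrix_mult: "ring_morphism f \<Longrightarrow> map_matrix f (M ** N) = map_matrix f M ** map_matrix f N"
  by (simp add: map_matrix_def matrix_matrix_mult_def vec_eq_iff ring_morphism.sum ring_morphism.mult)
lemma map_matrix_diff: "ring_morphism f \<Longrightarrow> map_matrix f (M - N) = map_matrix f M - map_matrix f N"
  by (simp add: map_matrix_def vec_eq_iff ring_morphism.diff)
lemma map_matrix_one: "ring_morphism f \<Longrightarrow> map_matrix f (mat 1) = mat 1"
  by (simp add: map_matrix_def mat_def vec_eq_iff ring_morphism.one ring_morphism.zero)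
lemma map_matrix_kron: "ring_morphism f \<Longrightarrow> map_matrix f (kron M N) = kron (map_matrix f M)
    (map_matrix f N)"
  by (simp add: map_matrix_def kron_def vec_eq_iff ring_morphism.mult)

lemma sum_pair: "(\<Sum>x\<in>(UNIV :: ('a::finite \<times> 'b::finite) set). f x) = (\<Sum>i\<in>UNIV. \<Sum>j\<in>UNIV. f (i, j))"
  by (simp add: sum.cartesian_product flip: UNIV_Times_UNIV)

lemma sum_mat_one:
  fixes f :: "'n::finite \<Rightarrow> 'a::ring_1"
  shows "(\<Sum>k\<in>UNIV. mat 1 $ i $ k * f k) = f i" "(\<Sum>k\<in>UNIV. mat 1 $ k $ i * f k) = f i"
    "(\<Sum>k\<in>UNIV. f k * mat 1 $ i $ k) = f i" "(\<Sum>k\<in>UNIV. f k * mat 1 $ k $ i) = f i"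
  by (simp_all add: mat_def if_distrib[of "\<lambda>x. x * _"] if_distrib[of "\<lambda>x. _ * x"] cong: if_cong)

lemma mat_one_commute: "mat 1 $ i $ j * x = x * (mat 1 $ i $ j :: 'a::ring_1)"
  by (simp add: mat_def)

lemma mat_one_left_commute: "x * (mat 1 $ i $ j * y) = mat 1 $ i $ j * (x * y :: 'a::ring_1)"
  by (simp add: mat_def)

lemma kron_entry: "kron M N $ (i, k) $ (j, l) = M $ i $ j * N $ k $ l"
  by (simp add: kron_def)

lemma kron_product_entry:
  fixes M :: "'a::ring_1^'n::finite^'n" and Z :: "'a^('n \<times> 'n)^('n \<times> 'n)"
  shows "(kron M (mat 1) ** Z) $ (i, k) $ q = (\<Sum>m\<in>UNIV. M $ i $ m * Z $ (m, k) $ q)"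
    "(kron (mat 1) M ** Z) $ (i, k) $ q = (\<Sum>m\<in>UNIV. M $ k $ m * Z $ (i, m) $ q)"
    "(Z ** kron M (mat 1)) $ p $ (j, l) = (\<Sum>m\<in>UNIV. Z $ p $ (m, l) * M $ m $ j)"
    "(Z ** kron (mat 1) M) $ p $ (j, l) = (\<Sum>m\<in>UNIV. Z $ p $ (j, m) * M $ m $ l)"
proof -
  show "(kron M (mat 1) ** Z) $ (i, k) $ q = (\<Sum>m\<in>UNIV. M $ i $ m * Z $ (m, k) $ q)"
    by (simp add: sum_mat_one matrix_matrix_mult_def kron_entry sum_pair mult.assoc flip:
        sum_distrib_left)
  show "(Z ** kron (mat 1) M) $ p $ (j, l) = (\<Sum>m\<in>UNIV. Z $ p $ (j, m) * M $ m $ l)"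
    by (simp add: sum_mat_one matrix_matrix_mult_def kron_entry sum_pair mat_one_left_commute flip:
        sum_distrib_left)
  show "(kron (mat 1) M ** Z) $ (i, k) $ q = (\<Sum>m\<in>UNIV. M $ k $ m * Z $ (i, m) $ q)"
    by (simp add: sum_mat_one matrix_matrix_mult_def kron_entry sum_pair mult.assoc flip:
        sum_distrib_left)
  show "(Z ** kron M (mat 1)) $ p $ (j, l) = (\<Sum>m\<in>UNIV. Z $ p $ (m, l) * M $ m $ j)"
    by (simp add: sum_mat_one matrix_matrix_mult_def kron_entry sum_pair mult.assoc[symmetric])
qed

lemma kron_one_hom:
  fixes M N :: "'a::ring_1^'n::finite^'n"
  shows "kron (M ** N) (mat 1) = kron M (mat 1) ** kron N (mat 1)"
    and "kron (mat 1) (M ** N) = kron (mat 1) M ** kron (mat 1) N"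
    and "kron (M + N) (mat 1) = kron M (mat 1) + kron N (mat 1)"
    and "kron (mat 1) (M + N) = kron (mat 1) M + kron (mat 1) N"
    and "kron (M - N) (mat 1) = kron M (mat 1) - kron N (mat 1)"
    and "kron (mat 1) (M - N) = kron (mat 1) M - kron (mat 1) N"
  by (simp_all only: vec_eq_iff split_paired_All kron_product_entry vector_add_component
      vector_minus_component kron_entry)
    (auto simp: matrix_matrix_mult_def sum_distrib_left sum_distrib_right mat_def
      if_distrib[of "\<lambda>x. x * _"] if_distrib[of "\<lambda>x. _ * x"] algebra_simps cong: if_cong)

section \<open>The reflection equation from one commutation relation\<close>

locale central_algebra = Modules.module scl for scl :: "'k::field \<Rightarrow> 'r::ring_1 \<Rightarrow> 'r" +
  assumes mult_scl_left: "scl a x * y = scl a (x * y)"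
    and mult_scl_right: "x * scl a y = scl a (x * y)"

definition two_sided :: "'a::ring_1 set \<Rightarrow> bool"
  where "two_sided J \<longleftrightarrow> 0 \<in> J \<and> (\<forall>x\<in>J. \<forall>y\<in>J. x + y \<in> J) \<and> (\<forall>x\<in>J. \<forall>r. r * x \<in> J \<and> x * r \<in> J)"

text \<open>
  The relations that hold exactly for the permutation operator \<open>P\<close>, its twisted partial transpose
  \<open>Q\<close>, and the two copies of a matrix \<open>A = F - N/4\<close> with \<open>F\<close> skew.  Here \<open>N = 2 (\<kappa> + \<epsilon>)\<close>.
\<close>

locale reflection_setting = central_algebra scl for scl :: "'k::field \<Rightarrow> 'r::ring_1 \<Rightarrow> 'r" +
  fixes P Q A\<^sub>1 A\<^sub>2 :: 'r and \<epsilon> \<kappa> :: 'k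
  assumes PP: "P * P = 1" and PQ: "P * Q = scl \<epsilon> Q" and QP: "Q * P = scl \<epsilon> Q"
    and QQ: "Q * Q = scl (2 * (\<kappa> + \<epsilon>)) Q"
    and PA: "P * A\<^sub>1 = A\<^sub>2 * P" "P * A\<^sub>2 = A\<^sub>1 * P"
    and A2Q: "A\<^sub>2 * Q = - (A\<^sub>1 * Q) - scl (\<kappa> + \<epsilon>) Q"
    and QA2: "Q * A\<^sub>2 = - (Q * A\<^sub>1) - scl (\<kappa> + \<epsilon>) Q"
begin

text \<open>
  The R-matrix at \<open>x\<close> is \<open>R (1 / x) (1 / (x - \<kappa>))\<close>; with the two fractions as parameters, the
  computations below use only the linear equations that define them.
\<close>

definition R :: "'k \<Rightarrow> 'k \<Rightarrow> 'r"
  where "R b a = 1 - scl b P + scl a Q"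

definition B :: 'r where "B = A\<^sub>2 - P + Q"

definition D :: "'k \<Rightarrow> 'r" where "D u = scl (u + \<epsilon>) 1 + A\<^sub>1"

lemmas expand = distrib_left distrib_right left_diff_distrib right_diff_distrib
  mult_scl_left mult_scl_right scale_left_distrib scale_left_diff_distrib
  scale_right_distrib scale_right_diff_distrib scale_minus_left scale_minus_right scale_scale

lemma scl_2: "scl (2 * c) x = scl c x + scl c x" "scl (c * 2) x = scl c x + scl c x"
  by (simp_all only: mult_2 mult_2_right scale_left_distrib)

text \<open>
  From \<open>(A\<^sub>1 + A\<^sub>2) Q = - (\<kappa> + \<epsilon>) Q\<close>, \<open>P Q = \<epsilon> Q\<close> and \<open>Q\<^sup>2 = 2 (\<kappa> + \<epsilon>) Q\<close> the constants add up to
  \<open>- (\<kappa> + \<epsilon>) - \<epsilon> + 2 (\<kappa> + \<epsilon>) = \<kappa>\<close>.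
\<close>

lemma BQ: "B * Q = scl \<kappa> Q - A\<^sub>1 * Q"
  unfolding B_def by (simp add: expand A2Q PQ QQ scl_2 algebra_simps)

lemma QB: "Q * B = scl \<kappa> Q - Q * A\<^sub>1"
  unfolding B_def by (simp add: expand QA2 QP QQ scl_2 algebra_simps)

text \<open>
  Apart from \<open>v - B\<close>, the term with \<open>P\<close> ends in \<open>u - A\<^sub>1\<close>, which will cancel the resolvent to its right,
  and the term with \<open>Q\<close> has absorbed \<open>A\<^sub>2\<close> by skewness.
\<close>

lemma left_factor:
  assumes "b * (u - v) = 1" "a * (u - v - \<kappa>) = 1"
  shows "(scl v 1 - A\<^sub>2) * R b a =
    scl v 1 - B - scl b (P * (scl u 1 - A\<^sub>1)) + scl a (D u * Q)"
proof -
  have b: "b * u = 1 + b * v" and a: "a * u = 1 + a * v + a * \<kappa>"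
    using assms by (simp_all add: right_diff_distrib distrib_left diff_eq_eq eq_diff_eq)
  show ?thesis
    unfolding R_def B_def D_def
    by (simp add: expand A2Q PA b a)
qed

lemma right_factor:
  assumes "b * (u + v) = 1" "a * (u + v - \<kappa>) = 1"
  shows "R b a * (scl v 1 + A\<^sub>2) =
    scl v 1 + B + scl b ((scl u 1 - A\<^sub>1) * P) - scl a (Q * D u)"
proof -
  have b: "b * u = 1 - b * v" and a: "a * u = 1 - a * v + a * \<kappa>"
    using assms by (simp_all add: right_diff_distrib distrib_left diff_eq_eq eq_diff_eq diff_add_eq)
  show ?thesis
    unfolding R_def B_def D_def
    by (simp add: expand QA2 PA b a) (simp add: algebra_simps)
qed

text \<open>
  The nine products of the two factorisations.  The commutator \<open>C\<close> records the price of moving \<open>B\<close>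
  past the resolvent; the poles at \<open>u \<mp> v = \<kappa>\<close> cancel in the terms with a single \<open>Q\<close> and a resolvent,
  because \<open>B\<close> turns into \<open>\<kappa> - A\<^sub>1\<close> next to \<open>Q\<close>.
\<close>

lemma sandwich:
  assumes b: "b * (u - v) = 1" and a: "a * (u - v - \<kappa>) = 1"
    and b': "b' * (u + v) = 1" and a': "a' * (u + v - \<kappa>) = 1"
    and X: "X * (scl u 1 - A\<^sub>1) = 1" "(scl u 1 - A\<^sub>1) * X = 1"
  defines "C \<equiv> B * X - X * B"
  shows "(scl v 1 - A\<^sub>2) * R b a * X * R b' a' * (scl v 1 + A\<^sub>2) =
    scl (v * v) X - scl v C - B * X * B + scl ((b' - b) * v) P - scl b' (B * P) - scl b (P * B)
    - X * Q * D u - D u * Q * X + scl a' (Q * D u + C * Q * D u) + scl a (D u * Q - D u * Q * C)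
    - scl (b * b') (P * (scl u 1 - A\<^sub>1) * P) + scl (\<epsilon> * (b * a')) (Q * D u)
    + scl (\<epsilon> * (a * b')) (D u * Q) - scl (a * a') (D u * Q * X * Q * D u)"
proof -
  have a'u: "a' * v + a' * u = 1 + a' * \<kappa>" and au: "a * u = 1 + a * v + a * \<kappa>"
    using a a' by (simp_all add: right_diff_distrib distrib_left diff_eq_eq add.commute
        add.left_commute)
  have XA: "X * A\<^sub>1 = scl u X - 1" and AX: "A\<^sub>1 * X = scl u X - 1"
    using X by (simp_all add: expand algebra_simps)
  have BXQ: "B * X * Q = scl (\<kappa> - u) (X * Q) + Q + C * Q"
  proof -
    have "B * X * Q = X * (B * Q) + C * Q" by (simp add: C_def expand mult.assoc)
    also have "X * (B * Q) = scl \<kappa> (X * Q) - (X * A\<^sub>1) * Q" by (simp add: BQ expand mult.assoc)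
    finally show ?thesis by (simp add: XA expand)
  qed
  have QXB: "Q * X * B = scl (\<kappa> - u) (Q * X) + Q - Q * C"
  proof -
    have "Q * X * B = (Q * B) * X - Q * C" by (simp add: C_def expand mult.assoc)
    also have "(Q * B) * X = scl \<kappa> (Q * X) - Q * (A\<^sub>1 * X)" by (simp add: QB expand mult.assoc)
    finally show ?thesis by (simp add: AX expand)
  qed
  define E F where EF: "E = scl u 1 - A\<^sub>1" "F = D u"
  have "(scl v 1 - A\<^sub>2) * R b a * X = scl v X - B * X - scl b P + scl a (F * Q * X)"
    using X by (simp only: left_factor[OF b a] EF)
      (simp add: distrib_right left_diff_distrib mult_scl_left mult.assoc)
  then have "(scl v 1 - A\<^sub>2) * R b a * X * R b' a' * (scl v 1 + A\<^sub>2) =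
     (scl v X - B * X - scl b P + scl a (F * Q * X)) * (scl v 1 + B + scl b' (E * P) - scl a' (Q * F))"
    using right_factor[OF b' a'] by (simp add: mult.assoc EF)
  also have "\<dots> = scl (v * v) X + scl v (X * B) - scl v (B * X) - B * X * B
     + scl (b' * v) (X * E * P) - scl b' (B * (X * E) * P)
     - scl (a' * v) (X * Q * F) + scl a' (B * X * Q * F)
     - scl (b * v) P - scl b (P * B) - scl (b * b') (P * E * P) + scl (b * a') ((P * Q) * F)
     + scl (a * v) (F * Q * X) + scl a (F * (Q * X * B)) + scl (a * b') (F * Q * (X * E) * P)
     - scl (a * a') (F * Q * X * Q * F)"
    by (simp add: expand mult.assoc algebra_simps)
  also have "\<dots> = scl (v * v) X + scl v (X * B) - scl v (B * X) - B * X * B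
     + scl (b' * v) P - scl b' (B * P)
     - scl (a' * v) (X * Q * F) + scl a' ((scl (\<kappa> - u) (X * Q) + Q + C * Q) * F)
     - scl (b * v) P - scl b (P * B) - scl (b * b') (P * E * P) + scl (b * a') (scl \<epsilon> Q * F)
     + scl (a * v) (F * Q * X) + scl a (F * (scl (\<kappa> - u) (Q * X) + Q - Q * C)) + scl (a * b') (F *
         scl \<epsilon> Q)
     - scl (a * a') (F * Q * X * Q * F)"
    using X by (simp add: EF(1)[symmetric] PQ flip: BXQ QXB) (simp add: mult.assoc QP)
  also have "\<dots> = scl (v * v) X - scl v (B * X - X * B) - B * X * B + scl ((b' - b) * v) P - scl b'
      (B * P) - scl b (P * B)
    - scl (a' * v + a' * u - a' * \<kappa>) (X * Q * F) - scl (a * u - a * v - a * \<kappa>) (F * Q * X) + scl a'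
        (Q * F + C * Q * F) + scl a (F * Q - F * Q * C)
    - scl (b * b') (P * E * P) + scl (\<epsilon> * (b * a')) (Q * F)
    + scl (\<epsilon> * (a * b')) (F * Q) - scl (a * a') (F * Q * X * Q * F)"
    by (simp add: expand mult.assoc) (simp add: algebra_simps)
  finally show ?thesis by (simp add: a'u au EF C_def)
qed

end

context reflection_setting begin
lemma scl_neg1: "scl (- v) 1 - x = - (scl v 1 + x)" "scl (- v) 1 + x = - (scl v 1 - x)"
  by (simp_all add: scale_minus_left)

text \<open>
  The right-hand side of the reflection equation arises from the left-hand side by \<open>v \<mapsto> - v\<close>, so
  both are instances of \<open>sandwich\<close>.  Substituting \<open>S = 2 u X - 1\<close>, the terms without a resolvent
  contribute the commutator of \<open>A\<^sub>2\<close> with \<open>R(u - v) R(u + v)\<close>, and the rational coefficients of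
  \<open>[A\<^sub>2, P]\<close> and \<open>[A\<^sub>1, Q]\<close> cancel; only terms with \<open>C\<close> survive.
\<close>

lemma reflection_equation_mod:
  assumes b: "b * (u - v) = 1" and a: "a * (u - v - \<kappa>) = 1"
    and b': "b' * (u + v) = 1" and a': "a' * (u + v - \<kappa>) = 1"
    and X: "X * (scl u 1 - A\<^sub>1) = 1" "(scl u 1 - A\<^sub>1) * X = 1"
    and S: "S = scl (2 * u) X - 1"
    and T: "T * (scl v 1 - A\<^sub>2) = scl v 1 + A\<^sub>2" "(scl v 1 - A\<^sub>2) * T = scl v 1 + A\<^sub>2"
  defines "C \<equiv> B * X - X * B"
  shows "(scl v 1 - A\<^sub>2) * (R b a * S * R b' a' * T - T * R b' a' * S * R b a) * (scl v 1 - A\<^sub>2) =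
    scl (2 * u) (scl (a' - a) (C * Q * D u + D u * Q * C) - scl (2 * v) C)"
proof -
  let ?L = "scl v 1 - A\<^sub>2" and ?L' = "scl v 1 + A\<^sub>2"
  let ?F = "?L * R b a * X * R b' a' * ?L'" and ?F' = "?L' * R b' a' * X * R b a * ?L"
  have 1: "?F = scl (v * v) X - scl v C - B * X * B + scl ((b' - b) * v) P - scl b' (B * P) - scl b
      (P * B)
    - X * Q * D u - D u * Q * X + scl a' (Q * D u + C * Q * D u) + scl a (D u * Q - D u * Q * C)
    - scl (b * b') (P * (scl u 1 - A\<^sub>1) * P) + scl (\<epsilon> * (b * a')) (Q * D u)
    + scl (\<epsilon> * (a * b')) (D u * Q) - scl (a * a') (D u * Q * X * Q * D u)"
    using sandwich[OF b a b' a' X] unfolding C_def .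
  have 2: "?F' = scl (v * v) X + scl v C - B * X * B + scl ((b' - b) * v) P - scl b (B * P) - scl b'
      (P * B)
    - X * Q * D u - D u * Q * X + scl a (Q * D u + C * Q * D u) + scl a' (D u * Q - D u * Q * C)
    - scl (b * b') (P * (scl u 1 - A\<^sub>1) * P) + scl (\<epsilon> * (a * b')) (Q * D u)
    + scl (\<epsilon> * (b * a')) (D u * Q) - scl (a * a') (D u * Q * X * Q * D u)"
  proof -
    have e: "u - - v = u + v" "u + - v = u - v" "u - - v - \<kappa> = u + v - \<kappa>" by simp_all
    have "?F' = (scl (- v) 1 - A\<^sub>2) * R b' a' * X * R b a * (scl (- v) 1 + A\<^sub>2)"
      by (simp only: scl_neg1 minus_mult_left[symmetric] minus_mult_right[symmetric] minus_minus)
    also have "\<dots> = scl (- v * - v) X - scl (- v) C - B * X * B + scl ((b - b') * - v) P - scl b (B *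
        P) - scl b' (P * B)
    - X * Q * D u - D u * Q * X + scl a (Q * D u + C * Q * D u) + scl a' (D u * Q - D u * Q * C)
    - scl (b' * b) (P * (scl u 1 - A\<^sub>1) * P) + scl (\<epsilon> * (b' * a)) (Q * D u)
    + scl (\<epsilon> * (a' * b)) (D u * Q) - scl (a' * a) (D u * Q * X * Q * D u)"
      unfolding C_def by (rule sandwich) (use b a b' a' X in simp_all)
    finally show ?thesis by (simp add: scale_minus_left algebra_simps)
  qed
  have comm: "R b' a' * R b a = R b a * R b' a'"
    unfolding R_def by (simp add: expand PQ QP algebra_simps)
  have BP: "B * P - P * B = A\<^sub>2 * P - A\<^sub>1 * P"
    unfolding B_def by (simp add: expand PQ QP PA algebra_simps)
  have QD: "Q * D u - D u * Q = Q * A\<^sub>1 - A\<^sub>1 * Q"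
    unfolding D_def by (simp add: expand)
  have "?F - ?F' = - scl (2 * v) C + scl (b - b') (B * P - P * B) + scl (a' - a + \<epsilon> * (b * a' - a *
      b')) (Q * D u - D u * Q)
      + scl (a' - a) (C * Q * D u + D u * Q * C)"
    unfolding 1 2 by (simp add: expand scl_2 algebra_simps)
  then have FF: "?F - ?F' = scl (a' - a) (C * Q * D u + D u * Q * C) - scl (2 * v) C
     + scl (b - b') (A\<^sub>2 * P - A\<^sub>1 * P) + scl (a' - a + \<epsilon> * (b * a' - a * b')) (Q * A\<^sub>1 - A\<^sub>1 * Q)"
    unfolding BP QD by simp
  let ?M = "R b a * R b' a'"
  have M: "?M = scl (1 + b * b') 1 - scl (b + b') P + scl (a + a' - \<epsilon> * (b * a' + a * b') + ((\<kappa> + \<epsilon>)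
      * (a * a') + (\<kappa> + \<epsilon>) * (a * a'))) Q"
    unfolding R_def by (simp add: expand PP PQ QP QQ[unfolded scl_2] scl_2[of "_ * (_ * _)",
        unfolded mult.assoc] algebra_simps)
  have "?L * ?M * ?L' - ?L' * ?M * ?L = scl (2 * v) (?M * A\<^sub>2 - A\<^sub>2 * ?M)"
    by (simp add: expand scl_2 algebra_simps)
  also have "?M * A\<^sub>2 - A\<^sub>2 * ?M = scl (b + b') (A\<^sub>2 * P - A\<^sub>1 * P) - scl (a + a' - \<epsilon> * (b * a' + a
      * b') + ((\<kappa> + \<epsilon>) * (a * a') + (\<kappa> + \<epsilon>) * (a * a'))) (Q * A\<^sub>1 - A\<^sub>1 * Q)"
    unfolding M by (simp add: expand PA QA2 A2Q scl_2 algebra_simps)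
  finally have MM: "?L * ?M * ?L' - ?L' * ?M * ?L = scl (2 * v * (b + b')) (A\<^sub>2 * P - A\<^sub>1 * P)
     - scl (2 * v * (a + a' - \<epsilon> * (b * a' + a * b') + ((\<kappa> + \<epsilon>) * (a * a') + (\<kappa> + \<epsilon>) * (a * a')))) (Q
         * A\<^sub>1 - A\<^sub>1 * Q)"
    by (simp add: scale_right_diff_distrib)
  define x where "x = b * b'"
  define y where "y = a * a'"
  have bx: "b = x * (u + v)" and b'x: "b' = x * (u - v)" and ay: "a = y * (u + v - \<kappa>)" and a'y: "a'
      = y * (u - v - \<kappa>)"
    unfolding x_def y_def using b b' a a' by (simp_all add: mult.assoc mult.left_commute[of _ b']
        mult.left_commute[of _ a'])
  have xy: "x * (u + v) * (u - v) = 1" using b bx by simp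
  \<comment> \<open>All fractions are polynomial multiples of \<open>b b'\<close> and \<open>a a'\<close>.\<close>
  have c1: "2 * u * (b - b') = 2 * v * (b + b')"
    by (subst (1 2) bx, subst (1 2) b'x) (simp add: algebra_simps)
  have c2: "2 * u * (a' - a + \<epsilon> * (b * a' - a * b')) = - (2 * v * (a + a' - \<epsilon> * (b * a' + a * b') +
      ((\<kappa> + \<epsilon>) * (a * a') + (\<kappa> + \<epsilon>) * (a * a'))))"
    (is "?lhs2 = ?rhs2")
  proof -
    have "b * a' + a * b' = x * y * ((u + v) * (u - v - \<kappa>) + (u + v - \<kappa>) * (u - v))"
      "b * a' - a * b' = x * y * ((u + v) * (u - v - \<kappa>) - (u + v - \<kappa>) * (u - v))"
      by (simp_all add: bx b'x ay a'y algebra_simps)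
    then have l: "?lhs2 = 2 * u * (y * (u - v - \<kappa>) - y * (u + v - \<kappa>)
         + \<epsilon> * (x * y * ((u + v) * (u - v - \<kappa>) - (u + v - \<kappa>) * (u - v))))"
      and r: "?rhs2 = - (2 * v * (y * (u + v - \<kappa>) + y * (u - v - \<kappa>)
         - \<epsilon> * (x * y * ((u + v) * (u - v - \<kappa>) + (u + v - \<kappa>) * (u - v)))
         + ((\<kappa> + \<epsilon>) * y + (\<kappa> + \<epsilon>) * y)))"
      unfolding y_def[symmetric] by (simp_all only: ay[symmetric] a'y[symmetric])
    have m: "- (2 * v * (y * (u + v - \<kappa>) + y * (u - v - \<kappa>)
         - \<epsilon> * (x * y * ((u + v) * (u - v - \<kappa>) + (u + v - \<kappa>) * (u - v)))
         + ((\<kappa> + \<epsilon>) * y + (\<kappa> + \<epsilon>) * y))) = 2 * u * (y * (u - v - \<kappa>) - y * (u + v - \<kappa>)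
         + \<epsilon> * (x * y * ((u + v) * (u - v - \<kappa>) - (u + v - \<kappa>) * (u - v))))
         + 4 * v * \<epsilon> * y * (x * (u + v) * (u - v) - 1)"
      by (simp add: algebra_simps)
    show ?thesis unfolding l r m xy by simp
  qed
  have "?L * (R b a * S * R b' a' * T - T * R b' a' * S * R b a) * ?L =
     ?L * R b a * S * R b' a' * (T * ?L) - (?L * T) * R b' a' * S * R b a * ?L"
    by (simp add: left_diff_distrib[of _ _ ?L] right_diff_distrib[of ?L] mult.assoc)
  also have "\<dots> = ?L * R b a * S * R b' a' * ?L' - ?L' * R b' a' * S * R b a * ?L"
    by (simp only: T)
  also have "\<dots> = scl (2 * u) (?F - ?F') - (?L * ?M * ?L' - ?L' * ?M * ?L)"
  proof -
    have "l * r * S * r' * l' = scl (2 * u) (l * r * X * r' * l') - l * (r * r') * l'" for l r r' l'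
      unfolding S by (simp add: left_diff_distrib right_diff_distrib mult_scl_left mult_scl_right
          mult.assoc)
    then show ?thesis by (simp add: scale_right_diff_distrib comm)
  qed
  also have "\<dots> = scl (2 * u) (scl (a' - a) (C * Q * D u + D u * Q * C) - scl (2 * v) C)"
    unfolding FF MM by (simp add: scale_right_distrib scale_scale c1 c2)
  finally show ?thesis .
qed

text \<open>
  Both \<open>u - A\<^sub>1\<close> and \<open>v - A\<^sub>2\<close> are invertible, with inverses built from \<open>S\<close> and \<open>T\<close>, so
  \<open>C = X [B, A\<^sub>1] X\<close> lies in the ideal and the outer factors \<open>v - A\<^sub>2\<close> can be removed.
\<close>

lemma reflection_equation_in_ideal:
  assumes b: "b * (u - v) = 1" and a: "a * (u - v - \<kappa>) = 1"
    and b': "b' * (u + v) = 1" and a': "a' * (u + v - \<kappa>) = 1"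
    and nz: "2 * u \<noteq> 0" "2 * v \<noteq> 0"
    and S: "S * (scl u 1 - A\<^sub>1) = scl u 1 + A\<^sub>1" "(scl u 1 - A\<^sub>1) * S = scl u 1 + A\<^sub>1"
    and T: "T * (scl v 1 - A\<^sub>2) = scl v 1 + A\<^sub>2" "(scl v 1 - A\<^sub>2) * T = scl v 1 + A\<^sub>2"
    and J: "two_sided J" and comm: "B * A\<^sub>1 - A\<^sub>1 * B \<in> J"
  shows "R b a * S * R b' a' * T - T * R b' a' * S * R b a \<in> J"
proof -
  have resolvent: "Z * E = 1 \<and> E * Z = 1 \<and> W = scl (2 * w) Z - 1"
    if "W * E = scl w 1 + A" "E * W = scl w 1 + A" "E = scl w 1 - A" "Z = scl (1 / (2 * w)) (W + 1)"
        "2 * w \<noteq> 0"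
    for W E A Z w
  proof -
    have "(W + 1) * E = scl (2 * w) 1" "E * (W + 1) = scl (2 * w) 1"
      using that(1-3) by (simp_all add: distrib_left distrib_right scl_2)
    then show ?thesis using that by (simp add: mult_scl_left mult_scl_right scale_scale)
  qed
  define X where "X = scl (1 / (2 * u)) (S + 1)"
  have X: "X * (scl u 1 - A\<^sub>1) = 1" "(scl u 1 - A\<^sub>1) * X = 1" "S = scl (2 * u) X - 1"
    using resolvent[OF S refl X_def nz(1)] by blast+
  define Y where "Y = scl (1 / (2 * v)) (T + 1)"
  let ?L = "scl v 1 - A\<^sub>2" and ?C = "B * X - X * B"
  have Y: "Y * ?L = 1" "?L * Y = 1"
    using resolvent[OF T refl Y_def nz(2)] by blast+
  note J = J[unfolded two_sided_def]
  have sclJ: "scl c x \<in> J" if "x \<in> J" for c x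
    using J that mult_scl_left[of c 1 x] by (metis mult_1)
  have minusJ: "x - y \<in> J" if "x \<in> J" "y \<in> J" for x y
    using J that sclJ[of y "- 1"] by (metis scale_minus_left scale_one add_uminus_conv_diff)
  have "?C = (X * (scl u 1 - A\<^sub>1)) * B * X - X * B * ((scl u 1 - A\<^sub>1) * X)" by (simp add: X)
  also have "\<dots> = X * (B * A\<^sub>1 - A\<^sub>1 * B) * X"
    by (simp add: left_diff_distrib right_diff_distrib mult_scl_left mult_scl_right mult.assoc)
  finally have C: "?C \<in> J" using J comm by simp
  let ?Z = "R b a * S * R b' a' * T - T * R b' a' * S * R b a"
  have "?L * ?Z * ?L \<in> J"
    unfolding reflection_equation_mod[OF b a b' a' X T]
  proof (rule sclJ, rule minusJ; rule sclJ)
    have "?C * Q * D u \<in> J" "D u * Q * ?C \<in> J" using J C by blast+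
    then show "?C * Q * D u + D u * Q * ?C \<in> J" using J by blast
  qed (rule C)
  then have "Y * (?L * ?Z * ?L) * Y \<in> J" using J by blast
  also have "Y * (?L * ?Z * ?L) * Y = (Y * ?L) * ?Z * (?L * Y)" by (simp only: mult.assoc)
  finally show ?thesis by (simp add: Y)
qed

end

section \<open>Ideals, central scalars and Cayley series\<close>

lemma two_sided_sum:
  assumes "two_sided J" "\<And>i. i \<in> S \<Longrightarrow> f i \<in> J" shows "sum f S \<in> J"
  using assms(2) by (induction S rule: infinite_finite_induct) (use assms(1) in \<open>auto simp:
      two_sided_def\<close>)

lemma two_sided_fls:
  assumes I: "two_sided I" shows "two_sided {f. \<forall>n. fls_nth f n \<in> I}"
proof -
  have "fls_nth (r * x) n \<in> I" "fls_nth (x * r) n \<in> I" if x: "\<forall>n. fls_nth x n \<in> I" for x r n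
  proof -
    obtain a where a: "\<forall>i<a. fls_nth x i = 0" using fls_zero_below[of x] by blast
    obtain b where b: "\<forall>i<b. fls_nth r i = 0" using fls_zero_below[of r] by blast
    show "fls_nth (r * x) n \<in> I" "fls_nth (x * r) n \<in> I"
      using I x unfolding fls_times_nth_above[of a x b r n, OF a b] fls_times_nth_above[of b r a x
          n, OF b a]
      by (auto intro!: two_sided_sum simp: two_sided_def)
  qed
  then show ?thesis using I by (simp add: two_sided_def)
qed

lemma two_sided_sqmat:
  assumes I: "two_sided I"
  shows "two_sided {M :: ('a::ring_1, 'n::finite) sqmat. \<forall>p q. mat_of M $ p $ q \<in> I}"
  using I by (auto simp: two_sided_def mat_of_simps matrix_matrix_mult_def intro!: two_sided_sum[OF I])

lemma fls_map_central:
  fixes f :: "'a::ring_1 \<Rightarrow> 'b::ring_1"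
  assumes f: "ring_morphism f" and c: "\<And>a x. f a * x = x * f a"
  shows "fls_map f a * x = x * fls_map f a"
proof (rule fls_eqI)
  fix n
  interpret ring_morphism f by fact
  obtain l where l: "\<forall>i<l. fls_nth x i = 0" using fls_zero_below[of x] by blast
  obtain k where k: "\<forall>i<k. fls_nth a i = 0" using fls_zero_below[of a] by blast
  have k': "\<forall>i<k. fls_nth (fls_map f a) i = 0" by (simp add: fls_map_nth k)
  show "fls_nth (fls_map f a * x) n = fls_nth (x * fls_map f a) n"
    unfolding fls_times_nth_above[of l x k "fls_map f a" n, OF l k']
      fls_times_nth_above[of k "fls_map f a" l x n, OF k' l]
    by (rule sum.reindex_bij_witness[of _ "\<lambda>i. n - i" "\<lambda>i. n - i"]) (auto simp: fls_map_nth c)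
qed

text \<open>
  The scalar multiplication of matrices that a homomorphism \<open>h\<close> into the centre of the ring of
  entries defines.
\<close>

definition mscale :: "('k \<Rightarrow> 'a) \<Rightarrow> 'k \<Rightarrow> ('a::ring_1, 'n::finite) sqmat \<Rightarrow> ('a, 'n) sqmat"
  where "mscale h c M = sqmat (\<chi> p q. h c * mat_of M $ p $ q)"

lemma mscale_entry [simp]: "mat_of (mscale h c M) $ p $ q = h c * mat_of M $ p $ q"
  by (simp add: mscale_def)

lemma central_algebra_mscale:
  fixes h :: "'k::field \<Rightarrow> 'a::ring_1"
  assumes h: "ring_morphism h" and c: "\<And>a x. h a * x = x * h a"
  shows "central_algebra (mscale h)"
proof -
  interpret ring_morphism h by fact
  have lc: "x * (h a * y) = h a * (x * y)" for a x y
    by (metis c mult.assoc)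
  show ?thesis
  proof
    fix a :: 'k and x y :: "('a, 'n::finite) sqmat"
    show "x * mscale h a y = mscale h a (x * y)"
      by (simp add: sqmat_eq_iff mat_of_simps matrix_matrix_mult_def lc[of _ a] sum_distrib_left)
  qed (simp_all add: sqmat_eq_iff mat_of_simps matrix_matrix_mult_def add mult distrib_left
      distrib_right
      mult.assoc sum_distrib_left)
qed

definition fls_matrix :: "('a::ring_1, 'n::finite) sqmat \<Rightarrow> ('a fls, 'n) sqmat"
  where "fls_matrix M = sqmat (map_matrix fls_const (mat_of M))"

text \<open>
  The coefficients of \<open>(u + A)/(u - A) = 1 + 2 \<Sum> A\<^sup>r u\<^sup>-\<^sup>r\<close> in \<open>u\<inverse>\<close>; \<open>cayley\<close> is the series itself.
\<close>

definition cayley_coeff :: "'a::ring_1 \<Rightarrow> nat \<Rightarrow> 'a"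
  where "cayley_coeff A r = (if r = 0 then 1 else A ^ r + A ^ r)"

definition cayley :: "('a::ring_1, 'n::finite) sqmat \<Rightarrow> ('a fls, 'n) sqmat"
  where "cayley A = sqmat (\<chi> i j. fps_to_fls (Abs_fps (\<lambda>r. mat_of (cayley_coeff A r) $ i $ j)))"

lemma cayley_step:
  "cayley_coeff A (Suc r) - cayley_coeff A r * A = (if r = 0 then A else 0)"
  "cayley_coeff A (Suc r) - A * cayley_coeff A r = (if r = 0 then A else 0)"
  by (simp_all add: cayley_coeff_def distrib_left distrib_right power_commutes)

lemma cayley_eq:
  fixes A :: "('a::ring_1, 'n::finite) sqmat"
  defines "x \<equiv> sqmat (mat fls_X_inv) :: ('a fls, 'n) sqmat"
  shows "cayley A * (x - fls_matrix A) = x + fls_matrix A"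
    and "(x - fls_matrix A) * cayley A = x + fls_matrix A"
proof -
  let ?C = "\<lambda>r. mat_of (cayley_coeff A r)"
  have nth: "fls_nth (mat_of (cayley A) $ i $ j) n = (if n < 0 then 0 else ?C (nat n) $ i $ j)" for
      i j n
    by (simp add: cayley_def)
  have entry: "mat_of (cayley_coeff A (Suc r)) $ i $ j - (\<Sum>k\<in>UNIV. ?C r $ i $ k * mat_of A $ k $ j)
      = (if r = 0 then mat_of A $ i $ j else 0)"
     "mat_of (cayley_coeff A (Suc r)) $ i $ j - (\<Sum>k\<in>UNIV. mat_of A $ i $ k * ?C r $ k $ j) = (if r =
         0 then mat_of A $ i $ j else 0)" for r i j
    using arg_cong[OF cayley_step(1)[of A r], of "\<lambda>M. mat_of M $ i $ j"] arg_cong[OF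
        cayley_step(2)[of A r], of "\<lambda>M. mat_of M $ i $ j"]
    by (auto simp: mat_of_simps matrix_matrix_mult_def split: if_splits)
  have x: "cayley A * x = sqmat (\<chi> i j. fls_shift 1 (mat_of (cayley A) $ i $ j))" "x * cayley A =
      sqmat (\<chi> i j. fls_shift 1 (mat_of (cayley A) $ i $ j))"
    by (simp_all add: x_def sqmat_eq_iff mat_of_simps matrix_matrix_mult_def mat_def if_distrib[of
        "\<lambda>x. x * _"] if_distrib[of "\<lambda>x. _ * x"] fls_X_inv_times_conv_shift cong: if_cong)
  have r: "fls_nth (mat_of (x + fls_matrix A) $ i $ j) n = (if n = -1 then mat 1 $ i $ j else if n =
      0 then mat_of A $ i $ j else 0)" for i j n
    by (simp add: x_def fls_matrix_def mat_of_simps mat_def map_matrix_def)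
  have cases: "n < -1 \<or> n = -1 \<or> (\<exists>r. n = int r)" for n :: int
    by (cases "n \<ge> 0") (auto intro: exI[of _ "nat n"])
  show "cayley A * (x - fls_matrix A) = x + fls_matrix A"
  proof (unfold sqmat_eq_iff, intro allI fls_eqI)
    fix i j n
    show "fls_nth (mat_of (cayley A * (x - fls_matrix A)) $ i $ j) n = fls_nth (mat_of (x +
        fls_matrix A) $ i $ j) n"
      unfolding r using cases[of n] entry(1)[of "nat n" i j]
      by (auto simp: right_diff_distrib x mat_of_simps matrix_matrix_mult_def fls_matrix_def
          map_matrix_def fls_nth_sum nth
          nat_add_distrib cayley_coeff_def sum_mat_one)
  qed
  show "(x - fls_matrix A) * cayley A = x + fls_matrix A"
  proof (unfold sqmat_eq_iff, intro allI fls_eqI)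
    fix i j n
    show "fls_nth (mat_of ((x - fls_matrix A) * cayley A) $ i $ j) n = fls_nth (mat_of (x +
        fls_matrix A) $ i $ j) n"
      unfolding r using cases[of n] entry(2)[of "nat n" i j]
      by (auto simp: left_diff_distrib x mat_of_simps matrix_matrix_mult_def fls_matrix_def
          map_matrix_def fls_nth_sum nth
          nat_add_distrib cayley_coeff_def sum_mat_one)
  qed
qed

section \<open>The Lie algebra of a bilinear form\<close>

text \<open>
  An ideal of the free algebra on \<open>X\<close> need not be an ideal of the ring of polynomials in all letters;
  its preimage under the retraction is one, and it has the same elements inside the smaller algebra.
\<close>

lemma ideal_extension:
  assumes "presentation X \<R>"
  shows "two_sided {p. retract X p \<in> relation_ideal X \<R>}"
proof -
  interpret presentation X \<R> by fact
  show ?thesis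
    using I_mult_left[OF _ retract_in_FA] I_mult_right[OF _ retract_in_FA]
    by (simp add: two_sided_def retract_def subst_add subst_mult I_0 I_add)
qed

interpretation cs: vector_space cscale by (rule vector_space_cscale)

lemma cscale_entry [simp]: "cscale c A $ i $ j = c * A $ i $ j"
  by (simp add: cscale_def)

lemma munit_entry: "(munit i j :: complex^'m^'m) $ a $ b = mat 1 $ a $ i * mat 1 $ b $ j"
  by (simp add: munit_def axis_def mat_def)

locale orthosymplectic =
  fixes G :: "complex^'n::finite^'n" and \<epsilon> :: complex
  assumes nonsing: "invertible G"
    and sign: "(\<epsilon> = 1 \<and> transpose G = G) \<or> (\<epsilon> = -1 \<and> transpose G = - G \<and> even CARD('n))"
begin

abbreviation "Gi \<equiv> matrix_inv G"

lemma G_Gi: "G ** Gi = mat 1" and Gi_G: "Gi ** G = mat 1"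
  using someI_ex[OF nonsing[unfolded invertible_def]] by (simp_all add: matrix_inv_def)

lemma G_Gi_sum: "(\<Sum>k\<in>UNIV. G $ i $ k * Gi $ k $ j) = mat 1 $ i $ j"
  and Gi_G_sum: "(\<Sum>k\<in>UNIV. Gi $ i $ k * G $ k $ j) = mat 1 $ i $ j"
  using G_Gi Gi_G by (simp_all add: matrix_matrix_mult_def vec_eq_iff)

lemma eps_eps: "\<epsilon> * \<epsilon> = 1" using sign by auto

lemma transpose_G: "transpose G = cscale \<epsilon> G"
  using sign by (auto simp: vec_eq_iff)

lemma G_sym: "G $ j $ i = \<epsilon> * G $ i $ j"
  using arg_cong[OF transpose_G, of "\<lambda>M. M $ i $ j"] by (simp add: transpose_def)

lemma sqmat_cscale: "sqmat (cscale c M) = mscale id c (sqmat M)"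
  by (simp add: mscale_def cscale_def)

interpretation ms: central_algebra "mscale (id :: complex \<Rightarrow> complex)"
  by (rule central_algebra_mscale) (auto simp: ring_morphism_def)

lemma transpose_Gi: "transpose Gi = cscale \<epsilon> Gi"
proof -
  let ?t = "sqmat (transpose Gi)"
  have "transpose Gi ** transpose G = mat 1"
    by (simp add: G_Gi flip: matrix_transpose_mul)
  then have "?t * sqmat (transpose G) = 1" by (simp flip: sqmat_hom)
  then have "mscale id \<epsilon> (?t * sqmat G) = 1"
    by (simp add: transpose_G sqmat_cscale ms.mult_scl_right)
  then have "mscale id \<epsilon> (?t * sqmat G) * sqmat Gi = sqmat Gi" by simp
  then have "mscale id \<epsilon> ?t = sqmat Gi"
    using sqmat_hom(1)[of G Gi] by (simp add: ms.mult_scl_left mult.assoc G_Gi sqmat_hom(4))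
  then have "mscale id \<epsilon> (mscale id \<epsilon> ?t) = mscale id \<epsilon> (sqmat Gi)" by simp
  then have "sqmat (transpose Gi) = sqmat (cscale \<epsilon> Gi)"
    by (simp only: ms.scale_scale eps_eps ms.scale_one sqmat_cscale)
  then show ?thesis by (metis mat_of_sqmat)
qed

lemma Gi_sym: "Gi $ j $ i = \<epsilon> * Gi $ i $ j"
  using arg_cong[OF transpose_Gi, of "\<lambda>M. M $ i $ j"] by (simp add: transpose_def)

text \<open>
  The transposition with respect to \<open>G\<close> that acts on the Lie algebra as \<open>-1\<close>.  On the matrix units
  it is the sum in the definition of \<open>F\<^sub>i\<^sub>j\<close>.
\<close>

definition \<theta> :: "complex^'n^'n \<Rightarrow> complex^'n^'n"
  where "\<theta> X = Gi ** transpose X ** G"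

lemma \<theta>_mult: "\<theta> (X ** Y) = \<theta> Y ** \<theta> X"
  unfolding \<theta>_def matrix_transpose_mul
  by (metis G_Gi matrix_mul_assoc matrix_mul_rid)

lemma \<theta>_entry: "\<theta> X $ i $ j = (\<Sum>k\<in>UNIV. \<Sum>l\<in>UNIV. Gi $ i $ l * X $ k $ l * G $ k $ j)"
  by (simp add: \<theta>_def matrix_matrix_mult_def transpose_def sum_distrib_right)

lemma \<theta>_linear: "\<theta> (X + Y) = \<theta> X + \<theta> Y" "\<theta> (X - Y) = \<theta> X - \<theta> Y" "\<theta> (cscale c X) = cscale c (\<theta> X)" "\<theta>
    0 = 0"
  by (simp_all add: vec_eq_iff \<theta>_entry algebra_simps sum.distrib sum_subtractf sum_distrib_left)

lemma \<theta>_\<theta>: "\<theta> (\<theta> X) = X"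
proof -
  have "sqmat Gi * sqmat G = 1" by (simp add: Gi_G flip: sqmat_hom)
  then have "sqmat (Gi ** (transpose G ** X ** transpose Gi) ** G) = sqmat X"
    by (simp add: transpose_G transpose_Gi sqmat_cscale sqmat_hom ms.mult_scl_left ms.mult_scl_right
        eps_eps mult.assoc) (simp add: mult.assoc[symmetric])
  then have "Gi ** (transpose G ** X ** transpose Gi) ** G = X" by (metis mat_of_sqmat)
  then show ?thesis by (simp add: \<theta>_def matrix_transpose_mul matrix_mul_assoc)
qed

lemma Fmat_entry: "Fmat G i j $ a $ b = mat 1 $ a $ i * mat 1 $ b $ j - Gi $ a $ j * G $ i $ b"
proof -
  have "(\<Sum>k\<in>UNIV. \<Sum>l\<in>UNIV. cscale (G $ i $ k * Gi $ l $ j) (munit l k)) $ a $ b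
    = (\<Sum>k\<in>UNIV. \<Sum>l\<in>UNIV. mat 1 $ a $ l * (G $ i $ k * Gi $ l $ j * mat 1 $ b $ k))"
    by (simp only: munit_entry mult_ac sum_component cscale_entry)
  also have "\<dots> = Gi $ a $ j * G $ i $ b"
    by (simp only: sum_mat_one) (simp add: mult.commute)
  finally show ?thesis
    unfolding Fmat_def by (simp only: vector_minus_component munit_entry)
qed

lemma Fmat_eq: "Fmat G i j = munit i j - \<theta> (munit i j)"
proof -
  have "\<theta> (munit i j) $ a $ b = Gi $ a $ j * G $ i $ b" for a b
  proof -
    have "\<theta> (munit i j) $ a $ b = (\<Sum>k\<in>UNIV. \<Sum>l\<in>UNIV. mat 1 $ l $ j * (mat 1 $ k $ i * (Gi $ a $ l *
        G $ k $ b)))"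
      by (simp only: \<theta>_entry munit_entry mult_ac)
    then show ?thesis by (simp only: sum_mat_one)
  qed
  then show ?thesis by (simp add: vec_eq_iff Fmat_entry munit_entry)
qed

lemma \<theta>_Fmat: "\<theta> (Fmat G i j) = - Fmat G i j"
  by (simp add: Fmat_eq \<theta>_linear \<theta>_\<theta>)

lemma expand_Fmat: "X - \<theta> X = (\<Sum>i\<in>UNIV. \<Sum>j\<in>UNIV. cscale (X $ i $ j) (Fmat G i j))"
proof -
  have "(\<Sum>i\<in>UNIV. \<Sum>j\<in>UNIV. X $ i $ j * (mat 1 $ a $ i * mat 1 $ b $ j)) = X $ a $ b" for a b
  proof -
    have "(\<Sum>i\<in>UNIV. \<Sum>j\<in>UNIV. X $ i $ j * (mat 1 $ a $ i * mat 1 $ b $ j)) =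
      (\<Sum>i\<in>UNIV. mat 1 $ a $ i * (\<Sum>j\<in>UNIV. mat 1 $ b $ j * X $ i $ j))"
      by (simp only: sum_distrib_left mult_ac)
    then show ?thesis by (simp only: sum_mat_one)
  qed
  then show ?thesis
    by (simp add: vec_eq_iff Fmat_entry \<theta>_entry right_diff_distrib sum_subtractf mult_ac)
qed

text \<open>
  Every \<open>X\<close> with \<open>\<theta>(X) = - X\<close> equals \<open>(X - \<theta>(X)) / 2\<close>, a combination of the \<open>F\<^sub>i\<^sub>j\<close>.
\<close>

lemma gN_iff: "X \<in> gN G \<longleftrightarrow> \<theta> X = - X"
proof
  assume "X \<in> gN G"
  then show "\<theta> X = - X"
    unfolding gN_def
    by (induction rule: cs.span_induct_alt) (auto simp: \<theta>_linear \<theta>_Fmat cs.scale_right_distrib)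
next
  assume "\<theta> X = - X"
  then have "X = cscale (1/2) (X - \<theta> X)" by (simp add: vec_eq_iff)
  then show "X \<in> gN G"
    unfolding gN_def expand_Fmat[of X]
    by (metis (mono_tags, lifting) cs.span_base cs.span_scale cs.span_sum mem_Collect_eq)
qed

lemma gN_Fmat [simp, intro]: "Fmat G i j \<in> gN G" by (simp add: gN_iff \<theta>_Fmat)
lemma gN_add [intro]: "X \<in> gN G \<Longrightarrow> Y \<in> gN G \<Longrightarrow> X + Y \<in> gN G"
  by (simp add: gN_iff \<theta>_linear)
lemma gN_cscale [intro]: "X \<in> gN G \<Longrightarrow> cscale c X \<in> gN G"
  by (simp add: gN_iff \<theta>_linear)
lemma gN_0 [intro, simp]: "0 \<in> gN G"
  by (simp add: gN_iff \<theta>_linear)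
lemma gN_bracket [intro]: "X \<in> gN G \<Longrightarrow> Y \<in> gN G \<Longrightarrow> X ** Y - Y ** X \<in> gN G"
proof -
  have "(- A) ** (- B) = A ** B" for A B :: "complex^'n^'n"
    by (simp add: matrix_matrix_mult_def vec_eq_iff)
  then show "X \<in> gN G \<Longrightarrow> Y \<in> gN G \<Longrightarrow> X ** Y - Y ** X \<in> gN G"
    by (simp add: gN_iff \<theta>_linear \<theta>_mult)
qed

lemma gN_sum [intro]: "(\<And>i. i \<in> S \<Longrightarrow> f i \<in> gN G) \<Longrightarrow> sum f S \<in> gN G"
  by (induction S rule: infinite_finite_induct) auto

lemma Fmat_product:
  "(Fmat G k l ** Fmat G i j) $ a $ b =
    mat 1 $ a $ k * mat 1 $ i $ l * mat 1 $ b $ j - mat 1 $ a $ k * Gi $ l $ j * G $ i $ b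
    - Gi $ a $ l * G $ k $ i * mat 1 $ b $ j + Gi $ a $ l * mat 1 $ k $ j * G $ i $ b"
proof -
  have "(Fmat G k l ** Fmat G i j) $ a $ b =
    (\<Sum>c\<in>UNIV. mat 1 $ c $ l * (mat 1 $ a $ k * mat 1 $ c $ i * mat 1 $ b $ j))
    - (\<Sum>c\<in>UNIV. mat 1 $ c $ l * (mat 1 $ a $ k * Gi $ c $ j * G $ i $ b))
    - (\<Sum>c\<in>UNIV. mat 1 $ c $ i * (Gi $ a $ l * G $ k $ c * mat 1 $ b $ j))
    + Gi $ a $ l * (\<Sum>c\<in>UNIV. G $ k $ c * Gi $ c $ j) * G $ i $ b"
    unfolding matrix_matrix_mult_def
    by (simp add: Fmat_entry algebra_simps sum.distrib sum_subtractf sum_distrib_left)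
  then show ?thesis
    by (simp only: sum_mat_one G_Gi_sum) (simp add: mat_def)
qed

text \<open>
  The right-hand side consists of the entries of \<open>[P - Q, F\<^sub>1]\<close>.
\<close>

lemma Fmat_bracket:
  "Fmat G k l ** Fmat G i j - Fmat G i j ** Fmat G k l =
    cscale (mat 1 $ i $ l) (Fmat G k j) - cscale (mat 1 $ k $ j) (Fmat G i l)
    - (\<Sum>m\<in>UNIV. cscale (G $ i $ k * Gi $ l $ m) (Fmat G m j))
    + (\<Sum>m\<in>UNIV. cscale (Gi $ l $ j * G $ m $ k) (Fmat G i m))" (is "?l = ?r")
proof -
  have "?l $ a $ b = ?r $ a $ b" for a b
  proof -
    have 1: "(\<Sum>m\<in>UNIV. G $ i $ k * Gi $ l $ m * Fmat G m j $ a $ b) =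
      G $ i $ k * Gi $ l $ a * mat 1 $ b $ j - G $ i $ k * Gi $ a $ j * mat 1 $ l $ b"
    proof -
      have "(\<Sum>m\<in>UNIV. G $ i $ k * Gi $ l $ m * Fmat G m j $ a $ b) =
        (\<Sum>m\<in>UNIV. mat 1 $ a $ m * (G $ i $ k * Gi $ l $ m * mat 1 $ b $ j))
        - G $ i $ k * Gi $ a $ j * (\<Sum>m\<in>UNIV. Gi $ l $ m * G $ m $ b)"
        by (simp add: Fmat_entry algebra_simps sum_subtractf sum_distrib_left)
      then show ?thesis by (simp only: sum_mat_one Gi_G_sum)
    qed
    have 2: "(\<Sum>m\<in>UNIV. Gi $ l $ j * G $ m $ k * Fmat G i m $ a $ b) =
      mat 1 $ a $ i * Gi $ l $ j * G $ b $ k - Gi $ l $ j * mat 1 $ a $ k * G $ i $ b"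
    proof -
      have "(\<Sum>m\<in>UNIV. Gi $ l $ j * G $ m $ k * Fmat G i m $ a $ b) =
        (\<Sum>m\<in>UNIV. mat 1 $ b $ m * (mat 1 $ a $ i * Gi $ l $ j * G $ m $ k))
        - Gi $ l $ j * (\<Sum>m\<in>UNIV. Gi $ a $ m * G $ m $ k) * G $ i $ b"
        by (simp add: Fmat_entry algebra_simps sum_subtractf sum_distrib_left)
      then show ?thesis by (simp only: sum_mat_one Gi_G_sum)
    qed
    have s: "Gi $ a $ l * G $ k $ i = G $ i $ k * Gi $ l $ a" for a l k i
    proof -
      have "Gi $ a $ l * G $ k $ i = (\<epsilon> * \<epsilon>) * (G $ i $ k * Gi $ l $ a)"
        by (subst G_sym, subst Gi_sym) (simp add: mult_ac)
      then show ?thesis by (simp add: eps_eps)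
    qed
    have t1: "Gi $ a $ l * G $ k $ i * mat 1 $ b $ j = G $ i $ k * Gi $ l $ a * mat 1 $ b $ j"
      by (simp only: s)
    have t2: "mat 1 $ a $ i * Gi $ j $ l * G $ k $ b = mat 1 $ a $ i * Gi $ l $ j * G $ b $ k"
      using s[of j l k b] by (simp only: mult.assoc mult.commute[of "G $ b $ k"])
    have t3: "(mat 1 :: complex^'n^'n) $ l $ b = mat 1 $ b $ l" by (simp add: mat_def)
    show ?thesis
      by (simp only: vector_minus_component vector_add_component sum_component cscale_entry
          Fmat_product t1 t2 1 2 t3) (simp add: Fmat_entry algebra_simps)
  qed
  then show ?thesis by (simp add: vec_eq_iff)
qed

lemma Fmat_trace: "(\<Sum>a\<in>UNIV. Fmat G i j $ a $ a) = 0"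
proof -
  have "(\<Sum>a\<in>UNIV. Fmat G i j $ a $ a) = (\<Sum>a\<in>UNIV. mat 1 $ a $ i * mat 1 $ a $ j) - (\<Sum>a\<in>UNIV. G $ i $
      a * Gi $ a $ j)"
    by (simp add: Fmat_entry sum_subtractf mult.commute)
  then show ?thesis by (simp only: sum_mat_one G_Gi_sum) simp
qed

sublocale U: presentation "gN G" "env_rels (gN G)"
  by standard (auto simp: env_rels_def intro!: FA_add FA_diff FA_mult FA_gen)

end

section \<open>A skew lift of the generator matrix\<close>

lemma ring_morphism_fls_const: "ring_morphism fls_const"
  by standard (simp_all add: fls_plus_const)

lemma ring_morphism_fls_matrix: "ring_morphism (fls_matrix :: ('a::ring_1, 'n::finite) sqmat \<Rightarrow> _)"
proof
  show "fls_matrix (x + y) = fls_matrix x + fls_matrix y" for x y :: "('a, 'n) sqmat"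
    by (simp add: fls_matrix_def sqmat_eq_iff mat_of_simps map_matrix_def fls_plus_const)
  show "fls_matrix (x * y) = fls_matrix x * fls_matrix y" for x y :: "('a, 'n) sqmat"
    by (simp add: fls_matrix_def mat_of_simps map_matrix_mult[OF ring_morphism_fls_const] flip:
        sqmat_hom)
  show "fls_matrix (1 :: ('a, 'n) sqmat) = 1"
    by (simp add: fls_matrix_def mat_of_simps map_matrix_one[OF ring_morphism_fls_const] sqmat_hom)
qed

lemma ring_morphism_power: "ring_morphism f \<Longrightarrow> f (x ^ n) = f x ^ n"
  by (induction n) (simp_all add: ring_morphism.one ring_morphism.mult)

lemma fls_matrix_cayley_coeff: "fls_matrix (cayley_coeff A r) = cayley_coeff (fls_matrix A) r"
  by (simp add: cayley_coeff_def ring_morphism.one ring_morphism.add ring_morphism_power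
      ring_morphism_fls_matrix)

definition leg1 :: "('a::ring_1, 'n::finite) sqmat \<Rightarrow> ('a, 'n \<times> 'n) sqmat"
  where "leg1 M = sqmat (kron (mat_of M) (mat 1))"
definition leg2 :: "('a::ring_1, 'n::finite) sqmat \<Rightarrow> ('a, 'n \<times> 'n) sqmat"
  where "leg2 M = sqmat (kron (mat 1) (mat_of M))"

lemma kron_one_one: "kron (mat 1) (mat 1) = (mat 1 :: 'a::ring_1^('n::finite \<times> 'n)^('n \<times> 'n))"
  by (auto simp: vec_eq_iff kron_entry mat_def)

lemma ring_morphism_leg1: "ring_morphism leg1" and ring_morphism_leg2: "ring_morphism leg2"
  by (unfold_locales; simp add: leg1_def leg2_def mat_of_simps kron_one_hom kron_one_one sqmat_hom)+

definition tr :: "('a, 'n::finite) sqmat \<Rightarrow> ('a, 'n) sqmat"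
  where "tr M = sqmat (transpose (mat_of M))"

lemma tr_entry [simp]: "mat_of (tr M) $ i $ j = mat_of M $ j $ i"
  by (simp add: tr_def transpose_def)

lemma tr_tr [simp]: "tr (tr M) = M" by (simp add: sqmat_eq_iff)

interpretation fs: central_algebra "mscale scal :: complex \<Rightarrow> ('x free_alg, 'n::finite) sqmat \<Rightarrow> _"
  by (rule central_algebra_mscale[OF ring_morphism_scal scal_commute])

definition smat :: "complex^'n^'n \<Rightarrow> ('x free_alg, 'n::finite) sqmat"
  where "smat M = sqmat (map_matrix scal M)"

lemma smat_entry [simp]: "mat_of (smat M) $ i $ j = scal (M $ i $ j)"
  by (simp add: smat_def map_matrix_def)

lemma tr_smat_mult: "tr (smat M * N) = tr N * tr (smat M)" "tr (N * smat M) = tr (smat M) * tr N"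
  by (simp_all add: sqmat_eq_iff mat_of_simps matrix_matrix_mult_def scal_commute)

lemma tr_scale: "tr (mscale h c M) = mscale h c (tr M)" "tr (M - N) = tr M - tr N"
  by (simp_all add: sqmat_eq_iff mat_of_simps)

context orthosymplectic
begin

lemma smat_G: "smat G * smat Gi = 1" "smat Gi * smat G = 1"
  by (simp_all add: smat_def G_Gi Gi_G map_matrix_one ring_morphism_scal
      flip: sqmat_hom map_matrix_mult[OF ring_morphism_scal])

lemma tr_smat_G: "tr (smat G) = mscale scal \<epsilon> (smat G)" "tr (smat Gi) = mscale scal \<epsilon> (smat Gi)"
  by (simp_all add: sqmat_eq_iff scal_mult[symmetric] G_sym[symmetric] Gi_sym[symmetric])

definition genF :: "((complex^'n^'n) free_alg, 'n) sqmat"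
  where "genF = sqmat (\<chi> i j. gen (Fmat G i j))"

text \<open>
  In the enveloping algebra this matrix and the matrix of generators agree, since the latter is skew
  there.  The lift is skew in the free algebra already.
\<close>

definition Flift :: "((complex^'n^'n) free_alg, 'n) sqmat"
  where "Flift = mscale scal (1/2) (genF - smat G * tr genF * smat Gi)"

lemma Flift_antisym: "smat G * tr Flift * smat Gi = - Flift"
proof -
  have "tr (smat G * tr genF * smat Gi) = tr (smat Gi) * (genF * tr (smat G))"
    by (simp add: tr_smat_mult)
  also have "\<dots> = smat Gi * genF * smat G"
    by (simp add: tr_smat_G fs.mult_scl_left fs.mult_scl_right eps_eps mult.assoc)
  finally have t: "tr (smat G * tr genF * smat Gi) = smat Gi * genF * smat G" .
  have "smat G * (smat Gi * genF * smat G) * smat Gi = (smat G * smat Gi) * genF * (smat G * smat Gi)"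
    by (simp only: mult.assoc)
  then have "smat G * (smat Gi * genF * smat G) * smat Gi = genF" by (simp add: smat_G)
  then show ?thesis
    by (simp add: Flift_def tr_scale t fs.mult_scl_left fs.mult_scl_right left_diff_distrib
        right_diff_distrib
      flip: fs.scale_minus_right)
qed

lemma Flift_G: "smat G * tr Flift = - (Flift * smat G)" "tr Flift * smat Gi = - (smat Gi * Flift)"
proof -
  have "smat G * tr Flift * smat Gi * smat G = - Flift * smat G" by (simp only: Flift_antisym)
  then show "smat G * tr Flift = - (Flift * smat G)" by (simp add: mult.assoc smat_G)
  have "smat Gi * (smat G * tr Flift * smat Gi) = smat Gi * - Flift" by (simp only: Flift_antisym)
  then show "tr Flift * smat Gi = - (smat Gi * Flift)"
    by (simp add: smat_G mult.assoc[symmetric])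
qed

lemma Flift_G_sum:
  "(\<Sum>m\<in>UNIV. mat_of Flift $ i $ m * scal (G $ m $ k)) + (\<Sum>m\<in>UNIV. mat_of Flift $ k $ m * scal (G $ i
      $ m)) = 0"
  "(\<Sum>m\<in>UNIV. scal (Gi $ l $ m) * mat_of Flift $ m $ j) + (\<Sum>m\<in>UNIV. scal (Gi $ m $ j) * mat_of Flift
      $ m $ l) = 0"
  using arg_cong[OF Flift_G(1), of "\<lambda>M. mat_of M $ i $ k"] arg_cong[OF Flift_G(2), of "\<lambda>M. mat_of M
      $ l $ j"]
  by (simp_all add: mat_of_simps matrix_matrix_mult_def scal_commute[of _ "mat_of Flift $ _ $ _"])

lemma env_relators:
  "x \<in> gN G \<Longrightarrow> y \<in> gN G \<Longrightarrow> gen (x + y) - gen x - gen y \<in> U.I"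
  "x \<in> gN G \<Longrightarrow> gen (cscale c x) - scal c * gen x \<in> U.I"
  "x \<in> gN G \<Longrightarrow> y \<in> gN G \<Longrightarrow> gen x * gen y - gen y * gen x - gen (x ** y - y ** x) \<in> U.I"
  by (rule U.I_relator; unfold env_rels_def; blast)+

lemma gen_0: "gen 0 \<in> U.I"
  using env_relators(2)[of 0 0] by simp

lemma gen_sum:
  assumes "finite S" "\<And>i. i \<in> S \<Longrightarrow> x i \<in> gN G"
  shows "gen (\<Sum>i\<in>S. cscale (c i) (x i)) - (\<Sum>i\<in>S. scal (c i) * gen (x i)) \<in> U.I"
  using assms
proof (induction S rule: finite_induct)
  case empty
  show ?case by (simp add: gen_0)
next
  case (insert i S)
  let ?s = "\<Sum>i\<in>S. cscale (c i) (x i)"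
  have "gen (cscale (c i) (x i) + ?s) - gen (cscale (c i) (x i)) - gen ?s \<in> U.I"
    by (rule env_relators) (use insert in auto)
  from U.I_add[OF U.I_add[OF this env_relators(2)[of "x i" "c i"]] insert.IH]
  have "(gen (cscale (c i) (x i) + ?s) - gen (cscale (c i) (x i)) - gen ?s)
    + (gen (cscale (c i) (x i)) - scal (c i) * gen (x i)) + (gen ?s - (\<Sum>i\<in>S. scal (c i) * gen (x
        i))) \<in> U.I"
    using insert.prems by blast
  then have "gen (cscale (c i) (x i) + ?s) - (scal (c i) * gen (x i) + (\<Sum>i\<in>S. scal (c i) * gen (x
      i))) \<in> U.I"
    by (simp add: diff_diff_eq2 diff_add_eq diff_diff_add add.commute)
  then show ?case using insert.hyps by simp
qed

lemma Fmat_relation: "(\<Sum>k\<in>UNIV. \<Sum>l\<in>UNIV. cscale (G $ i $ l * Gi $ k $ j) (Fmat G k l)) = - Fmat G i j"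
proof -
  have "\<theta> (munit i j) = munit i j - Fmat G i j" by (simp add: Fmat_eq)
  then have e: "\<theta> (munit i j) $ k $ l = G $ i $ l * Gi $ k $ j" for k l
    by (simp only: vector_minus_component) (simp add: Fmat_entry munit_entry mult.commute)
  have "\<theta> (munit i j) - \<theta> (\<theta> (munit i j)) = - Fmat G i j" by (simp add: \<theta>_\<theta> Fmat_eq)
  then show ?thesis unfolding expand_Fmat[of "\<theta> (munit i j)"] e .
qed

text \<open>
  By \<open>Fmat_relation\<close>, the matrix of generators is skew modulo the linear relations.
\<close>

lemma Flift_gen: "mat_of Flift $ i $ j - gen (Fmat G i j) \<in> U.I"
proof -
  let ?s = "\<Sum>p\<in>UNIV. scal (G $ i $ snd p * Gi $ fst p $ j) * gen (Fmat G (fst p) (snd p))"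
  have "gen (\<Sum>p\<in>UNIV. cscale (G $ i $ snd p * Gi $ fst p $ j) (Fmat G (fst p) (snd p))) - ?s \<in> U.I"
    by (rule gen_sum) auto
  then have "gen (cscale (- 1) (Fmat G i j)) - ?s \<in> U.I"
    using Fmat_relation[of i j] by (simp add: sum_pair cs.scale_minus_left)
  from U.I_diff[OF this env_relators(2)[of "Fmat G i j" "- 1"]]
  have "- gen (Fmat G i j) - ?s \<in> U.I" by (simp add: scal_minus minus_diff_commute)
  then have "scal (1/2) * (- gen (Fmat G i j) - ?s) \<in> U.I" by (rule U.I_mult_left) auto
  moreover have mat: "mat_of (smat G * tr genF * smat Gi) $ i $ j = ?s"
    by (simp add: sum_pair mat_of_simps matrix_matrix_mult_def genF_def scal_mult sum_distrib_left
        sum_distrib_right mult.assoc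
        scal_commute[of _ "gen _"]) (rule sum.swap)
  then have "mat_of Flift $ i $ j = scal (1/2) * (gen (Fmat G i j) - ?s)"
    by (simp add: Flift_def mat_of_simps genF_def)
  moreover have "scal (1/2) * gen (Fmat G i j) + scal (1/2) * gen (Fmat G i j) = gen (Fmat G i j)"
  proof -
    have "scal (1/2) + scal (1/2) = (1 :: (complex^'n^'n) free_alg)" by (simp flip: scal_add)
    then show ?thesis by (simp flip: distrib_right)
  qed
  then have "scal (1/2) * (gen (Fmat G i j) - ?s) - gen (Fmat G i j) = scal (1/2) * (- gen (Fmat G i
      j) - ?s)"
    by (simp only: right_diff_distrib) (simp add: algebra_simps)
  ultimately show ?thesis by simp
qed

lemma Flift_FA: "mat_of Flift $ i $ j \<in> FA (gN G)"
  using FA_add[OF U.I_FA[OF Flift_gen[of i j]] FA_gen[of "Fmat G i j" "gN G"]] by simp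

end

context orthosymplectic
begin

definition Ashift :: "((complex^'n^'n) free_alg, 'n) sqmat"
  where "Ashift = Flift - mscale scal (of_nat CARD('n) / 4) 1"

text \<open>
  Modulo the relations the lift may be replaced by the generators, for which the enveloping relations
  reduce the claim to \<open>Fmat_bracket\<close>.
\<close>

lemma Flift_bracket:
  "mat_of Flift $ k $ l * mat_of Flift $ i $ j - mat_of Flift $ i $ j * mat_of Flift $ k $ l
    - (scal (mat 1 $ i $ l) * mat_of Flift $ k $ j - scal (mat 1 $ k $ j) * mat_of Flift $ i $ l
    - (\<Sum>m\<in>UNIV. scal (G $ i $ k * Gi $ l $ m) * mat_of Flift $ m $ j)
    + (\<Sum>m\<in>UNIV. scal (Gi $ l $ j * G $ m $ k) * mat_of Flift $ i $ m)) \<in> U.I"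
proof -
  let ?f = "\<lambda>i j. mat_of Flift $ i $ j" and ?g = "\<lambda>i j. gen (Fmat G i j)"
  define eq where "eq p q \<longleftrightarrow> p \<in> FA (gN G) \<and> q \<in> FA (gN G) \<and> p - q \<in> U.I" for p q
  have gF: "?g i j \<in> FA (gN G)" for i j by (rule FA_gen) simp
  have lift: "eq (?f i j) (?g i j)" for i j
    by (simp add: eq_def Flift_gen Flift_FA gF)
  have add: "eq p q \<Longrightarrow> eq p' q' \<Longrightarrow> eq (p + p') (q + q')" for p q p' q'
    using U.I_add[of "p - q" "p' - q'"] by (auto simp: eq_def algebra_simps)
  have diff: "eq p q \<Longrightarrow> eq p' q' \<Longrightarrow> eq (p - p') (q - q')" for p q p' q'
    using U.I_diff[of "p - q" "p' - q'"] by (auto simp: eq_def algebra_simps)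
  have mult: "eq p q \<Longrightarrow> eq p' q' \<Longrightarrow> eq (p * p') (q * q')" for p q p' q'
    using U.I_add[OF U.I_mult_right[of "p - q" p'] U.I_mult_left[of "p' - q'" q]]
    by (auto simp: eq_def algebra_simps)
  have scale: "eq p q \<Longrightarrow> eq (scal c * p) (scal c * q)" for p q c
    by (rule mult) (auto simp: eq_def U.I_0)
  have sum: "(\<And>m. eq (u m) (w m)) \<Longrightarrow> eq (\<Sum>m\<in>S. u m) (\<Sum>m\<in>S. w m)" for u w :: "'n \<Rightarrow> _" and S
    using U.I_sum[of S "\<lambda>m. u m - w m"] by (auto simp: eq_def sum_subtractf)
  have trans: "eq p q \<Longrightarrow> eq q r \<Longrightarrow> eq p r" for p q r
    using U.I_add[of "p - q" "q - r"] by (auto simp: eq_def)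
  have sym: "eq p q \<Longrightarrow> eq q p" for p q
    using U.I_minus[of "p - q"] by (auto simp: eq_def)
  have gen_add: "x \<in> gN G \<Longrightarrow> y \<in> gN G \<Longrightarrow> eq (gen (x + y)) (gen x + gen y)" for x y
    using env_relators(1)[of x y] by (auto simp: eq_def algebra_simps)
  have gen_scale: "x \<in> gN G \<Longrightarrow> eq (gen (cscale c x)) (scal c * gen x)" for x c
    using env_relators(2)[of x c] by (auto simp: eq_def)
  have gen_diff: "x \<in> gN G \<Longrightarrow> y \<in> gN G \<Longrightarrow> eq (gen (x - y)) (gen x - gen y)" for x y
  proof -
    assume xy: "x \<in> gN G" "y \<in> gN G"
    have "eq (gen (x + cscale (- 1) y)) (gen x + scal (- 1) * gen y)"
    proof (rule trans[OF gen_add[OF xy(1) gN_cscale[OF xy(2)]] add[OF _ gen_scale[OF xy(2)]]])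
      show "eq (gen x) (gen x)" using xy by (auto simp: eq_def U.I_0)
    qed
    then show ?thesis by (simp add: cs.scale_minus_left scal_minus)
  qed
  have gen_sum': "(\<And>m. x m \<in> gN G) \<Longrightarrow> eq (gen (\<Sum>m\<in>UNIV. cscale (c m) (x m))) (\<Sum>m\<in>UNIV. scal (c m) *
      gen (x m))"
    for c and x :: "'n \<Rightarrow> _"
    using gen_sum[of UNIV x c] by (auto simp: eq_def intro!: FA_gen FA_sum)
  have "eq (?f k l * ?f i j - ?f i j * ?f k l) (?g k l * ?g i j - ?g i j * ?g k l)"
    by (intro diff mult lift)
  moreover have "eq (?g k l * ?g i j - ?g i j * ?g k l)
      (gen (Fmat G k l ** Fmat G i j - Fmat G i j ** Fmat G k l))"
    using env_relators(3)[of "Fmat G k l" "Fmat G i j"] gF by (auto simp: eq_def intro!: FA_gen)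
  moreover have "eq (gen (Fmat G k l ** Fmat G i j - Fmat G i j ** Fmat G k l))
      (scal (mat 1 $ i $ l) * ?g k j - scal (mat 1 $ k $ j) * ?g i l
    - (\<Sum>m\<in>UNIV. scal (G $ i $ k * Gi $ l $ m) * ?g m j)
    + (\<Sum>m\<in>UNIV. scal (Gi $ l $ j * G $ m $ k) * ?g i m))"
  proof -
    have gN_diff: "x \<in> gN G \<Longrightarrow> y \<in> gN G \<Longrightarrow> x - y \<in> gN G" for x y
      using gN_add[of x "cscale (- 1) y"] gN_cscale[of y "- 1"] by (simp add: cs.scale_minus_left)
    show ?thesis
      unfolding Fmat_bracket
      by (rule trans[OF gen_add add] trans[OF gen_diff diff] gen_scale gen_sum' gN_diff gN_cscale
          gN_sum gN_Fmat)+
  qed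
  moreover have "eq (scal (mat 1 $ i $ l) * ?f k j - scal (mat 1 $ k $ j) * ?f i l
    - (\<Sum>m\<in>UNIV. scal (G $ i $ k * Gi $ l $ m) * ?f m j)
    + (\<Sum>m\<in>UNIV. scal (Gi $ l $ j * G $ m $ k) * ?f i m))
    (scal (mat 1 $ i $ l) * ?g k j - scal (mat 1 $ k $ j) * ?g i l
    - (\<Sum>m\<in>UNIV. scal (G $ i $ k * Gi $ l $ m) * ?g m j)
    + (\<Sum>m\<in>UNIV. scal (Gi $ l $ j * G $ m $ k) * ?g i m))"
    by (intro add diff scale sum lift)
  ultimately show ?thesis using trans sym unfolding eq_def by meson
qed

end

section \<open>The operators P and Q\<close>

lemma Pmat_entry: "Pmat $ (i, k) $ (j, l) = mat 1 $ i $ l * mat 1 $ k $ j"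
proof -
  have "Pmat $ (i, k) $ (j, l) = (\<Sum>a\<in>UNIV. mat 1 $ i $ a * (\<Sum>b\<in>UNIV. mat 1 $ j $ b * (mat 1 $ k $ b
      * mat 1 $ l $ a)))"
    by (simp only: Pmat_def sum_component kron_entry munit_entry sum_distrib_left mult_ac)
  then show ?thesis by (simp only: sum_mat_one) (simp add: mat_def)
qed

lemma Ptmat_entry: "Ptmat $ (i, k) $ (j, l) = mat 1 $ i $ k * mat 1 $ j $ l"
proof -
  have "Ptmat $ (i, k) $ (j, l) = (\<Sum>a\<in>UNIV. mat 1 $ i $ a * (\<Sum>b\<in>UNIV. mat 1 $ j $ b * (mat 1 $ k $ a
      * mat 1 $ l $ b)))"
    by (simp only: Ptmat_def sum_component kron_entry munit_entry sum_distrib_left mult_ac)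
  then show ?thesis by (simp only: sum_mat_one) (simp add: mat_def)
qed

lemma Qmat_entry: "Qmat G $ (i, k) $ (j, l) = G $ i $ k * matrix_inv G $ l $ j"
proof -
  have "Qmat G $ (i, k) $ (j, l) =
    (\<Sum>m\<in>UNIV. (\<Sum>n\<in>UNIV. G $ i $ n * (mat 1 $ n $ k * mat 1 $ m $ l)) * matrix_inv G $ m $ j)"
    by (simp only: Qmat_def kron_product_entry Ptmat_entry)
  also have "\<dots> = (\<Sum>m\<in>UNIV. mat 1 $ m $ l * (matrix_inv G $ m $ j * (\<Sum>n\<in>UNIV. mat 1 $ n $ k * G $ i $
      n)))"
    by (simp only: sum_distrib_left sum_distrib_right mult_ac)
  finally show ?thesis by (simp only: sum_mat_one) (simp add: mult.commute)
qed

definition Pop :: "('x free_alg, 'n::finite \<times> 'n) sqmat"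
  where "Pop = sqmat (map_matrix scal Pmat)"
definition Qop :: "complex^'n^'n \<Rightarrow> ('x free_alg, 'n::finite \<times> 'n) sqmat"
  where "Qop G = sqmat (map_matrix scal (Qmat G))"

lemma scal_mat_one: "scal (mat 1 $ i $ j) = mat 1 $ i $ j" by (simp add: mat_def)

lemma Pop_entry: "mat_of Pop $ (i, k) $ (j, l) = mat 1 $ i $ l * mat 1 $ k $ j"
  by (simp add: Pop_def map_matrix_def Pmat_entry scal_mult scal_mat_one)
lemma Qop_entry: "mat_of (Qop G) $ (i, k) $ (j, l) = scal (G $ i $ k) * scal (matrix_inv G $ l $ j)"
  by (simp add: Qop_def map_matrix_def Qmat_entry scal_mult)

lemma Pop_mult: "mat_of (Pop * Z) $ (i, k) $ q = mat_of Z $ (k, i) $ q"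
  "mat_of (Z * Pop) $ p $ (j, l) = mat_of Z $ p $ (l, j)"
proof -
  have "mat_of (Pop * Z) $ (i, k) $ q = (\<Sum>a\<in>UNIV. \<Sum>b\<in>UNIV. mat 1 $ i $ b * (mat 1 $ k $ a * mat_of Z
      $ (a, b) $ q))"
    by (simp only: mat_of_simps matrix_matrix_mult_def vec_lambda_beta sum_pair Pop_entry mult.assoc)
  then show "mat_of (Pop * Z) $ (i, k) $ q = mat_of Z $ (k, i) $ q" by (simp only: sum_mat_one)
  have "mat_of (Z * Pop) $ p $ (j, l) = (\<Sum>a\<in>UNIV. \<Sum>b\<in>UNIV. mat_of Z $ p $ (a, b) * mat 1 $ a $ l *
      mat 1 $ b $ j)"
    by (simp only: mat_of_simps matrix_matrix_mult_def vec_lambda_beta sum_pair Pop_entry mult.assoc)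
  then show "mat_of (Z * Pop) $ p $ (j, l) = mat_of Z $ p $ (l, j)" by (simp only: sum_mat_one)
qed

lemma sqmat_pair_eqI:
  fixes A B :: "('a, 'm::finite \<times> 'n::finite) sqmat"
  shows "(\<And>i k j l. mat_of A $ (i, k) $ (j, l) = mat_of B $ (i, k) $ (j, l)) \<Longrightarrow> A = B"
  by (simp add: sqmat_eq_iff)

lemma leg_entry: "mat_of (leg1 M) $ (i, k) $ (j, l) = mat_of M $ i $ j * mat 1 $ k $ l"
  "mat_of (leg2 M) $ (i, k) $ (j, l) = mat 1 $ i $ j * mat_of M $ k $ l"
  by (simp_all add: leg1_def leg2_def kron_entry)

lemma leg_mult_entry:
  "mat_of (leg1 M * Z) $ (i, k) $ q = (\<Sum>m\<in>UNIV. mat_of M $ i $ m * mat_of Z $ (m, k) $ q)"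
  "mat_of (leg2 M * Z) $ (i, k) $ q = (\<Sum>m\<in>UNIV. mat_of M $ k $ m * mat_of Z $ (i, m) $ q)"
  "mat_of (Z * leg1 M) $ p $ (j, l) = (\<Sum>m\<in>UNIV. mat_of Z $ p $ (m, l) * mat_of M $ m $ j)"
  "mat_of (Z * leg2 M) $ p $ (j, l) = (\<Sum>m\<in>UNIV. mat_of Z $ p $ (j, m) * mat_of M $ m $ l)"
  by (simp_all add: mat_of_simps leg1_def leg2_def kron_product_entry)

lemma Pop_relations: "Pop * Pop = 1" "Pop * leg1 M = leg2 M * Pop" "Pop * leg2 M = leg1 M * Pop"
proof -
  show "Pop * Pop = (1 :: ('a free_alg, 'b::finite \<times> 'b) sqmat)"
    by (rule sqmat_pair_eqI) (simp only: Pop_mult Pop_entry one_sqmat.rep_eq, simp add: mat_def)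
qed (rule sqmat_pair_eqI, simp only: Pop_mult leg_entry mat_one_commute)+

context orthosymplectic
begin

text \<open>
  The sign comes from \<open>G\<^sup>t = \<epsilon> G\<close>, and the factor \<open>N\<close> is the trace of \<open>G\<inverse> G\<close>.
\<close>

lemma Qop_relations: "Pop * Qop G = mscale scal \<epsilon> (Qop G)" "Qop G * Pop = mscale scal \<epsilon> (Qop G)"
  "Qop G * Qop G = mscale scal (of_nat CARD('n)) (Qop G)"
proof -
  show "Pop * Qop G = mscale scal \<epsilon> (Qop G)"
    by (rule sqmat_pair_eqI) (simp add: Pop_mult Qop_entry mult.assoc[symmetric]
        scal_mult[symmetric] G_sym[symmetric])
  show "Qop G * Pop = mscale scal \<epsilon> (Qop G)"
  proof (rule sqmat_pair_eqI)
    fix i k j l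
    have "G $ i $ k * Gi $ j $ l = \<epsilon> * (G $ i $ k * Gi $ l $ j)"
      by (subst Gi_sym) (simp add: mult_ac)
    then show "mat_of (Qop G * Pop) $ (i, k) $ (j, l) = mat_of (mscale scal \<epsilon> (Qop G)) $ (i, k) $
        (j, l)"
      by (simp only: mscale_entry Pop_mult Qop_entry scal_mult[symmetric])
  qed
  show "Qop G * Qop G = mscale scal (of_nat CARD('n)) (Qop G)"
  proof (rule sqmat_pair_eqI)
    fix i k j l
    have "(\<Sum>a\<in>UNIV. \<Sum>b\<in>UNIV. G $ i $ k * Gi $ b $ a * (G $ a $ b * Gi $ l $ j)) =
      G $ i $ k * Gi $ l $ j * (\<Sum>b\<in>UNIV. \<Sum>a\<in>UNIV. Gi $ b $ a * G $ a $ b)"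
      by (subst sum.swap) (simp only: sum_distrib_left mult_ac)
    also have "(\<Sum>b\<in>UNIV. \<Sum>a\<in>UNIV. Gi $ b $ a * G $ a $ b) = of_nat CARD('n)"
      by (simp add: Gi_G_sum mat_def)
    finally show "mat_of (Qop G * Qop G) $ (i, k) $ (j, l) = mat_of (mscale scal (of_nat CARD('n))
        (Qop G)) $ (i, k) $ (j, l)"
      by (simp add: mat_of_simps matrix_matrix_mult_def sum_pair Qop_entry scal_mult[symmetric]
          scal_sum[symmetric] mult_ac)
  qed
qed

lemma leg_Flift_Qop:
  "leg2 Flift * Qop G = - (leg1 Flift * Qop G)" "Qop G * leg2 Flift = - (Qop G * leg1 Flift)"
proof -
  have "leg2 Flift * Qop G + leg1 Flift * Qop G = 0"
  proof (rule sqmat_pair_eqI)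
    fix i k j l
    have "mat_of (leg2 Flift * Qop G + leg1 Flift * Qop G) $ (i, k) $ (j, l) =
      ((\<Sum>m\<in>UNIV. mat_of Flift $ i $ m * scal (G $ m $ k)) + (\<Sum>m\<in>UNIV. mat_of Flift $ k $ m * scal (G
          $ i $ m))) * scal (Gi $ l $ j)"
      by (simp add: mat_of_simps(2) leg_mult_entry Qop_entry distrib_right sum_distrib_right
          mult.assoc add.commute)
    then show "mat_of (leg2 Flift * Qop G + leg1 Flift * Qop G) $ (i, k) $ (j, l) = mat_of 0 $ (i,
        k) $ (j, l)"
      unfolding Flift_G_sum by (simp add: mat_of_simps)
  qed
  then show "leg2 Flift * Qop G = - (leg1 Flift * Qop G)" by (simp add: eq_neg_iff_add_eq_0)
  have "Qop G * leg1 Flift + Qop G * leg2 Flift = 0"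
  proof (rule sqmat_pair_eqI)
    fix i k j l
    have "mat_of (Qop G * leg1 Flift + Qop G * leg2 Flift) $ (i, k) $ (j, l) =
      scal (G $ i $ k) * ((\<Sum>m\<in>UNIV. scal (Gi $ l $ m) * mat_of Flift $ m $ j) + (\<Sum>m\<in>UNIV. scal (Gi $
          m $ j) * mat_of Flift $ m $ l))"
      by (simp add: mat_of_simps(2) leg_mult_entry Qop_entry distrib_left sum_distrib_left mult.assoc)
    then show "mat_of (Qop G * leg1 Flift + Qop G * leg2 Flift) $ (i, k) $ (j, l) = mat_of 0 $ (i,
        k) $ (j, l)"
      unfolding Flift_G_sum by (simp add: mat_of_simps)
  qed
  then show "Qop G * leg2 Flift = - (Qop G * leg1 Flift)" by (simp add: eq_neg_iff_add_eq_0 add.commute)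
qed

lemma leg_scale: "leg1 (mscale scal c 1) = mscale scal c 1" "leg2 (mscale scal c 1) = mscale scal c 1"
  by (auto intro!: sqmat_pair_eqI simp: leg_entry mat_of_simps) (auto simp: mat_def)

lemma leg_Ashift: "leg1 Ashift = leg1 Flift - mscale scal (of_nat CARD('n) / 4) 1" "leg2 Ashift =
    leg2 Flift - mscale scal (of_nat CARD('n) / 4) 1"
  by (simp_all add: Ashift_def ring_morphism.diff ring_morphism_leg1 ring_morphism_leg2 leg_scale)

lemma leg_Ashift_Qop:
  "leg2 Ashift * Qop G = - (leg1 Ashift * Qop G) - mscale scal (of_nat CARD('n) / 2) (Qop G)"
  "Qop G * leg2 Ashift = - (Qop G * leg1 Ashift) - mscale scal (of_nat CARD('n) / 2) (Qop G)"
proof -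
  have "mscale scal (of_nat CARD('n) / 2) (Qop G :: ((complex^'n^'n) free_alg, _) sqmat) = mscale
      scal (of_nat CARD('n) / 4) (Qop G) + mscale scal (of_nat CARD('n) / 4) (Qop G)"
    by (simp flip: fs.scale_left_distrib)
  then show "leg2 Ashift * Qop G = - (leg1 Ashift * Qop G) - mscale scal (of_nat CARD('n) / 2) (Qop G)"
  "Qop G * leg2 Ashift = - (Qop G * leg1 Ashift) - mscale scal (of_nat CARD('n) / 2) (Qop G)"
    by (simp_all add: leg_Ashift left_diff_distrib right_diff_distrib leg_Flift_Qop fs.mult_scl_left
        fs.mult_scl_right)
qed

text \<open>
  The entries of \<open>[B, A\<^sub>1]\<close> are the bracket relations of the lift; the shift by \<open>N/4\<close> is central and
  drops out.
\<close>

lemma commutator_entry: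
  "mat_of ((leg2 Ashift - Pop + Qop G) * leg1 Ashift - leg1 Ashift * (leg2 Ashift - Pop + Qop G)) $
      p $ q \<in> U.I"
proof (cases p, cases q)
  fix i k j l assume pq: "p = (i, k)" "q = (j, l)"
  let ?B = "leg2 Flift - Pop + Qop G" and ?f = "\<lambda>i j. mat_of Flift $ i $ j"
  have "(leg2 Ashift - Pop + Qop G) * leg1 Ashift - leg1 Ashift * (leg2 Ashift - Pop + Qop G)
     = ?B * leg1 Flift - leg1 Flift * ?B"
    by (simp add: leg_Ashift algebra_simps fs.mult_scl_left fs.mult_scl_right)
  moreover have "mat_of (?B * leg1 Flift - leg1 Flift * ?B) $ (i, k) $ (j, l) = ?f k l * ?f i j - ?f
      i j * ?f k l
    - (scal (mat 1 $ i $ l) * ?f k j - scal (mat 1 $ k $ j) * ?f i l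
    - (\<Sum>m\<in>UNIV. scal (G $ i $ k * Gi $ l $ m) * ?f m j)
    + (\<Sum>m\<in>UNIV. scal (Gi $ l $ j * G $ m $ k) * ?f i m))"
  proof -
    have 1: "mat_of (leg2 Flift * leg1 Flift) $ (i, k) $ (j, l) = ?f k l * ?f i j"
      by (simp only: leg_mult_entry(2) leg_entry mult.assoc[symmetric] sum_mat_one)
    have 2: "mat_of (leg1 Flift * leg2 Flift) $ (i, k) $ (j, l) = ?f i j * ?f k l"
      by (simp only: leg_mult_entry(1) leg_entry mat_one_left_commute sum_mat_one)
    have 3: "mat_of (Pop * leg1 Flift) $ (i, k) $ (j, l) = scal (mat 1 $ i $ l) * ?f k j"
      "mat_of (leg1 Flift * Pop) $ (i, k) $ (j, l) = scal (mat 1 $ k $ j) * ?f i l"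
      by (simp_all add: Pop_mult leg_entry scal_mat_one mat_one_commute)
    have 4: "mat_of (Qop G * leg1 Flift) $ (i, k) $ (j, l) = (\<Sum>m\<in>UNIV. scal (G $ i $ k * Gi $ l $ m)
        * ?f m j)"
      by (simp add: leg_mult_entry Qop_entry scal_mult)
    have 5: "mat_of (leg1 Flift * Qop G) $ (i, k) $ (j, l) = (\<Sum>m\<in>UNIV. scal (Gi $ l $ j * G $ m $ k)
        * ?f i m)"
      by (simp add: leg_mult_entry Qop_entry scal_commute[of _ "?f _ _"] mult.commute[of "Gi $ l $
          j"] flip: scal_mult)
    show ?thesis
      unfolding right_diff_distrib left_diff_distrib distrib_left distrib_right mat_of_simps(2,3)
        vector_add_component vector_minus_component 1 2 3 4 5
      by (simp add: algebra_simps)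
  qed
  ultimately show ?thesis using Flift_bracket[of k l i j] by (simp add: pq)
qed

end

section \<open>The images of the relators of the reflection algebra\<close>

lemma leg_fls_matrix: "leg1 (fls_matrix M) = fls_matrix (leg1 M)" "leg2 (fls_matrix M) = fls_matrix
    (leg2 M)"
  by (simp_all add: leg1_def leg2_def fls_matrix_def map_matrix_kron[OF ring_morphism_fls_const]
      map_matrix_one[OF ring_morphism_fls_const])

definition emb2 :: "('a::ring_1, 'n::finite) sqmat \<Rightarrow> ('a fls fls, 'n) sqmat"
  where "emb2 M = fls_matrix (fls_matrix M)"

lemma ring_morphism_emb2: "ring_morphism emb2"
  by standard (simp_all add: emb2_def ring_morphism.add ring_morphism.mult ring_morphism.one
      ring_morphism_fls_matrix)

lemma emb2_entry: "mat_of (emb2 M) $ i $ j = const2 (mat_of M $ i $ j)"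
  by (simp add: emb2_def fls_matrix_def map_matrix_def)

definition scal2 :: "complex fls fls \<Rightarrow> 'x free_alg fls fls"
  where "scal2 = fls_map (fls_map scal)"

lemma ring_morphism_scal2: "ring_morphism scal2"
  unfolding scal2_def by (intro ring_morphism_fls_map ring_morphism_scal)

lemma scal2_commute: "scal2 a * x = x * scal2 a"
  unfolding scal2_def by (intro fls_map_central ring_morphism_fls_map ring_morphism_scal scal_commute)

interpretation s2: central_algebra "mscale scal2 :: complex fls fls \<Rightarrow> ('x free_alg fls fls,
    'n::finite) sqmat \<Rightarrow> _"
  by (rule central_algebra_mscale[OF ring_morphism_scal2 scal2_commute])

lemma scal2_const2: "scal2 (const2 c) = const2 (scal c)"
  by (simp add: scal2_def)

lemma emb2_mscale: "emb2 (mscale scal c M) = mscale scal2 (const2 c) (emb2 M)"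
  by (simp add: sqmat_eq_iff emb2_entry scal2_const2)

lemma scal2_var: "scal2 var_u = fls_X_inv" "scal2 var_v = fls_const fls_X_inv"
  by (simp_all add: scal2_def var_u_def var_v_def)

text \<open>
  The defect of the reflection equation for two arbitrary series of matrices instead of \<open>S(u)\<close> and
  \<open>S(v)\<close>.  Its R-matrices are scalar, so a substitution acts on the defect through the two series only.
\<close>

definition defect_of ::
    "complex \<Rightarrow> complex^'n::finite^'n \<Rightarrow> ('x free_alg fls fls, 'n) sqmat \<Rightarrow> ('x free_alg fls fls, 'n)
        sqmat \<Rightarrow>
     ('x free_alg fls fls, 'n \<times> 'n) sqmat"
  where "defect_of \<kappa> G s t =
    (let Rm = sqmat (scal_matrix (Rmat \<kappa> G (var_u - var_v)));
         Rp = sqmat (scal_matrix (Rmat \<kappa> G (var_u + var_v)))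
     in Rm * leg1 s * Rp * leg2 t - leg2 t * Rp * leg1 s * Rm)"

lemma map_reflection_defect:
  fixes g :: "'n::finite rgen \<Rightarrow> 'x free_alg" and G :: "complex^'n^'n"
  defines "H \<equiv> fls_map (fls_map (subst g))"
  shows "sqmat (map_matrix H (reflection_defect \<kappa> G)) =
    defect_of \<kappa> G (sqmat (map_matrix H S_u)) (sqmat (map_matrix H S_v))"
proof -
  have H: "ring_morphism H"
    unfolding H_def by (intro ring_morphism_fls_map ring_morphism_subst)
  have "H (fls_map (fls_map scal) x) = fls_map (fls_map scal) x" for x
    by (simp add: H_def fls_map_comp)
  then have "map_matrix H (scal_matrix M) = scal_matrix M" for M :: "complex fls fls^('n \<times> 'n)^('n \<times>
      'n)"
    by (simp add: scal_matrix_def map_matrix_def vec_eq_iff)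
  then show ?thesis
    by (simp add: reflection_defect_def defect_of_def Let_def map_matrix_diff[OF H]
        map_matrix_mult[OF H]
        map_matrix_kron[OF H] map_matrix_one[OF H] sqmat_hom leg1_def leg2_def)
qed

text \<open>
  The defect is fixed by the retraction, as the generators are; hence so are its coefficients.
\<close>

lemma presentation_refl:
  fixes G :: "complex^'n::finite^'n"
  shows "presentation rgens (refl_rels \<kappa> G)"
proof
  show "refl_rels \<kappa> G \<subseteq> FA (rgens :: 'n rgen set)"
  proof -
    define g :: "'n rgen \<Rightarrow> 'n rgen free_alg" where "g x = (if x \<in> rgens then gen x else 0)" for x
    have s: "scoeff i j r \<in> FA rgens" for i j :: 'n and r
      by (auto simp: scoeff_def rgens_def intro!: FA_gen)
    have r: "subst g p = retract rgens p" for p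
      by (simp add: retract_def g_def[abs_def])
    have gs: "subst g (scoeff i j r) = scoeff i j r" for i j :: 'n and r
      unfolding r by (rule retract_FA[OF s])
    let ?H = "fls_map (fls_map (subst g))"
    have "map_matrix ?H S_u = S_u" "map_matrix ?H S_v = S_v"
      by (simp_all add: map_matrix_def S_u_def S_v_def vec_eq_iff gs)
    then have "sqmat (map_matrix ?H (reflection_defect \<kappa> G)) = defect_of \<kappa> G (sqmat S_u) (sqmat S_v)"
      by (simp add: map_reflection_defect)
    also have "\<dots> = sqmat (reflection_defect \<kappa> G)"
      by (simp add: reflection_defect_def defect_of_def Let_def sqmat_hom leg1_def leg2_def)
    finally have "map_matrix ?H (reflection_defect \<kappa> G) = reflection_defect \<kappa> G" by (metis mat_of_sqmat)
    then have H: "?H (reflection_defect \<kappa> G $ p $ q) = reflection_defect \<kappa> G $ p $ q" for p q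
      by (cases p, cases q) (simp add: map_matrix_def vec_eq_iff)
    have "subst g (fls_nth (fls_nth (reflection_defect \<kappa> G $ p $ q) m) n) =
      fls_nth (fls_nth (?H (reflection_defect \<kappa> G $ p $ q)) m) n" for p q m n
      by (simp add: fls_map_nth)
    then have "retract rgens (fls_nth (fls_nth (reflection_defect \<kappa> G $ p $ q) m) n) =
      fls_nth (fls_nth (reflection_defect \<kappa> G $ p $ q) m) n" for p q m n
      unfolding r H .
    then have 1: "fls_nth (fls_nth (reflection_defect \<kappa> G $ p $ q) m) n \<in> FA rgens" for p q m n
      using retract_in_FA[of rgens "fls_nth (fls_nth (reflection_defect \<kappa> G $ p $ q) m) n"] by simp
    have "(- 1) ^ k \<in> FA rgens" for k
      using FA_scal[of "(- 1) ^ k"] by (simp add: ring_morphism_power[OF ring_morphism_scal] scal_minus)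
    then have 2: "fps_nth ((S_series ** S_series_neg - mat 1) $ i $ j) r \<in> FA rgens" for i j :: 'n and r
      unfolding matrix_matrix_mult_def S_series_def S_series_neg_def
      by (auto simp: fps_sum_nth fps_mult_nth mat_def intro!: FA_diff FA_sum FA_mult s)
    show ?thesis using 1 2 unfolding refl_rels_def by blast
  qed
qed

text \<open>
  The leading term in \<open>u\<close> is 1 in each linear form that involves \<open>u\<close>.
\<close>

lemma var_nonzero: "var_u \<noteq> 0" "var_v \<noteq> 0" "var_u - var_v \<noteq> 0" "var_u + var_v \<noteq> 0"
  "var_u - var_v - const2 c \<noteq> 0" "var_u + var_v - const2 c \<noteq> 0"
proof -
  have "fls_nth var_u (-1) = 1" "fls_nth var_v (-1) = 0" "fls_nth (const2 c) (-1) = 0"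
    by (simp_all add: var_u_def var_v_def)
  then have "fls_nth (var_u - var_v) (-1) \<noteq> 0" "fls_nth (var_u + var_v) (-1) \<noteq> 0"
    "fls_nth (var_u - var_v - const2 c) (-1) \<noteq> 0" "fls_nth (var_u + var_v - const2 c) (-1) \<noteq> 0"
        "fls_nth var_u (-1) \<noteq> 0"
    by simp_all
  then show "var_u \<noteq> 0" "var_u - var_v \<noteq> 0" "var_u + var_v \<noteq> 0"
    "var_u - var_v - const2 c \<noteq> 0" "var_u + var_v - const2 c \<noteq> 0" by fastforce+
  show "var_v \<noteq> 0" by (simp add: var_v_def)
qed

lemma leg_var:
  "leg1 (sqmat (mat fls_X_inv)) = mscale scal2 var_u (1 :: ('x free_alg fls fls, 'n::finite \<times> 'n)
      sqmat)"
  "leg2 (fls_matrix (sqmat (mat fls_X_inv))) = mscale scal2 var_v (1 :: ('x free_alg fls fls,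
      'n::finite \<times> 'n) sqmat)"
  by (auto intro!: sqmat_pair_eqI simp: leg_entry mat_of_simps scal2_var fls_matrix_def map_matrix_def)
    (auto simp: mat_def)

context orthosymplectic
begin

lemma kappa_eps: "kappa \<epsilon> TYPE('n) + \<epsilon> = of_nat CARD('n) / 2"
  by (simp add: kappa_def)

sublocale L: reflection_setting "mscale scal2" "emb2 Pop" "emb2 (Qop G)" "emb2 (leg1 Ashift)" "emb2
    (leg2 Ashift)"
  "const2 \<epsilon>" "const2 (kappa \<epsilon> TYPE('n))"
proof
  interpret e: ring_morphism "emb2 :: ((complex^'n^'n) free_alg, 'n \<times> 'n) sqmat \<Rightarrow> _"
    by (rule ring_morphism_emb2)
  have c: "const2 (kappa \<epsilon> TYPE('n)) + const2 \<epsilon> = const2 (of_nat CARD('n) / 2)"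
    by (simp only: fls_plus_const kappa_eps)
  have c2: "2 * (const2 (kappa \<epsilon> TYPE('n)) + const2 \<epsilon>) = const2 (of_nat CARD('n))"
  proof -
    have "kappa \<epsilon> TYPE('n) + \<epsilon> + (kappa \<epsilon> TYPE('n) + \<epsilon>) = of_nat CARD('n)" by (simp add: kappa_eps)
    then show ?thesis by (simp only: mult_2 fls_plus_const)
  qed
  show "emb2 (Qop G) * emb2 (Qop G :: ((complex^'n^'n) free_alg, _) sqmat) = mscale scal2 (2 *
      (const2 (kappa \<epsilon> TYPE('n)) + const2 \<epsilon>)) (emb2 (Qop G))"
    unfolding c2 by (simp only: e.mult[symmetric] Qop_relations emb2_mscale)
  show "emb2 (leg2 Ashift) * emb2 (Qop G) = - (emb2 (leg1 Ashift) * emb2 (Qop G)) - mscale scal2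
      (const2 (kappa \<epsilon> TYPE('n)) + const2 \<epsilon>) (emb2 (Qop G))"
    "emb2 (Qop G) * emb2 (leg2 Ashift) = - (emb2 (Qop G) * emb2 (leg1 Ashift)) - mscale scal2
        (const2 (kappa \<epsilon> TYPE('n)) + const2 \<epsilon>) (emb2 (Qop G))"
    unfolding c by (simp_all only: e.mult[symmetric] leg_Ashift_Qop e.diff e.minus emb2_mscale)
qed (simp_all only: ring_morphism.mult[OF ring_morphism_emb2, symmetric] Pop_relations Qop_relations
    emb2_mscale
    ring_morphism.one[OF ring_morphism_emb2])

lemma scal_matrix_Rmat: "sqmat (scal_matrix (Rmat (kappa \<epsilon> TYPE('n)) G x)) = L.R (1 / x) (1 / (x -
    const2 (kappa \<epsilon> TYPE('n))))"
proof -
  interpret s: ring_morphism "scal2 :: _ \<Rightarrow> (complex^'n^'n) free_alg fls fls" by (rule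
      ring_morphism_scal2)
  have 1: "scal2 (mat 1 $ p $ q) = (mat 1 $ p $ q :: (complex^'n^'n) free_alg fls fls)" for p q ::
      "'n \<times> 'n"
    by (simp add: mat_def)
  have 2: "scal2 (const2 c / y) = scal2 (1 / y) * (const2 (scal c) :: (complex^'n^'n) free_alg fls
      fls)" for c y
    using s.mult[of "1 / y" "const2 c"] by (simp add: scal2_const2)
  show ?thesis
    unfolding L.R_def sqmat_eq_iff
    by (simp add: scal_matrix_def Rmat_def mat_of_simps emb2_entry Pop_def Qop_def map_matrix_def
        s.add s.diff 1 2 flip: scal2_def)
qed

definition ideal2 :: "((complex^'n^'n) free_alg fls fls, 'n \<times> 'n) sqmat set"
  where "ideal2 = {M. \<forall>p q. mat_of M $ p $ q \<in> {f. \<forall>m. fls_nth f m \<in> {f. \<forall>n. fls_nth f n \<in>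
    {x. retract (gN G) x \<in> U.I}}}}"

lemma two_sided_ideal2: "two_sided ideal2"
  unfolding ideal2_def
  by (intro two_sided_sqmat two_sided_fls ideal_extension U.presentation_axioms)

text \<open>
  The Cayley series satisfy the hypotheses of the abstract reflection equation exactly, except that
  \<open>[B, A\<^sub>1]\<close> only has its entries in the ideal.
\<close>

lemma defect_in_ideal:
  "defect_of (kappa \<epsilon> TYPE('n)) G (cayley (fls_matrix Ashift)) (fls_matrix (cayley Ashift)) \<in> ideal2"
proof -
  interpret e: ring_morphism "emb2 :: ((complex^'n^'n) free_alg, 'n \<times> 'n) sqmat \<Rightarrow> _"
    by (rule ring_morphism_emb2)
  have leg1: "leg1 (fls_matrix (fls_matrix Ashift)) = emb2 (leg1 Ashift)"
    and leg2: "leg2 (fls_matrix (fls_matrix Ashift)) = emb2 (leg2 Ashift)"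
    by (simp_all add: emb2_def leg_fls_matrix)
  have S: "leg1 (cayley (fls_matrix Ashift)) * (mscale scal2 var_u 1 - emb2 (leg1 Ashift)) = mscale
      scal2 var_u 1 + emb2 (leg1 Ashift)"
    "(mscale scal2 var_u 1 - emb2 (leg1 Ashift)) * leg1 (cayley (fls_matrix Ashift)) = mscale scal2
        var_u 1 + emb2 (leg1 Ashift)"
    using cayley_eq[of "fls_matrix Ashift", THEN arg_cong[of _ _ leg1]]
    by (simp_all only: ring_morphism.mult[OF ring_morphism_leg1] ring_morphism.add[OF
        ring_morphism_leg1]
        ring_morphism.diff[OF ring_morphism_leg1] leg1 leg_var)
  have T: "leg2 (fls_matrix (cayley Ashift)) * (mscale scal2 var_v 1 - emb2 (leg2 Ashift)) = mscale
      scal2 var_v 1 + emb2 (leg2 Ashift)"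
    "(mscale scal2 var_v 1 - emb2 (leg2 Ashift)) * leg2 (fls_matrix (cayley Ashift)) = mscale scal2
        var_v 1 + emb2 (leg2 Ashift)"
    using cayley_eq[of Ashift, THEN arg_cong[of _ _ "\<lambda>M. leg2 (fls_matrix M)"]]
    by (simp_all only: ring_morphism.mult[OF ring_morphism_leg2] ring_morphism.add[OF
        ring_morphism_leg2]
        ring_morphism.diff[OF ring_morphism_leg2] ring_morphism.mult[OF ring_morphism_fls_matrix]
        ring_morphism.add[OF ring_morphism_fls_matrix] ring_morphism.diff[OF
            ring_morphism_fls_matrix] leg2 leg_var)
  let ?K = "(leg2 Ashift - Pop + Qop G) * leg1 Ashift - leg1 Ashift * (leg2 Ashift - Pop + Qop G)"
  have "L.B * emb2 (leg1 Ashift) - emb2 (leg1 Ashift) * L.B = emb2 ?K"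
    by (simp only: L.B_def e.mult e.add e.diff)
  moreover have "retract (gN G) (mat_of ?K $ p $ q) \<in> U.I" for p q
    using commutator_entry[of p q] U.I_FA[OF commutator_entry[of p q]] by (simp only: retract_FA)
  then have "emb2 ?K \<in> ideal2"
    by (auto simp: ideal2_def emb2_entry retract_def U.I_0)
  ultimately have K: "L.B * emb2 (leg1 Ashift) - emb2 (leg1 Ashift) * L.B \<in> ideal2" by simp
  show ?thesis
    unfolding defect_of_def Let_def scal_matrix_Rmat
    by (rule L.reflection_equation_in_ideal[where u = var_u and v = var_v, OF _ _ _ _ _ _ S T
        two_sided_ideal2 K])
      (use var_nonzero(1-4) var_nonzero(5,6)[of "kappa \<epsilon> TYPE('n)"] in simp_all)
qed

definition psi_gen :: "'n rgen \<Rightarrow> (complex^'n^'n) free_alg"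
  where "psi_gen = (\<lambda>(i, j, r). mat_of (cayley_coeff Ashift r) $ i $ j)"

lemma subst_psi_scoeff: "subst psi_gen (scoeff i j r) = mat_of (cayley_coeff Ashift r) $ i $ j"
  by (simp add: scoeff_def psi_gen_def cayley_coeff_def one_sqmat.rep_eq mat_def)

lemma Ashift_power_FA: "mat_of (Ashift ^ r) $ i $ j \<in> FA (gN G)"
proof (induction r arbitrary: i j)
  case 0
  show ?case by (auto simp: one_sqmat.rep_eq mat_def)
next
  case (Suc r)
  have "mat_of Ashift $ i $ j \<in> FA (gN G)" for i j
    by (auto simp: Ashift_def mat_of_simps mat_def intro!: FA_diff FA_mult Flift_FA)
  with Suc show ?case by (auto simp: mat_of_simps matrix_matrix_mult_def intro!: FA_sum FA_mult)
qed

lemma cayley_coeff_FA: "mat_of (cayley_coeff Ashift r) $ i $ j \<in> FA (gN G)"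
  by (auto simp: cayley_coeff_def mat_of_simps mat_def intro!: FA_add Ashift_power_FA)

lemma psi_defect: "subst psi_gen (fls_nth (fls_nth (reflection_defect (kappa \<epsilon> TYPE('n)) G $ p $ q)
    m) n) \<in> U.I"
proof -
  let ?H = "fls_map (fls_map (subst psi_gen))"
  have "mat_of (cayley_coeff (fls_matrix Ashift) r) $ i $ j = fls_const (mat_of (cayley_coeff Ashift
      r) $ i $ j)" for r i j
    by (simp only: fls_matrix_cayley_coeff[symmetric]) (simp add: fls_matrix_def map_matrix_def)
  then have "sqmat (map_matrix ?H S_u) = cayley (fls_matrix Ashift)"
    by (simp add: sqmat_eq_iff map_matrix_def S_u_def cayley_def subst_psi_scoeff)
  moreover have "sqmat (map_matrix ?H S_v) = fls_matrix (cayley Ashift)"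
    by (simp add: sqmat_eq_iff map_matrix_def S_v_def cayley_def subst_psi_scoeff fls_matrix_def)
  ultimately have "sqmat (map_matrix ?H (reflection_defect (kappa \<epsilon> TYPE('n)) G)) \<in> ideal2"
    using defect_in_ideal by (simp add: map_reflection_defect)
  then have "retract (gN G) (fls_nth (fls_nth (?H (reflection_defect (kappa \<epsilon> TYPE('n)) G $ p $ q))
      m) n) \<in> U.I"
    unfolding ideal2_def mem_Collect_eq mat_of_sqmat map_matrix_def vec_lambda_beta by blast
  then have "retract (gN G) (subst psi_gen (fls_nth (fls_nth (reflection_defect (kappa \<epsilon> TYPE('n)) G
      $ p $ q) m) n)) \<in> U.I"
    by (simp add: fls_map_nth)
  moreover have "fls_nth (fls_nth (reflection_defect (kappa \<epsilon> TYPE('n)) G $ p $ q) m) n \<in> FA rgens"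
    using presentation.relators[OF presentation_refl[of "kappa \<epsilon> TYPE('n)" G]] unfolding
        refl_rels_def by blast
  then have "subst psi_gen (fls_nth (fls_nth (reflection_defect (kappa \<epsilon> TYPE('n)) G $ p $ q) m) n)
      \<in> FA (gN G)"
    by (rule subst_FA) (auto simp: psi_gen_def cayley_coeff_FA)
  ultimately show ?thesis by (simp add: retract_FA)
qed

end

text \<open>
  Inside the range of summation the alternating terms are \<open>\<plusminus> 4 A\<^sup>r\<close>, and at its ends \<open>\<plusminus> 2 A\<^sup>r\<close>; the
  partial sums therefore alternate between \<open>2 A\<^sup>r\<close> and \<open>- 2 A\<^sup>r\<close>.
\<close>

lemma cayley_partial_sum:
  fixes A :: "'a::ring_1"
  assumes "n < r"
  shows "(\<Sum>m\<le>n. cayley_coeff A m * ((- 1) ^ (r - m) * cayley_coeff A (r - m))) = (- 1) ^ (r - n) *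
      (A ^ r + A ^ r)"
  using assms
proof (induction n)
  case 0
  then show ?case by (simp add: cayley_coeff_def)
next
  case (Suc n)
  have "A ^ Suc n * A ^ (r - Suc n) = A ^ r" using Suc.prems by (simp del: power_Suc flip: power_add)
  then have p: "cayley_coeff A (Suc n) * cayley_coeff A (r - Suc n) = A ^ r + A ^ r + (A ^ r + A ^ r)"
    using Suc.prems by (simp add: cayley_coeff_def distrib_left distrib_right del: power_Suc)
  have "r - n = Suc (r - Suc n)" using Suc.prems by simp
  moreover have "cayley_coeff A (Suc n) * ((- 1) ^ (r - Suc n) * cayley_coeff A (r - Suc n)) =
    (- 1) ^ (r - Suc n) * (cayley_coeff A (Suc n) * cayley_coeff A (r - Suc n))"
    by (simp add: minus_one_power_iff)
  ultimately show ?case using Suc p by (simp add: distrib_left)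
qed

lemma cayley_unitary:
  fixes A :: "'a::ring_1"
  shows "(\<Sum>m\<le>r. cayley_coeff A m * ((- 1) ^ (r - m) * cayley_coeff A (r - m))) = (if r = 0 then 1
      else 0)"
proof (cases r)
  case (Suc n)
  then show ?thesis using cayley_partial_sum[of n r A] by (simp add: cayley_coeff_def del: power_Suc)
qed (simp add: cayley_coeff_def)

lemma mat_of_sum: "mat_of (sum f S) $ i $ j = (\<Sum>x\<in>S. mat_of (f x) $ i $ j)"
  by (induction S rule: infinite_finite_induct) (simp_all add: mat_of_simps)

context orthosymplectic
begin

lemma psi_unitarity: "subst psi_gen (fps_nth ((S_series ** S_series_neg - mat 1) $ i $ j) r) = 0"
proof -
  let ?C = "cayley_coeff Ashift"
  have sgn: "subst psi_gen ((- 1) ^ k) = (- 1) ^ k" for k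
    by (simp add: ring_morphism_power[OF ring_morphism_subst] subst_minus)
  have "subst psi_gen (fps_nth ((S_series ** S_series_neg) $ i $ j) r) =
    (\<Sum>k\<in>UNIV. \<Sum>m\<le>r. mat_of (?C m) $ i $ k * ((- 1) ^ (r - m) * mat_of (?C (r - m)) $ k $ j))"
    by (simp add: matrix_matrix_mult_def S_series_def S_series_neg_def fps_sum_nth fps_mult_nth
        subst_sum
        subst_mult subst_psi_scoeff sgn atMost_atLeast0)
  also have "\<dots> = (\<Sum>m\<le>r. \<Sum>k\<in>UNIV. mat_of (?C m) $ i $ k * ((- 1) ^ (r - m) * mat_of (?C (r - m)) $ k
      $ j))"
    by (rule sum.swap)
  also have "\<dots> = mat_of (\<Sum>m\<le>r. ?C m * ((- 1) ^ (r - m) * ?C (r - m))) $ i $ j"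
    by (auto simp: mat_of_sum minus_one_power_iff mat_of_simps matrix_matrix_mult_def sum_negf
        sum_mat_one intro!: sum.cong)
  also have "\<dots> = (if r = 0 then mat 1 $ i $ j else 0)"
    unfolding cayley_unitary by (simp add: mat_of_simps)
  finally show ?thesis
    by (auto simp: subst_diff mat_def)
qed

lemma psi_relators: "x \<in> refl_rels (kappa \<epsilon> TYPE('n)) G \<Longrightarrow> subst psi_gen x \<in> U.I"
  unfolding refl_rels_def
  by (elim UnE CollectE exE conjE) (simp_all only: psi_defect psi_unitarity U.I_0)

end

section \<open>Commutators in the reflection algebra\<close>

definition fls_coeff :: "int \<Rightarrow> ('a::zero fls, 'n::finite) sqmat \<Rightarrow> ('a, 'n) sqmat"
  where "fls_coeff n M = sqmat (map_matrix (\<lambda>f. fls_nth f n) (mat_of M))"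

text \<open>
  Series without positive powers of the spectral parameter, whose first two coefficients multiply
  as those of power series do.
\<close>

definition regular :: "('a::zero fls, 'n::finite) sqmat \<Rightarrow> bool"
  where "regular M \<longleftrightarrow> (\<forall>i j. \<forall>n<0. fls_nth (mat_of M $ i $ j) n = 0)"

lemma fls_coeff_entry: "mat_of (fls_coeff n M) $ i $ j = fls_nth (mat_of M $ i $ j) n"
  by (simp add: fls_coeff_def map_matrix_def)

lemma regular_mult:
  fixes M N :: "('a::ring_1 fls, 'n::finite) sqmat"
  assumes "regular M" "regular N"
  shows "regular (M * N)"
    and "fls_coeff 0 (M * N) = fls_coeff 0 M * fls_coeff 0 N"
    and "fls_coeff 1 (M * N) = fls_coeff 0 M * fls_coeff 1 N + fls_coeff 1 M * fls_coeff 0 N"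
proof -
  have nth: "fls_nth (mat_of (M * N) $ i $ j) n = (\<Sum>k\<in>UNIV. \<Sum>m=0..n. fls_nth (mat_of M $ i $ k) m *
      fls_nth (mat_of N $ k $ j) (n - m))" for i j n
  proof -
    have "fls_nth (mat_of M $ i $ k * mat_of N $ k $ j) n = (\<Sum>m=0..n. fls_nth (mat_of M $ i $ k) m *
        fls_nth (mat_of N $ k $ j) (n - m))" for k
      using fls_times_nth_above[of 0 "mat_of M $ i $ k" 0 "mat_of N $ k $ j" n] assms by (simp add:
          regular_def)
    then show ?thesis by (simp add: mat_of_simps matrix_matrix_mult_def fls_nth_sum)
  qed
  show "regular (M * N)" unfolding regular_def by (simp add: nth)
  show "fls_coeff 0 (M * N) = fls_coeff 0 M * fls_coeff 0 N"
    by (simp add: sqmat_eq_iff fls_coeff_entry nth) (simp add: mat_of_simps matrix_matrix_mult_def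
        fls_coeff_entry)
  have "{0..1::int} = {0, 1}" by auto
  then show "fls_coeff 1 (M * N) = fls_coeff 0 M * fls_coeff 1 N + fls_coeff 1 M * fls_coeff 0 N"
    by (simp add: sqmat_eq_iff fls_coeff_entry nth) (simp add: mat_of_simps matrix_matrix_mult_def
        fls_coeff_entry sum.distrib)
qed

lemma fls_coeff_diff: "fls_coeff n (M - N) = fls_coeff n M - fls_coeff n (N :: ('a::ring_1 fls,
    'n::finite) sqmat)"
  by (simp add: sqmat_eq_iff fls_coeff_entry mat_of_simps)

lemma fls_matrix_coeff:
  "regular (fls_matrix M)" "fls_coeff 0 (fls_matrix M) = M" "n \<noteq> 0 \<Longrightarrow> fls_coeff n (fls_matrix M) = 0"
  by (simp_all add: regular_def fls_coeff_entry sqmat_eq_iff) (simp_all add: fls_matrix_def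
      map_matrix_def mat_of_simps)

text \<open>
  Compare the lowest coefficients in \<open>(1 / x) x = 1\<close>.
\<close>

lemma inverse_linear_nth:
  fixes x :: "complex fls fls"
  assumes x: "fls_subdegree x = - 1" "fls_nth x (- 1) = 1"
  shows "n \<le> 0 \<Longrightarrow> fls_nth (1 / x) n = 0" "fls_nth (1 / x) 1 = 1"
proof -
  have "x \<noteq> 0" using x by auto
  then have xi: "(1 / x) * x = 1" "1 / x \<noteq> 0" by simp_all
  then have "fls_subdegree (1 / x) + fls_subdegree x = 0"
    using fls_subdegree_mult[of "1 / x" x] \<open>x \<noteq> 0\<close> by simp
  then have s: "fls_subdegree (1 / x) = 1" using x by simp
  then show "n \<le> 0 \<Longrightarrow> fls_nth (1 / x) n = 0" by (intro fls_eq0_below_subdegree) simp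
  have "fls_nth ((1 / x) * x) 0 = fls_nth (1 / x) 1 * fls_nth x (- 1)"
    unfolding fls_times_nth(2) s x by (simp add: x)
  then show "fls_nth (1 / x) 1 = 1" unfolding xi x by simp
qed

lemma Rmat_coeff:
  fixes G :: "complex^'n::finite^'n"
  assumes x: "fls_subdegree x = - 1" "fls_nth x (- 1) = 1"
    and y: "fls_subdegree (x - const2 \<kappa>) = - 1" "fls_nth (x - const2 \<kappa>) (- 1) = 1"
  defines "M \<equiv> sqmat (scal_matrix (Rmat \<kappa> G x)) :: ('x free_alg fls fls, 'n \<times> 'n) sqmat"
  shows "regular M" "fls_coeff 0 M = 1" "fls_coeff 1 M = fls_matrix (Qop G - Pop)"
proof -
  have d: "const2 c / z = fls_const (fls_const c) * (1 / z)" for c and z :: "complex fls fls" by simp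
  have nth: "fls_nth (mat_of M $ p $ q) n = fls_map scal (fls_nth (mat 1 $ p $ q) n
     - fls_const (Pmat $ p $ q) * fls_nth (1 / x) n + fls_const (Qmat G $ p $ q) * fls_nth (1 / (x -
         const2 \<kappa>)) n)" for p q n
    unfolding M_def by (simp add: scal_matrix_def Rmat_def fls_map_nth d del: times_divide_eq_right
        mult_1_right)
  show "regular M"
    unfolding regular_def nth by (simp add: inverse_linear_nth[OF x] inverse_linear_nth[OF y] mat_def)
  show "fls_coeff 0 M = 1"
    unfolding sqmat_eq_iff fls_coeff_entry nth
    by (simp add: inverse_linear_nth[OF x] inverse_linear_nth[OF y] mat_def mat_of_simps)
  interpret s: ring_morphism "fls_map scal :: _ \<Rightarrow> 'x free_alg fls" by (rule ring_morphism_fls_map[OF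
      ring_morphism_scal])
  show "fls_coeff 1 M = fls_matrix (Qop G - Pop)"
    unfolding sqmat_eq_iff fls_coeff_entry nth inverse_linear_nth[OF x] inverse_linear_nth[OF y]
    by (simp add: mat_def mat_of_simps fls_matrix_def map_matrix_def Qop_def Pop_def s.add s.diff
        s.minus fls_minus_const fls_plus_const)
qed

lemma sqmat_reflection_defect: "sqmat (reflection_defect \<kappa> G) = defect_of \<kappa> G (sqmat S_u) (sqmat S_v)"
  by (simp add: reflection_defect_def defect_of_def Let_def sqmat_hom leg1_def leg2_def)

definition Hgen :: "('n::finite rgen free_alg, 'n) sqmat"
  where "Hgen = sqmat (\<chi> i j. scoeff i j 1)"

lemma subdegree_linear:
  "fls_subdegree (var_u - var_v) = - 1" "fls_subdegree (var_u + var_v) = - 1"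
  "fls_subdegree (var_u - var_v - const2 c) = - 1" "fls_subdegree (var_u + var_v - const2 c) = - 1"
  "fls_nth (var_u - var_v) (- 1) = 1" "fls_nth (var_u + var_v) (- 1) = 1"
  "fls_nth (var_u - var_v - const2 c) (- 1) = 1" "fls_nth (var_u + var_v - const2 c) (- 1) = 1"
  by (auto intro!: fls_subdegree_eqI simp: var_u_def var_v_def)

text \<open>
  To first order in \<open>u\<inverse>\<close> the factors \<open>R(u - v)\<close>, \<open>S\<^sub>1(u)\<close> and \<open>R(u + v)\<close> contribute
  \<open>Q - P\<close>, \<open>H\<^sub>1\<close> and \<open>Q - P\<close>; what remains is the coefficient of \<open>v\<inverse>\<close> in a commutator with \<open>S\<^sub>2(v)\<close>.
\<close>

lemma defect_coefficient:
  fixes G :: "complex^'n::finite^'n"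
  defines "Z \<equiv> leg1 Hgen + (Qop G - Pop) + (Qop G - Pop)"
  shows "fls_nth (fls_nth (reflection_defect \<kappa> G $ p $ q) 1) 1 = mat_of (Z * leg2 Hgen - leg2 Hgen *
      Z) $ p $ q"
proof -
  define S T where "S = leg1 (sqmat S_u :: ('n rgen free_alg fls fls, 'n) sqmat)"
    and "T = leg2 (sqmat S_v :: ('n rgen free_alg fls fls, 'n) sqmat)"
  define W where "W = leg2 (sqmat (\<chi> i j. fps_to_fls (Abs_fps (scoeff i j))) :: ('n rgen free_alg
      fls, 'n) sqmat)"
  let ?m = "sqmat (scal_matrix (Rmat \<kappa> G (var_u - var_v))) :: ('n rgen free_alg fls fls, 'n \<times> 'n) sqmat"
  let ?p = "sqmat (scal_matrix (Rmat \<kappa> G (var_u + var_v))) :: ('n rgen free_alg fls fls, 'n \<times> 'n) sqmat"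
  have S: "regular S" "fls_coeff 0 S = 1" "fls_coeff 1 S = fls_matrix (leg1 Hgen)"
  proof -
    have nth: "fls_nth (mat_of S $ (i, k) $ (j, l)) n =
       (if n < 0 then 0 else fls_const (scoeff i j (nat n)) * mat 1 $ k $ l)" for i j k l n
      by (simp add: S_def leg_entry S_u_def mat_def)
    show "regular S" unfolding regular_def by (simp add: nth)
    show "fls_coeff 0 S = 1"
      by (rule sqmat_pair_eqI) (simp add: fls_coeff_entry nth mat_of_simps scoeff_def mat_def)
    show "fls_coeff 1 S = fls_matrix (leg1 Hgen)"
      by (rule sqmat_pair_eqI) (simp add: fls_coeff_entry nth fls_matrix_def map_matrix_def
          leg_entry Hgen_def mat_def)
  qed
  have T: "T = fls_matrix W"
    by (rule sqmat_pair_eqI) (simp add: T_def W_def leg_entry S_v_def fls_matrix_def map_matrix_def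
        mat_def)
  have W: "regular W" "fls_coeff 0 W = 1" "fls_coeff 1 W = leg2 Hgen"
  proof -
    have nth: "fls_nth (mat_of W $ (i, k) $ (j, l)) n =
       (if n < 0 then 0 else mat 1 $ i $ j * scoeff k l (nat n))" for i j k l n
      by (simp add: W_def leg_entry mat_def)
    show "regular W" unfolding regular_def by (simp add: nth)
    show "fls_coeff 0 W = 1"
      by (rule sqmat_pair_eqI) (simp add: fls_coeff_entry nth mat_of_simps scoeff_def mat_def)
    show "fls_coeff 1 W = leg2 Hgen"
      by (rule sqmat_pair_eqI) (simp add: fls_coeff_entry nth leg_entry Hgen_def mat_def)
  qed
  note m = Rmat_coeff[OF subdegree_linear(1,5,3,7), where 'x = "'n rgen", of \<kappa> G]
    and p = Rmat_coeff[OF subdegree_linear(2,6,4,8), where 'x = "'n rgen", of \<kappa> G]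
  have Tc: "regular T" "fls_coeff 0 T = W" "fls_coeff 1 T = 0"
    unfolding T by (simp_all add: fls_matrix_coeff)
  have Z: "fls_matrix Z = fls_matrix (leg1 Hgen) + fls_matrix (Qop G - Pop) + fls_matrix (Qop G - Pop)"
    unfolding Z_def by (simp only: ring_morphism.add[OF ring_morphism_fls_matrix])
  have "fls_coeff 1 (sqmat (reflection_defect \<kappa> G)) = fls_coeff 1 (?m * S * ?p * T - T * ?p * S * ?m)"
    by (simp add: sqmat_reflection_defect defect_of_def Let_def S_def T_def)
  also have "\<dots> = fls_matrix Z * W - W * fls_matrix Z"
    unfolding Z by (simp add: fls_coeff_diff regular_mult m p S Tc distrib_left distrib_right add_ac)
  finally have 1: "fls_coeff 1 (sqmat (reflection_defect \<kappa> G)) = fls_matrix Z * W - W * fls_matrix Z" .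
  have "fls_coeff 1 (fls_matrix Z * W - W * fls_matrix Z) = Z * leg2 Hgen - leg2 Hgen * Z"
    by (simp add: fls_coeff_diff regular_mult W fls_matrix_coeff)
  then have "fls_coeff 1 (fls_coeff 1 (sqmat (reflection_defect \<kappa> G))) = Z * leg2 Hgen - leg2 Hgen * Z"
    by (simp add: 1)
  then show ?thesis by (metis fls_coeff_entry mat_of_sqmat)
qed

text \<open>
  The value at \<open>X\<close> of the linear map with \<open>E\<^sub>i\<^sub>j \<mapsto> M\<^sub>i\<^sub>j\<close>.
\<close>

definition pair :: "complex^'n^'n \<Rightarrow> ('x free_alg, 'n::finite) sqmat \<Rightarrow> 'x free_alg"
  where "pair X M = (\<Sum>i\<in>UNIV. \<Sum>j\<in>UNIV. scal (X $ i $ j) * mat_of M $ i $ j)"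

text \<open>
  The value at \<open>X \<otimes> Y\<close> of the corresponding map for two tensor factors.  It turns the operators \<open>P\<close> and
  \<open>Q\<close> in front of or behind a matrix into products of \<open>X\<close>, \<open>\<theta>(X)\<close> and \<open>Y\<close>.
\<close>

definition pair2 :: "complex^'n^'n \<Rightarrow> complex^'n^'n \<Rightarrow> ('x free_alg, 'n::finite \<times> 'n) sqmat \<Rightarrow> 'x free_alg"
  where "pair2 X Y M = (\<Sum>i\<in>UNIV. \<Sum>j\<in>UNIV. \<Sum>k\<in>UNIV. \<Sum>l\<in>UNIV.
    scal (X $ i $ j * Y $ k $ l) * mat_of M $ (i, k) $ (j, l))"

lemma pair2_diff: "pair2 X Y (M - N) = pair2 X Y M - pair2 X Y N"
  and pair2_add: "pair2 X Y (M + N) = pair2 X Y M + pair2 X Y N"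
  by (simp_all add: pair2_def mat_of_simps algebra_simps sum.distrib sum_subtractf)

lemma pair_diff: "pair (X - Y) M = pair X M - pair Y M"
  and pair_add: "pair (X + Y) M = pair X M + pair Y M"
  and pair_minus: "pair (- X) M = - pair X M"
  and pair_cscale: "pair (cscale c X) M = scal c * pair X M"
  by (simp_all add: pair_def scal_diff scal_add scal_minus scal_mult left_diff_distrib distrib_right
      sum.distrib
      sum_subtractf sum_negf mult.assoc sum_distrib_left)

lemma sum_reorder:
  fixes f :: "'a::finite \<Rightarrow> 'a \<Rightarrow> 'a \<Rightarrow> 'a \<Rightarrow> 'b::comm_monoid_add"
    and g :: "'a \<Rightarrow> 'a \<Rightarrow> 'a \<Rightarrow> 'a \<Rightarrow> 'a \<Rightarrow> 'b"
  shows "(\<Sum>i\<in>UNIV. \<Sum>j\<in>UNIV. \<Sum>k\<in>UNIV. \<Sum>l\<in>UNIV. f i j k l) = (\<Sum>k\<in>UNIV. \<Sum>l\<in>UNIV. \<Sum>i\<in>UNIV. \<Sum>j\<in>UNIV. f i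
      j k l)"
    and "(\<Sum>i\<in>UNIV. \<Sum>j\<in>UNIV. \<Sum>k\<in>UNIV. \<Sum>l\<in>UNIV. \<Sum>m\<in>UNIV. g i j k l m) = (\<Sum>m\<in>UNIV. \<Sum>l\<in>UNIV. \<Sum>k\<in>UNIV.
        \<Sum>i\<in>UNIV. \<Sum>j\<in>UNIV. g i j k l m)"
    and "(\<Sum>i\<in>UNIV. \<Sum>j\<in>UNIV. \<Sum>k\<in>UNIV. \<Sum>l\<in>UNIV. \<Sum>m\<in>UNIV. g i j k l m) = (\<Sum>k\<in>UNIV. \<Sum>m\<in>UNIV. \<Sum>l\<in>UNIV.
        \<Sum>i\<in>UNIV. \<Sum>j\<in>UNIV. g i j k l m)"
  subgoal unfolding sum.cartesian_product
    by (rule sum.reindex_bij_witness[of _ "\<lambda>(k, l, i, j). (i, j, k, l)" "\<lambda>(i, j, k, l). (k, l, i,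
        j)"]) auto
  subgoal unfolding sum.cartesian_product
    by (rule sum.reindex_bij_witness[of _ "\<lambda>(m, l, k, i, j). (i, j, k, l, m)" "\<lambda>(i, j, k, l, m). (m,
        l, k, i, j)"]) auto
  subgoal unfolding sum.cartesian_product
    by (rule sum.reindex_bij_witness[of _ "\<lambda>(k, m, l, i, j). (i, j, k, l, m)" "\<lambda>(i, j, k, l, m). (k,
        m, l, i, j)"]) auto
  done

lemma scal_left_commute: "a * (scal c * b) = scal c * (a * b)"
  by (metis mult.assoc scal_commute)

lemma pair2_leg_leg: "pair2 X Y (leg1 M * leg2 M') = pair X M * pair Y M'"
  "pair2 X Y (leg2 M' * leg1 M) = pair Y M' * pair X M"
proof -
  have e: "mat_of (leg1 M * leg2 M') $ (i, k) $ (j, l) = mat_of M $ i $ j * mat_of M' $ k $ l"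
    "mat_of (leg2 M' * leg1 M) $ (i, k) $ (j, l) = mat_of M' $ k $ l * mat_of M $ i $ j" for i j k l
    by (simp_all only: leg_mult_entry(1,2) leg_entry mat_one_left_commute mult.assoc[symmetric]
        sum_mat_one)
      (simp_all only: mult.assoc mat_one_left_commute sum_mat_one)
  have "pair X M * pair Y M' = (\<Sum>k\<in>UNIV. \<Sum>l\<in>UNIV. \<Sum>i\<in>UNIV. \<Sum>j\<in>UNIV.
    scal (X $ i $ j * Y $ k $ l) * (mat_of M $ i $ j * mat_of M' $ k $ l))"
    by (simp add: pair_def scal_mult sum_distrib_left sum_distrib_right mult.assoc
        scal_left_commute[of "mat_of M $ _ $ _"])
  then show "pair2 X Y (leg1 M * leg2 M') = pair X M * pair Y M'"
    unfolding pair2_def e by (subst sum_reorder(1)) simp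
  show "pair2 X Y (leg2 M' * leg1 M) = pair Y M' * pair X M"
    by (simp add: pair2_def e pair_def scal_mult mult.commute[of "X $ _ $ _"] sum_distrib_left
        sum_distrib_right mult.assoc
        scal_left_commute[of "mat_of M' $ _ $ _"])
qed

lemma pair2_Pop:
  "pair2 X Y (Pop * leg2 M) = pair (X ** Y) M"
  "pair2 X Y (leg2 M * Pop) = pair (Y ** X) M"
proof -
  have "pair2 X Y (Pop * leg2 M) = (\<Sum>i\<in>UNIV. \<Sum>j\<in>UNIV. \<Sum>k\<in>UNIV.
    mat 1 $ k $ j * (\<Sum>l\<in>UNIV. scal (X $ i $ j * Y $ k $ l) * mat_of M $ i $ l))"
    unfolding pair2_def Pop_mult leg_entry mat_one_left_commute sum_distrib_left ..
  also have "\<dots> = (\<Sum>i\<in>UNIV. \<Sum>l\<in>UNIV. \<Sum>j\<in>UNIV. scal (X $ i $ j * Y $ j $ l) * mat_of M $ i $ l)"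
    unfolding sum_mat_one by (intro sum.cong refl sum.swap)
  finally show "pair2 X Y (Pop * leg2 M) = pair (X ** Y) M"
    by (simp add: pair_def matrix_matrix_mult_def scal_sum sum_distrib_right)
  have "pair2 X Y (leg2 M * Pop) = (\<Sum>i\<in>UNIV. \<Sum>j\<in>UNIV. \<Sum>k\<in>UNIV.
    \<Sum>l\<in>UNIV. mat 1 $ i $ l * (scal (X $ i $ j * Y $ k $ l) * mat_of M $ k $ j))"
    unfolding pair2_def Pop_mult leg_entry mat_one_left_commute ..
  also have "\<dots> = (\<Sum>j\<in>UNIV. \<Sum>i\<in>UNIV. \<Sum>k\<in>UNIV. scal (X $ i $ j * Y $ k $ i) * mat_of M $ k $ j)"
    unfolding sum_mat_one by (rule sum.swap)
  also have "\<dots> = (\<Sum>j\<in>UNIV. \<Sum>k\<in>UNIV. \<Sum>i\<in>UNIV. scal (X $ i $ j * Y $ k $ i) * mat_of M $ k $ j)"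
    by (intro sum.cong refl sum.swap)
  also have "\<dots> = (\<Sum>k\<in>UNIV. \<Sum>j\<in>UNIV. \<Sum>i\<in>UNIV. scal (X $ i $ j * Y $ k $ i) * mat_of M $ k $ j)"
    by (rule sum.swap)
  finally show "pair2 X Y (leg2 M * Pop) = pair (Y ** X) M"
    by (simp add: pair_def matrix_matrix_mult_def scal_sum sum_distrib_right mult.commute)
qed

context orthosymplectic
begin

lemma pair2_Qop:
  "pair2 X Y (Qop G * leg2 M) = pair (\<theta> X ** Y) M"
  "pair2 X Y (leg2 M * Qop G) = pair (Y ** \<theta> X) M"
proof -
  have "pair2 X Y (Qop G * leg2 M) = (\<Sum>i\<in>UNIV. \<Sum>j\<in>UNIV. \<Sum>k\<in>UNIV. \<Sum>l\<in>UNIV. \<Sum>m\<in>UNIV.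
      scal (X $ i $ j * Y $ k $ l * G $ i $ k * Gi $ m $ j) * mat_of M $ m $ l)"
    by (simp add: pair2_def leg_mult_entry Qop_entry sum_distrib_left scal_mult mult.assoc)
  also have "\<dots> = (\<Sum>m\<in>UNIV. \<Sum>l\<in>UNIV. \<Sum>k\<in>UNIV. \<Sum>i\<in>UNIV. \<Sum>j\<in>UNIV.
      scal (X $ i $ j * Y $ k $ l * G $ i $ k * Gi $ m $ j) * mat_of M $ m $ l)"
    by (rule sum_reorder)
  also have "\<dots> = pair (\<theta> X ** Y) M"
    unfolding pair_def
    by (simp add: matrix_matrix_mult_def \<theta>_entry scal_sum[symmetric] sum_distrib_right[symmetric])
      (simp add: sum_distrib_left mult_ac)
  finally show "pair2 X Y (Qop G * leg2 M) = pair (\<theta> X ** Y) M" .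
  have "pair2 X Y (leg2 M * Qop G) = (\<Sum>i\<in>UNIV. \<Sum>j\<in>UNIV. \<Sum>k\<in>UNIV. \<Sum>l\<in>UNIV. \<Sum>m\<in>UNIV.
      scal (X $ i $ j * Y $ k $ l * G $ i $ m * Gi $ l $ j) * mat_of M $ k $ m)"
    by (simp add: pair2_def leg_mult_entry Qop_entry sum_distrib_left scal_mult mult.assoc
       scal_commute[of _ "mat_of M $ _ $ _"] scal_left_commute[of "mat_of M $ _ $ _"])
  also have "\<dots> = (\<Sum>k\<in>UNIV. \<Sum>m\<in>UNIV. \<Sum>l\<in>UNIV. \<Sum>i\<in>UNIV. \<Sum>j\<in>UNIV.
      scal (X $ i $ j * Y $ k $ l * G $ i $ m * Gi $ l $ j) * mat_of M $ k $ m)"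
    by (rule sum_reorder)
  also have "\<dots> = pair (Y ** \<theta> X) M"
    unfolding pair_def
    by (simp add: matrix_matrix_mult_def \<theta>_entry scal_sum[symmetric] sum_distrib_right[symmetric])
      (simp add: sum_distrib_left mult_ac)
  finally show "pair2 X Y (leg2 M * Qop G) = pair (Y ** \<theta> X) M" .
qed

text \<open>
  The operators \<open>P\<close> and \<open>Q\<close> contribute the same multiple of \<open>h([X, Y])\<close>, since \<open>\<theta>(X) = - X\<close> offsets
  their opposite signs; each of them occurs twice.
\<close>

lemma Hgen_commutator:
  assumes "X \<in> gN G" "Y \<in> gN G"
  shows "pair X Hgen * pair Y Hgen - pair Y Hgen * pair X Hgen - scal 4 * pair (X ** Y - Y ** X) Hgen
    \<in> relation_ideal rgens (refl_rels (kappa \<epsilon> TYPE('n)) G)"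
proof -
  interpret B: presentation rgens "refl_rels (kappa \<epsilon> TYPE('n)) G" by (rule presentation_refl)
  let ?Z = "leg1 Hgen + (Qop G - Pop) + (Qop G - Pop)"
  have \<theta>X: "\<theta> X ** Y = - (X ** Y)" "Y ** \<theta> X = - (Y ** X)"
    using assms by (simp_all add: gN_iff matrix_matrix_mult_def vec_eq_iff sum_negf)
  have four: "scal 4 * x = x + x + (x + x)" for x :: "'n rgen free_alg"
  proof -
    have "(4 :: complex) = 1 + 1 + (1 + 1)" by simp
    then show ?thesis by (simp only: scal_add scal_1 distrib_right mult_1)
  qed
  have "fls_nth (fls_nth (reflection_defect (kappa \<epsilon> TYPE('n)) G $ p $ q) 1) 1 \<in> B.I" for p q
    by (rule B.I_relator) (unfold refl_rels_def, blast)
  then have "mat_of (?Z * leg2 Hgen - leg2 Hgen * ?Z) $ p $ q \<in> B.I" for p q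
    unfolding defect_coefficient .
  then have "pair2 X Y (?Z * leg2 Hgen - leg2 Hgen * ?Z) \<in> B.I"
    unfolding pair2_def by (intro B.I_sum B.I_mult_left) auto
  also have "pair2 X Y (?Z * leg2 Hgen - leg2 Hgen * ?Z) =
    pair X Hgen * pair Y Hgen - pair Y Hgen * pair X Hgen - scal 4 * pair (X ** Y - Y ** X) Hgen"
    by (simp add: distrib_left distrib_right left_diff_distrib[of _ _ "leg2 _"]
        right_diff_distrib[of "leg2 _"] pair2_diff pair2_add pair2_leg_leg
        pair2_Pop pair2_Qop \<theta>X pair_minus pair_diff four)
  finally show ?thesis .
qed

end

section \<open>The embedding and its left inverse\<close>

definition linear_coeff :: "'a::ring_1 \<Rightarrow> nat \<Rightarrow> 'a"
  where "linear_coeff A r = (if r = 0 then 1 else if r = 1 then A else 0)"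

lemma cayley_linear:
  fixes A :: "'a::ring_1"
  shows "(\<Sum>m\<le>r. cayley_coeff A m * linear_coeff (- A) (r - m)) = linear_coeff A r"
    and "(\<Sum>m\<le>r. linear_coeff (- A) m * cayley_coeff A (r - m)) = linear_coeff A r"
proof -
  have 1: "(\<Sum>m\<le>r. cayley_coeff A m * linear_coeff (- A) (r - m)) = linear_coeff A r" for r
  proof (cases r)
    case (Suc n)
    have "(\<Sum>m\<le>n. cayley_coeff A m * linear_coeff (- A) (Suc n - m)) = (\<Sum>m\<le>n. if m = n then -
        (cayley_coeff A n * A) else 0)"
      by (rule sum.cong) (auto simp: linear_coeff_def)
    then show ?thesis
      using cayley_step(1)[of A n] by (simp add: Suc linear_coeff_def)
  qed (simp add: linear_coeff_def cayley_coeff_def)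
  have 2: "(\<Sum>m\<le>r. cayley_coeff A m * linear_coeff (- A) (r - m)) = (\<Sum>m\<le>r. linear_coeff (- A) m *
      cayley_coeff A (r - m))" for r
    by (rule sum.reindex_bij_witness[of _ "\<lambda>m. r - m" "\<lambda>m. r - m"])
      (auto simp: linear_coeff_def cayley_coeff_def distrib_left distrib_right power_commutes)
  show "(\<Sum>m\<le>r. cayley_coeff A m * linear_coeff (- A) (r - m)) = linear_coeff A r"
    "(\<Sum>m\<le>r. linear_coeff (- A) m * cayley_coeff A (r - m)) = linear_coeff A r"
    using 1 2 by simp_all
qed

context presentation
begin

text \<open>
  Matrices and series over a presented algebra are computed on representatives in the free algebra.
\<close>

lemma rmat_one_pres: "rmat_one \<A> = (\<lambda>i j. \<pi> (mat_of 1 $ i $ j))"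
  by (auto simp: rmat_one_def one_pres zero_pres mat_of_simps mat_def fun_eq_iff)

lemma rmat_mult_pres:
  assumes "\<And>i j. mat_of M $ i $ j \<in> FA X" "\<And>i j. mat_of N $ i $ j \<in> FA X"
  shows "rmat_mult \<A> (\<lambda>i j. \<pi> (mat_of M $ i $ j)) (\<lambda>i j. \<pi> (mat_of N $ i $ j)) = (\<lambda>i j. \<pi> (mat_of (M
      * N) $ i $ j))"
  unfolding rmat_mult_def
  by (intro ext) (simp add: mult_pres assms finsum_pres FA_mult mat_of_simps matrix_matrix_mult_def)

lemma rmat_pow_pres:
  assumes "\<And>i j. mat_of M $ i $ j \<in> FA X" "\<And>i j r. mat_of (M ^ r) $ i $ j \<in> FA X"
  shows "rmat_pow \<A> (\<lambda>i j. \<pi> (mat_of M $ i $ j)) r = (\<lambda>i j. \<pi> (mat_of (M ^ r) $ i $ j))"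
  by (induction r) (simp_all add: rmat_one_pres rmat_mult_pres assms power_Suc2 del: power_Suc)

lemma rser_mult_pres:
  assumes "\<And>r i j. mat_of (M r) $ i $ j \<in> FA X" "\<And>r i j. mat_of (N r) $ i $ j \<in> FA X"
  shows "rser_mult \<A> (\<lambda>r i j. \<pi> (mat_of (M r) $ i $ j)) (\<lambda>r i j. \<pi> (mat_of (N r) $ i $ j)) =
    (\<lambda>r i j. \<pi> (mat_of (\<Sum>m\<le>r. M m * N (r - m)) $ i $ j))"
proof -
  have "mat_of (M m * N (r - m)) $ i $ j \<in> FA X" for m r i j
    by (auto simp: mat_of_simps matrix_matrix_mult_def intro!: FA_sum FA_mult assms)
  then show ?thesis
    unfolding rser_mult_def
    by (intro ext) (simp add: rmat_mult_pres assms finsum_pres mat_of_sum)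
qed

lemma rser_linear_pres:
  "rser_linear \<A> (\<lambda>i j. \<pi> (mat_of M $ i $ j)) = (\<lambda>r i j. \<pi> (mat_of (linear_coeff M r) $ i $ j))"
  by (intro ext) (simp add: rser_linear_def linear_coeff_def rmat_one_pres zero_pres mat_of_simps)

end

lemma alg_hom_comp:
  assumes f: "f \<in> alg_hom A B" and g: "g \<in> alg_hom B C"
  shows "(\<lambda>x. g (f x)) \<in> alg_hom A C"
proof -
  have h: "f \<in> ring_hom A B" "g \<in> ring_hom B C"
    using f g by (simp_all add: alg_hom_def)
  show ?thesis
    using ring_hom_trans[OF h] ring_hom_closed[OF h(1)] f g by (simp add: alg_hom_def comp_def)
qed

lemma pair_add_right: "pair X (M + N) = pair X M + pair X N" "pair X (M - N) = pair X M - pair X N"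
  by (simp_all add: pair_def mat_of_simps algebra_simps sum.distrib sum_subtractf)

lemma pair_scalar: "pair X (mscale scal c 1) = scal (c * (\<Sum>i\<in>UNIV. X $ i $ i))"
proof -
  have "pair X (mscale scal c 1) = (\<Sum>i\<in>UNIV. \<Sum>j\<in>UNIV. mat 1 $ i $ j * scal (X $ i $ j * c))"
    by (simp add: pair_def mat_of_simps scal_mult mat_one_left_commute mat_one_commute[symmetric]
        flip: mult.assoc)
  then show ?thesis by (simp add: sum_mat_one scal_sum sum_distrib_left mult.commute)
qed

lemma pair_FA: "(\<And>i j. mat_of M $ i $ j \<in> FA Y) \<Longrightarrow> pair X M \<in> FA Y"
  unfolding pair_def by (intro FA_sum FA_mult) auto

lemma subst_pair: "subst g (pair X M) = pair X (sqmat (map_matrix (subst g) (mat_of M)))"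
  by (simp add: pair_def subst_sum subst_mult map_matrix_def)

context orthosymplectic
begin

text \<open>
  Pairing with \<open>F\<^sub>i\<^sub>j = E\<^sub>i\<^sub>j - \<dots>\<close> takes an entry of \<open>M - M'\<close>.
\<close>

lemma pair_Fmat: "pair (Fmat G i j) M = mat_of M $ i $ j - mat_of (smat G * tr M * smat Gi) $ i $ j"
proof -
  have "pair (Fmat G i j) M = (\<Sum>a\<in>UNIV. mat 1 $ a $ i * (\<Sum>b\<in>UNIV. mat 1 $ b $ j * mat_of M $ a $ b))
     - (\<Sum>a\<in>UNIV. \<Sum>b\<in>UNIV. scal (Gi $ a $ j * G $ i $ b) * mat_of M $ a $ b)"
    by (simp add: pair_def Fmat_entry scal_diff scal_mult scal_mat_one left_diff_distrib
        sum_subtractf sum_distrib_left mult.assoc)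
  also have "(\<Sum>a\<in>UNIV. \<Sum>b\<in>UNIV. scal (Gi $ a $ j * G $ i $ b) * mat_of M $ a $ b) = mat_of (smat G *
      tr M * smat Gi) $ i $ j"
    by (simp add: mat_of_simps matrix_matrix_mult_def sum_distrib_left sum_distrib_right
        mult.commute[of "Gi $ _ $ _"]
        scal_mult mult.assoc scal_commute[of _ "mat_of M $ _ $ _"]) (rule sum.swap)
  finally show ?thesis by (simp add: sum_mat_one)
qed

lemma S_series'_nth: "fps_nth (S_series' G $ i $ j) 1 = mat_of (smat G * tr Hgen * smat Gi) $ i $ j"
  by (simp add: S_series'_def const_matrix_def matrix_matrix_mult_def fps_sum_nth S_series_def
      transpose_def
      mat_of_simps Hgen_def)

sublocale B: presentation rgens "refl_rels (kappa \<epsilon> TYPE('n)) G"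
  by (rule presentation_refl)

text \<open>
  Defined on all matrices as a linear map with \<open>E\<^sub>i\<^sub>j \<mapsto> s\<^sub>i\<^sub>j\<^sup>(\<^sup>1\<^sup>) / 4\<close>, so that the linear
      relations between the
  \<open>F\<^sub>i\<^sub>j\<close> are respected automatically.  At \<open>F\<^sub>i\<^sub>j\<close> it takes the value
  \<open>(s\<^sub>i\<^sub>j\<^sup>(\<^sup>1\<^sup>) - s'\<^sub>i\<^sub>j\<^sup>(\<^sup>1\<^sup>)) / 4\<close>.
\<close>

definition phi_gen :: "complex^'n^'n \<Rightarrow> 'n rgen free_alg"
  where "phi_gen X = scal (1/4) * pair X Hgen"

lemma Hgen_FA: "mat_of Hgen $ i $ j \<in> FA rgens"
  by (auto simp: Hgen_def scoeff_def rgens_def intro!: FA_gen)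

lemma phi_gen_FA: "phi_gen X \<in> FA rgens"
  unfolding phi_gen_def by (intro FA_mult FA_scal pair_FA Hgen_FA)

lemma phi_relators:
  assumes "r \<in> env_rels (gN G)"
  shows "subst phi_gen r \<in> B.I"
proof -
  have 1: "phi_gen (x + y) = phi_gen x + phi_gen y" for x y
    by (simp add: phi_gen_def pair_add distrib_left)
  have 2: "phi_gen (cscale c x) = scal c * phi_gen x" for c x
    unfolding phi_gen_def pair_cscale by (rule scal_left_commute)
  have 3: "phi_gen x * phi_gen y - phi_gen y * phi_gen x - phi_gen (x ** y - y ** x) \<in> B.I"
    if "x \<in> gN G" "y \<in> gN G" for x y
  proof -
    have ss: "scal c * (scal d * a) = scal (c * d) * a" for c d and a :: "'n rgen free_alg"
      by (simp add: scal_mult mult.assoc)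
    have e: "scal (1/4) * a * (scal (1/4) * b) = scal (1/16) * (a * b)" for a b :: "'n rgen free_alg"
      by (simp add: mult.assoc scal_left_commute[of a] ss)
    have "scal (1/16) * (scal 4 * a) = scal (1/4) * a" for a :: "'n rgen free_alg"
      by (simp add: ss)
    then have "phi_gen x * phi_gen y - phi_gen y * phi_gen x - phi_gen (x ** y - y ** x) =
      scal (1/16) * (pair x Hgen * pair y Hgen - pair y Hgen * pair x Hgen - scal 4 * pair (x ** y -
          y ** x) Hgen)"
      by (simp only: phi_gen_def e right_diff_distrib)
    then show ?thesis using B.I_mult_left[OF Hgen_commutator[OF that] FA_scal] by simp
  qed
  show ?thesis
    using assms unfolding env_rels_def
    by (elim UnE CollectE exE conjE)
      (simp_all only: subst_diff subst_mult subst_gen subst_scal 1 2 3, simp_all add: B.I_0)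
qed

lemma FU_pres: "FU G i j = U.\<pi> (mat_of Flift $ i $ j)"
  unfolding FU_def
  by (subst U.cls_eq_iff) (use U.I_minus[OF Flift_gen[of i j]] in \<open>auto intro: FA_gen Flift_FA\<close>)

lemma Ashift_FA: "mat_of Ashift $ i $ j \<in> FA (gN G)"
  using Ashift_power_FA[of 1] by simp

lemma F_shifted_pres: "F_shifted G = (\<lambda>i j. U.\<pi> (mat_of Ashift $ i $ j))"
proof (intro ext)
  fix i j :: 'n
  have "(mat_of 1 $ i $ j :: (complex^'n^'n) free_alg) \<in> FA (gN G)"
    using Ashift_power_FA[of 0 i j] by simp
  then show "F_shifted G i j = U.\<pi> (mat_of Ashift $ i $ j)"
    unfolding F_shifted_def UgN_def
    by (simp add: FU_pres U.rmat_one_pres U.smult_pres U.diff_pres Flift_FA FA_mult Ashift_def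
        mat_of_simps)
qed

lemma eval_series_pres: "eval_series G = (\<lambda>r i j. U.\<pi> (mat_of (cayley_coeff Ashift r) $ i $ j))"
proof (intro ext)
  fix r and i j :: 'n
  have two: "scal 2 * x = x + x" for x :: "(complex^'n^'n) free_alg"
  proof -
    have "scal 2 = scal 1 + (scal 1 :: (complex^'n^'n) free_alg)" by (simp flip: scal_add del: scal_1)
    then show ?thesis by (simp only: scal_1 distrib_right mult_1)
  qed
  then show "eval_series G r i j = U.\<pi> (mat_of (cayley_coeff Ashift r) $ i $ j)"
    unfolding eval_series_def UgN_def F_shifted_pres U.rmat_pow_pres[OF Ashift_FA Ashift_power_FA]
    by (auto simp: U.rmat_one_pres U.smult_pres Ashift_power_FA cayley_coeff_def mat_of_simps two
        simp del: scal_1)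
qed

lemma cayley_fraction: "is_cayley_fraction (UgN G) (F_shifted G) (eval_series G)"
proof -
  have "(\<lambda>i j. \<ominus>\<^bsub>U.\<A>\<^esub> U.\<pi> (mat_of Ashift $ i $ j)) = (\<lambda>i j. U.\<pi> (mat_of (- Ashift) $ i $ j))"
    by (intro ext) (simp add: U.minus_pres Ashift_FA mat_of_simps)
  moreover have "mat_of (linear_coeff (- Ashift) r) $ i $ j \<in> FA (gN G)" for r i j
    by (auto simp: linear_coeff_def mat_of_simps mat_def intro: Ashift_FA)
  ultimately show ?thesis
    unfolding is_cayley_fraction_def UgN_def F_shifted_pres eval_series_pres
    by (simp add: U.rser_linear_pres U.rser_mult_pres cayley_coeff_FA cayley_linear)
qed

text \<open>
  The \<open>F\<^sub>i\<^sub>j\<close> span the Lie algebra, so their classes generate the enveloping algebra.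
\<close>

lemma hom_agree_on_gN:
  assumes P: "presentation Y \<S>"
    and h: "h \<in> alg_hom (UgN G) (presented_algebra Y \<S>)" and h': "h' \<in> alg_hom (UgN G)
        (presented_algebra Y \<S>)"
    and eq: "\<And>i j. h (FU G i j) = h' (FU G i j)" and x: "x \<in> carrier (UgN G)"
  shows "h x = h' x"
proof -
  note h = h[unfolded UgN_def] and h' = h'[unfolded UgN_def]
  note v = alg_hom_values[OF U.presentation_axioms P h] and v' = alg_hom_values[OF
      U.presentation_axioms P h']
  have "h (U.\<pi> (gen X)) = h' (U.\<pi> (gen X))" if X: "X \<in> gN G" for X
  proof -
    let ?c = "\<lambda>p. X $ fst p $ snd p / 2" and ?F = "\<lambda>p. Fmat G (fst p) (snd p)"
    have "X = cscale (1/2) (X - \<theta> X)" using X by (simp add: gN_iff vec_eq_iff)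
    also have "\<dots> = (\<Sum>p\<in>UNIV. cscale (?c p) (?F p))"
      unfolding expand_Fmat by (simp add: sum_pair cs.scale_sum_right)
    finally have "gen X - (\<Sum>p\<in>UNIV. scal (?c p) * gen (?F p)) \<in> U.I"
      using gen_sum[of UNIV ?F ?c] by simp
    then have X: "U.\<pi> (gen X) = U.\<pi> (\<Sum>p\<in>UNIV. scal (?c p) * gen (?F p))"
      using X by (subst U.cls_eq_iff) (auto intro!: FA_gen FA_sum FA_mult)
    have g: "gen (?F p) \<in> FA (gN G)" for p by (rule FA_gen) simp
    have "h (U.\<pi> (scal (?c p) * gen (?F p))) = h' (U.\<pi> (scal (?c p) * gen (?F p)))" for p
      using eq[of "fst p" "snd p"] by (simp add: v v' g FU_def)
    then have "h (U.\<pi> (\<Sum>p\<in>S. scal (?c p) * gen (?F p))) = h' (U.\<pi> (\<Sum>p\<in>S. scal (?c p) * gen (?F p)))"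
        for S
    proof (induction S rule: infinite_finite_induct)
      case (insert p S)
      then show ?case by (simp add: v v' g FA_mult FA_sum)
    qed (use v(3)[of 0] v'(3)[of 0] in simp_all)
    then show ?thesis unfolding X .
  qed
  then show ?thesis
    using alg_hom_unique[OF U.presentation_axioms P h h'] x by (simp add: UgN_def)
qed

text \<open>
  The left inverse sends \<open>h(F\<^sub>i\<^sub>j) / 4\<close> to half of an entry of \<open>A - A'\<close>.  Here \<open>A' = - F - N/4\<close>, so
  this entry is \<open>2 F\<^sub>i\<^sub>j\<close>.
\<close>

lemma embedding_and_retraction:
  "\<exists>\<phi> \<psi>.
    unique_alg_hom (UgN G) (BgN \<epsilon> G)
      (\<lambda>h. \<forall>i j. h (FU G i j) =
        (1/4) \<odot>\<^bsub>BgN \<epsilon> G\<^esub> (sB \<epsilon> G i j 1 \<ominus>\<^bsub>BgN \<epsilon> G\<^esub> sB' \<epsilon> G i j 1)) \<phi> \<and>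
    inj_on \<phi> (carrier (UgN G)) \<and>
    is_cayley_fraction (UgN G) (F_shifted G) (eval_series G) \<and>
    unique_alg_hom (BgN \<epsilon> G) (UgN G)
      (\<lambda>h. \<forall>i j r. h (sB \<epsilon> G i j r) = eval_series G r i j) \<psi> \<and>
    (\<forall>x \<in> carrier (UgN G). \<psi> (\<phi> x) = x)"
proof -
  note UP = U.presentation_axioms and BP = B.presentation_axioms
  obtain \<phi> where \<phi>: "\<phi> \<in> alg_hom U.\<A> B.\<A>" "\<And>p. p \<in> FA (gN G) \<Longrightarrow> \<phi> (U.\<pi> p) = B.\<pi> (subst phi_gen p)"
    using alg_hom_exists[OF UP BP phi_gen_FA phi_relators] by blast
  have psi_FA: "psi_gen x \<in> FA (gN G)" for x by (cases x) (simp add: psi_gen_def cayley_coeff_FA)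
  obtain \<psi> where \<psi>: "\<psi> \<in> alg_hom B.\<A> U.\<A>" "\<And>p. p \<in> FA rgens \<Longrightarrow> \<psi> (B.\<pi> p) = U.\<pi> (subst psi_gen p)"
    using alg_hom_exists[OF BP UP psi_FA psi_relators] by blast
  have H: "mat_of Hgen $ i $ j = scoeff i j 1" for i j by (simp add: Hgen_def)
  have s_FA: "scoeff i j r \<in> FA rgens" for i j :: 'n and r
    by (auto simp: scoeff_def rgens_def intro!: FA_gen)
  have \<phi>F: "\<phi> (FU G i j) = B.\<pi> (phi_gen (Fmat G i j))" for i j
    unfolding FU_def by (subst \<phi>) (auto intro: FA_gen)
  have image: "(1/4) \<odot>\<^bsub>BgN \<epsilon> G\<^esub> (sB \<epsilon> G i j 1 \<ominus>\<^bsub>BgN \<epsilon> G\<^esub> sB' \<epsilon> G i j 1) = B.\<pi> (phi_gen (Fmat G i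
      j))" for i j
  proof -
    have e: "pair (Fmat G i j) Hgen = scoeff i j 1 - fps_nth (S_series' G $ i $ j) 1"
      unfolding pair_Fmat S_series'_nth H ..
    have "fps_nth (S_series' G $ i $ j) 1 = scoeff i j 1 - pair (Fmat G i j) Hgen" unfolding e by simp
    then have "fps_nth (S_series' G $ i $ j) 1 \<in> FA rgens"
      by (simp only:) (intro FA_diff s_FA pair_FA Hgen_FA)
    then show ?thesis
      unfolding BgN_def sB_def sB'_def phi_gen_def e
      by (simp add: B.diff_pres B.smult_pres s_FA FA_diff)
  qed
  have \<psi>s: "\<psi> (sB \<epsilon> G i j r) = eval_series G r i j" for i j r
    unfolding sB_def eval_series_pres by (simp add: \<psi> s_FA subst_psi_scoeff)
  have \<phi>_unique: "unique_alg_hom (UgN G) (BgN \<epsilon> G)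
      (\<lambda>h. \<forall>i j. h (FU G i j) =
        (1/4) \<odot>\<^bsub>BgN \<epsilon> G\<^esub> (sB \<epsilon> G i j 1 \<ominus>\<^bsub>BgN \<epsilon> G\<^esub> sB' \<epsilon> G i j 1)) \<phi>"
    unfolding unique_alg_hom_def image
  proof (intro conjI ballI impI allI)
    show \<phi>': "\<phi> \<in> alg_hom (UgN G) (BgN \<epsilon> G)" using \<phi>(1) by (simp add: UgN_def BgN_def)
    fix h x assume "h \<in> alg_hom (UgN G) (BgN \<epsilon> G)" "\<forall>i j. h (FU G i j) = B.\<pi> (phi_gen (Fmat G i j))"
        "x \<in> carrier (UgN G)"
    with \<phi>' show "h x = \<phi> x"
      using hom_agree_on_gN[OF BP, of h \<phi> x] \<phi>F by (simp add: BgN_def)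
  qed (rule \<phi>F)
  have \<psi>_unique: "unique_alg_hom (BgN \<epsilon> G) (UgN G) (\<lambda>h. \<forall>i j r. h (sB \<epsilon> G i j r) = eval_series G r i
      j) \<psi>"
    unfolding unique_alg_hom_def
  proof (intro conjI ballI impI allI)
    show "\<psi> \<in> alg_hom (BgN \<epsilon> G) (UgN G)" using \<psi>(1) by (simp add: UgN_def BgN_def)
    fix h x assume h: "h \<in> alg_hom (BgN \<epsilon> G) (UgN G)" "\<forall>i j r. h (sB \<epsilon> G i j r) = eval_series G r i
        j" "x \<in> carrier (BgN \<epsilon> G)"
    have eq: "h (B.\<pi> (gen y)) = \<psi> (B.\<pi> (gen y))" if yin: "y \<in> rgens" for y
    proof -
      obtain i j r where y: "y = (i, j, r)" "r \<ge> 1" using yin by (auto simp: rgens_def)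
      then have "B.\<pi> (gen y) = sB \<epsilon> G i j r" by (simp add: sB_def scoeff_def)
      then show ?thesis by (simp only: h(2)[rule_format] \<psi>s)
    qed
    show "h x = \<psi> x"
      by (rule alg_hom_unique[OF BP UP h(1)[unfolded BgN_def UgN_def] \<psi>(1) eq h(3)[unfolded BgN_def]])
  qed (rule \<psi>s)
  have retract: "\<psi> (\<phi> x) = x" if x: "x \<in> carrier (UgN G)" for x
  proof -
    have "(\<lambda>x. \<psi> (\<phi> x)) \<in> alg_hom (UgN G) U.\<A>"
      unfolding UgN_def by (rule alg_hom_comp[OF \<phi>(1) \<psi>(1)])
    moreover have "(\<lambda>x. x) \<in> alg_hom (UgN G) U.\<A>"
      by (auto simp: alg_hom_def ring_hom_def UgN_def)
    moreover have "\<psi> (\<phi> (FU G i j)) = FU G i j" for i j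
    proof -
      have "sqmat (map_matrix (subst psi_gen) (mat_of Hgen)) = Ashift + Ashift"
        unfolding sqmat_eq_iff by (simp only: mat_of_sqmat map_matrix_def vec_lambda_beta H
            subst_psi_scoeff)
          (simp add: cayley_coeff_def)
      moreover have "pair (Fmat G i j) Ashift = mat_of Flift $ i $ j + mat_of Flift $ i $ j"
        by (simp add: Ashift_def pair_add_right pair_scalar Fmat_trace pair_Fmat Flift_antisym
            mat_of_simps)
      moreover have "scal (1/4) * (a + a + (a + a)) = a" for a :: "(complex^'n^'n) free_alg"
      proof -
        have "scal (1/4) * (a + a + (a + a)) = scal (1/4 + 1/4 + (1/4 + 1/4)) * a"
          by (simp only: scal_add distrib_left distrib_right)
        then show ?thesis by simp
      qed
      ultimately have "subst psi_gen (phi_gen (Fmat G i j)) = mat_of Flift $ i $ j"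
        by (simp only: phi_gen_def subst_mult subst_scal subst_pair pair_add_right)
      then show ?thesis unfolding \<phi>F \<psi>(2)[OF phi_gen_FA] by (simp only: FU_pres)
    qed
    ultimately show ?thesis using hom_agree_on_gN[OF UP, of "\<lambda>x. \<psi> (\<phi> x)" "\<lambda>x. x" x] x by simp
  qed
  then have "inj_on \<phi> (carrier (UgN G))" by (metis inj_onI)
  then show ?thesis using \<phi>_unique \<psi>_unique cayley_fraction retract by blast
qed

end

theorem corollary3p7:
  fixes G :: "complex^'n::finite^'n" and \<epsilon> :: complex
  assumes nonsing: "invertible G"
    and sign: "(\<epsilon> = 1 \<and> transpose G = G) \<or> (\<epsilon> = -1 \<and> transpose G = - G \<and> even CARD('n))"
  shows "\<exists>\<phi> \<psi>.
    unique_alg_hom (UgN G) (BgN \<epsilon> G)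
      (\<lambda>h. \<forall>i j. h (FU G i j) =
        (1/4) \<odot>\<^bsub>BgN \<epsilon> G\<^esub> (sB \<epsilon> G i j 1 \<ominus>\<^bsub>BgN \<epsilon> G\<^esub> sB' \<epsilon> G i j 1)) \<phi> \<and>
    inj_on \<phi> (carrier (UgN G)) \<and>
    is_cayley_fraction (UgN G) (F_shifted G) (eval_series G) \<and>
    unique_alg_hom (BgN \<epsilon> G) (UgN G)
      (\<lambda>h. \<forall>i j r. h (sB \<epsilon> G i j r) = eval_series G r i j) \<psi> \<and>
    (\<forall>x \<in> carrier (UgN G). \<psi> (\<phi> x) = x)"
proof -
  interpret orthosymplectic G \<epsilon> by standard (rule nonsing, rule sign)
  show ?thesis by (rule embedding_and_retraction)
qed

end
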